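(* Let $m\in\mathbb{R}$, $m\neq0$. For $s=1,\dots,7$ let $S_s$ be a solvable Lie group with Lie algebra $\mathfrak{cp}_s^m$ (structure equations in the context, with respect to a basis $\{e^1,\dots,e^7\}$ of left-invariant $1$-forms), and let $\varphi(t)$ be the following family of left-invariant $\mathrm{G}_2$-structures on $S_s$: $\mathfrak{cp}_1^m$: for $t\in(-\infty,\frac{1}{4m^2})$, $\varphi(t)=(1-4m^2t)^2(e^{127}+e^{347}+e^{567})+(1-4m^2t)^{\frac94}(e^{135}-e^{146}-e^{236}-e^{245})$. $\mathfrak{cp}_2^m$: for $t\in(-\infty,\frac{3}{10m^2})$, $\varphi(t)=(1-\frac{10}{3}m^2t)^{\frac{11}{5}}(e^{127}-e^{236})+(1-\frac{10}{3}m^2t)^{2}(e^{347}+e^{567})+(1-\frac{10}{3}m^2t)^{\frac{12}{5}}(e^{135}-e^{146}-e^{245})$. $\mathfrak{cp}_3^m$: for $t\in(-\infty,\frac{1}{3m^2})$, $\varphi(t)=(1-3m^2t)^{\frac{7}{3}}(e^{127}-e^{236}-e^{245})+(1-3m^2t)^{2}(e^{347}+e^{567})+(1-3m^2t)^{\frac{5}{2}}(e^{135}-e^{146})$. $\mathfrak{cp}_4^m$: for $t\in(-\infty,\frac{5}{14m^2})$, $\varphi(t)=(1-\frac{14}{5}m^2t)^{\frac{17}{7}}(e^{127}-e^{146}-e^{236}-e^{245})+(1-\frac{14}{5}m^2t)^{2}(e^{347}+e^{567})+(1-\frac{14}{5}m^2t)^{\frac{18}{7}}e^{135}$. $\mathfrak{cp}_5^m$: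 for $t\in(-\infty,\frac{1}{3m^2})$, $\varphi(t)=(1-3m^2t)^{\frac{7}{3}}(e^{127}-e^{146}-e^{245})+(1-3m^2t)^{2}(e^{347}+e^{567})+(1-3m^2t)^{\frac{5}{2}}(e^{135}-e^{236})$. $\mathfrak{cp}_6^m$: for $t\in(-\infty,\frac{3}{8m^2})$, $\varphi(t)=(1-\frac{8}{3}m^2t)^{\frac{5}{2}}(e^{127}+e^{135}-e^{146}-e^{236}-e^{245})+(1-\frac{8}{3}m^2t)^{2}(e^{347}+e^{567})$. $\mathfrak{cp}_7^m$: for $t\in(-\infty,\frac{5}{14m^2})$, $\varphi(t)=(1-\frac{14}{5}m^2t)^{\frac{15}{7}}(e^{127}+e^{347}+e^{567}-e^{236})+(1-\frac{14}{5}m^2t)^{\frac{18}{7}}(e^{135}-e^{146}-e^{245})$. Then, for each $s$ and each $t$ in the corresponding interval, the $\mathrm{G}_2$-structure $\varphi(t)$ is a Laplacian soliton of shrinking type; that is, there exist a real number $\lambda<0$ and a vector field $X$ on $S_s$ (both possibly depending on $t$) with $$\Delta_t\varphi(t)=\lambda\,\varphi(t)+\mathcal{L}_X\varphi(t).$$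
   Context: Notation: $e^{i_1\dots i_k}=e^{i_1}\wedge\dots\wedge e^{i_k}$. A Lie algebra is described by the tuple $(de^1,\dots,de^7)$ of exterior derivatives of a basis of its dual: \begin{align*} \mathfrak{cp}^m_1 &= (-me^{17}, -m e^{27}, -me^{37}, -m e^{47}, -me^{57}, -m e^{67}, 0);\\ \mathfrak{cp}^m_2 &= \big(-\tfrac43m e^{17}+\tfrac23me^{36}, -m e^{27}, -\tfrac23me^{37}, -m e^{47}, -me^{57}, -\tfrac23 m e^{67}, 0\big);\\ \mathfrak{cp}^m_3 &= \big(-\tfrac32m e^{17}+\tfrac12 m e^{36}+\tfrac12 m e^{45}, -m e^{27}, -\tfrac34me^{37}, -\tfrac34 m e^{47}, -\tfrac34me^{57}, -\tfrac34m e^{67}, 0\big);\\ \mathfrak{cp}^m_4 &= \big(-\tfrac75m e^{17}+\tfrac25 m e^{36}+\tfrac25 m e^{45}, -\tfrac65m e^{27}-\tfrac25m e^{46}, -\tfrac45me^{37}, -\tfrac35 m e^{47}, -\tfrac45me^{57},-\tfrac35m e^{67}, 0\big);\\ \mathfrak{cp}^m_5 &= \big(-\tfrac54 m e^{17}+\tfrac12 m e^{45}, -\tfrac54m e^{27}-\tfrac12m e^{46}, -me^{37}, -\tfrac12 m e^{47}, -\tfrac34me^{57}, -\tfrac34m e^{67}, 0\big);\\ \mathfrak{cp}^m_6 &= \big(-\tfrac43m e^{17}+\tfrac13 m e^{36}+\tfrac13 m e^{45}, -\tfrac43m e^{27}+\tfrac13m e^{35}-\tfrac13 m e^{46}, -\tfrac23me^{37},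 -\tfrac23 m e^{47}, -\tfrac23me^{57}, -\tfrac23m e^{67}, 0\big);\\ \mathfrak{cp}^m_7 &= \big(-\tfrac65m e^{17}+\tfrac25 m e^{36}, -\tfrac35m e^{27}, -\tfrac35me^{37}, \tfrac25 m e^{26}-\tfrac65 m e^{47}, \tfrac25 m e^{23}-\tfrac65me^{57}, -\tfrac35m e^{67}, 0\big). \end{align*} A $\mathrm{G}_2$-structure on a $7$-manifold is given by a $3$-form $\varphi$ which, with respect to some local basis of $1$-forms $\{x^1,\dots,x^7\}$ (an adapted basis), is $\varphi=x^{127}+x^{347}+x^{567}+x^{135}-x^{146}-x^{236}-x^{245}$. It induces the Riemannian metric $g_\varphi$ and the orientation for which $\{x^1,\dots,x^7\}$ is an oriented orthonormal coframe. $\Delta_t$ denotes the Hodge Laplacian $dd^{*}+d^{*}d$ of the metric $g_{\varphi(t)}$, and $\mathcal{L}_X$ the Lie derivative. *)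

theory Defs
  imports "HOL-Analysis.Analysis"
begin

section \<open>Smooth manifolds and Lie groups\<close>

text \<open>All the sets \<^term>\<open>U\<close> below are open, so differentiability may be taken at points.\<close>

primrec Ck_on :: "nat \<Rightarrow> 'a::real_normed_vector set \<Rightarrow> ('a \<Rightarrow> 'b::real_normed_vector) \<Rightarrow> bool" where
  "Ck_on 0 U f \<longleftrightarrow> continuous_on U f"
| "Ck_on (Suc k) U f \<longleftrightarrow> (\<forall>x\<in>U. f differentiable (at x)) \<and>
     (\<forall>v. Ck_on k U (\<lambda>x. frechet_derivative f (at x) v))"

definition smooth_on :: "'a::real_normed_vector set \<Rightarrow> ('a \<Rightarrow> 'b::real_normed_vector) \<Rightarrow> bool" where
  "smooth_on U f \<longleftrightarrow> (\<forall>k. Ck_on k U f)"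

type_synonym ('a, 'e) atlas = "('a set \<times> ('a \<Rightarrow> 'e)) set"

text \<open>The manifold is the whole type \<^typ>\<open>'a\<close>; its dimension is that of the model space \<^typ>\<open>'e\<close>.\<close>

definition smooth_atlas ::
  "('a::{t2_space,second_countable_topology}, 'e::euclidean_space) atlas \<Rightarrow> bool" where
  "smooth_atlas A \<longleftrightarrow>
     (\<Union>(U, \<phi>)\<in>A. U) = UNIV \<and>
     (\<forall>(U, \<phi>)\<in>A. open U \<and> open (\<phi> ` U) \<and> homeomorphism U (\<phi> ` U) \<phi> (inv_into U \<phi>)) \<and>
     (\<forall>(U, \<phi>)\<in>A. \<forall>(V, \<psi>)\<in>A. smooth_on (\<phi> ` (U \<inter> V)) (\<psi> \<circ> inv_into U \<phi>))"

definition smooth_map ::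
  "('a::topological_space, 'e::euclidean_space) atlas \<Rightarrow>
   ('b::topological_space, 'f::euclidean_space) atlas \<Rightarrow> ('a \<Rightarrow> 'b) \<Rightarrow> bool" where
  "smooth_map A B f \<longleftrightarrow> continuous_on UNIV f \<and>
     (\<forall>(U, \<phi>)\<in>A. \<forall>(V, \<psi>)\<in>B. smooth_on (\<phi> ` (U \<inter> f -` V)) (\<psi> \<circ> f \<circ> inv_into U \<phi>))"

definition prod_atlas :: "('a, 'e) atlas \<Rightarrow> ('b, 'f) atlas \<Rightarrow> ('a \<times> 'b, 'e \<times> 'f) atlas" where
  "prod_atlas A B = {(U \<times> V, map_prod \<phi> \<psi>) | U \<phi> V \<psi>. (U, \<phi>) \<in> A \<and> (V, \<psi>) \<in> B}"

definition smooth_fun :: "('a::topological_space, 'e::euclidean_space) atlas \<Rightarrow> ('a \<Rightarrow> real) set" where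
  "smooth_fun A = {f. smooth_map A {(UNIV, \<lambda>x::real. x)} f}"

definition lie_group ::
  "('a::{t2_space,second_countable_topology}, 'e::euclidean_space) atlas \<Rightarrow>
   ('a \<Rightarrow> 'a \<Rightarrow> 'a) \<Rightarrow> 'a \<Rightarrow> ('a \<Rightarrow> 'a) \<Rightarrow> bool" where
  "lie_group A mul one ginv \<longleftrightarrow> smooth_atlas A \<and> group mul one ginv \<and>
     smooth_map (prod_atlas A A) A (\<lambda>(g, h). mul g h) \<and> smooth_map A A ginv"

section \<open>Vector fields and the Lie algebra\<close>

text \<open>
  Vector fields are derivations of the algebra of smooth functions, tangent vectors at \<^term>\<open>p\<close>
  are derivations at \<^term>\<open>p\<close>. Both are normalised to vanish on functions that are not smooth,
  so that equality of derivations is equality of HOL functions.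
\<close>

type_synonym 'a vfield = "('a \<Rightarrow> real) \<Rightarrow> 'a \<Rightarrow> real"

definition vector_fields :: "('a::topological_space, 'e::euclidean_space) atlas \<Rightarrow> 'a vfield set" where
  "vector_fields A = {X.
     (\<forall>f. f \<notin> smooth_fun A \<longrightarrow> X f = (\<lambda>p. 0)) \<and>
     (\<forall>f\<in>smooth_fun A. X f \<in> smooth_fun A) \<and>
     (\<forall>f\<in>smooth_fun A. \<forall>g\<in>smooth_fun A. \<forall>a b::real.
        X (\<lambda>p. a * f p + b * g p) = (\<lambda>p. a * X f p + b * X g p)) \<and>
     (\<forall>f\<in>smooth_fun A. \<forall>g\<in>smooth_fun A.
        X (\<lambda>p. f p * g p) = (\<lambda>p. f p * X g p + g p * X f p))}"

definition tangent_space ::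
  "('a::topological_space, 'e::euclidean_space) atlas \<Rightarrow> 'a \<Rightarrow> (('a \<Rightarrow> real) \<Rightarrow> real) set" where
  "tangent_space A p = {v.
     (\<forall>f. f \<notin> smooth_fun A \<longrightarrow> v f = 0) \<and>
     (\<forall>f\<in>smooth_fun A. \<forall>g\<in>smooth_fun A. \<forall>a b::real.
        v (\<lambda>q. a * f q + b * g q) = a * v f + b * v g) \<and>
     (\<forall>f\<in>smooth_fun A. \<forall>g\<in>smooth_fun A. v (\<lambda>q. f q * g q) = f p * v g + g p * v f)}"

definition bracket :: "'a vfield \<Rightarrow> 'a vfield \<Rightarrow> 'a vfield" where
  "bracket X Y = (\<lambda>f p. X (Y f) p - Y (X f) p)"

definition left_invariant ::
  "('a::topological_space, 'e::euclidean_space) atlas \<Rightarrow> ('a \<Rightarrow> 'a \<Rightarrow> 'a) \<Rightarrow> 'a vfield \<Rightarrow> bool" where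
  "left_invariant A mul X \<longleftrightarrow>
     (\<forall>g. \<forall>f\<in>smooth_fun A. X (\<lambda>p. f (mul g p)) = (\<lambda>p. X f (mul g p)))"

text \<open>
  \<open>E\<^sub>1,\<dots>,E\<^sub>n\<close> is a basis of the Lie algebra: left-invariant vector fields whose values at
  the identity form a basis of the tangent space there.
\<close>

definition lie_algebra_basis ::
  "('a::topological_space, 'e::euclidean_space) atlas \<Rightarrow> ('a \<Rightarrow> 'a \<Rightarrow> 'a) \<Rightarrow> 'a \<Rightarrow>
   (nat \<Rightarrow> 'a vfield) \<Rightarrow> bool" where
  "lie_algebra_basis A mul one E \<longleftrightarrow>
     (\<forall>i\<in>{1..DIM('e)}. E i \<in> vector_fields A \<and> left_invariant A mul (E i)) \<and>
     (\<forall>v\<in>tangent_space A one. \<exists>!c. c \<in> extensional {1..DIM('e)} \<and>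
        (\<forall>f\<in>smooth_fun A. v f = (\<Sum>i=1..DIM('e). c i * E i f one)))"

section \<open>Differential forms\<close>

text \<open>
  A \<open>k\<close>-form is an alternating map on \<open>k\<close>-tuples (lists of length \<open>k\<close>) of vector fields that is
  multilinear over the smooth functions; it is normalised to vanish on all other lists.
\<close>

type_synonym 'a form = "'a vfield list \<Rightarrow> 'a \<Rightarrow> real"

definition forms :: "('a::topological_space, 'e::euclidean_space) atlas \<Rightarrow> nat \<Rightarrow> 'a form set" where
  "forms A k = {\<omega>.
     (\<forall>Xs. \<not> (length Xs = k \<and> set Xs \<subseteq> vector_fields A) \<longrightarrow> \<omega> Xs = (\<lambda>p. 0)) \<and>
     (\<forall>Xs. length Xs = k \<and> set Xs \<subseteq> vector_fields A \<longrightarrow> \<omega> Xs \<in> smooth_fun A) \<and>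
     (\<forall>Xs. \<forall>i<k. \<forall>Y\<in>vector_fields A. \<forall>Z\<in>vector_fields A. \<forall>f\<in>smooth_fun A. \<forall>g\<in>smooth_fun A.
        length Xs = k \<and> set Xs \<subseteq> vector_fields A \<longrightarrow>
        \<omega> (Xs[i := (\<lambda>h p. f p * Y h p + g p * Z h p)])
          = (\<lambda>p. f p * \<omega> (Xs[i := Y]) p + g p * \<omega> (Xs[i := Z]) p)) \<and>
     (\<forall>Xs. \<forall>i<k. \<forall>j<k. i \<noteq> j \<and> length Xs = k \<and> set Xs \<subseteq> vector_fields A \<and> Xs ! i = Xs ! j
        \<longrightarrow> \<omega> Xs = (\<lambda>p. 0))}"

text \<open>
  Sum over shuffles: \<^term>\<open>S\<close> is the set of positions whose entries are fed to \<^term>\<open>\<alpha>\<close>. Hence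
  \<open>(\<alpha>\<^sub>1 \<and> \<dots> \<and> \<alpha>\<^sub>k) (X\<^sub>1,\<dots>,X\<^sub>k) = det (\<alpha>\<^sub>i X\<^sub>j)\<close> for 1-forms, without factorials.
\<close>

definition wedge :: "'a form \<Rightarrow> 'a form \<Rightarrow> 'a form" where
  "wedge \<alpha> \<beta> = (\<lambda>Xs p. \<Sum>S\<in>Pow {..<length Xs}.
     (-1) ^ card {(i, j). i \<in> S \<and> j < i \<and> j \<notin> S} * \<alpha> (nths Xs S) p * \<beta> (nths Xs (- S)) p)"

definition wedges :: "'a form list \<Rightarrow> 'a form" where
  "wedges \<alpha>s = foldr wedge \<alpha>s (\<lambda>Xs p. if Xs = [] then 1 else 0)"

text \<open>The invariant (Koszul) formula, in the convention \<open>d\<alpha> (X, Y) = X (\<alpha> Y) - Y (\<alpha> X) - \<alpha> [X, Y]\<close>.\<close>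

definition ext_d :: "('a::topological_space, 'e::euclidean_space) atlas \<Rightarrow> 'a form \<Rightarrow> 'a form" where
  "ext_d A \<omega> = (\<lambda>Xs p. if set Xs \<subseteq> vector_fields A then
     (\<Sum>i<length Xs. (-1) ^ i * (Xs ! i) (\<omega> (nths Xs (- {i}))) p) +
     (\<Sum>j<length Xs. \<Sum>i<j.
        (-1) ^ (i + j) * \<omega> (bracket (Xs ! i) (Xs ! j) # nths Xs (- {i, j})) p)
     else 0)"

definition lie_derivative ::
  "('a::topological_space, 'e::euclidean_space) atlas \<Rightarrow> 'a vfield \<Rightarrow> 'a form \<Rightarrow> 'a form" where
  "lie_derivative A X \<omega> = (\<lambda>Ys p. if set Ys \<subseteq> vector_fields A then
     X (\<omega> Ys) p - (\<Sum>i<length Ys. \<omega> (Ys[i := bracket X (Ys ! i)]) p) else 0)"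

section \<open>Hodge theory\<close>

type_synonym 'a metric = "'a vfield \<Rightarrow> 'a vfield \<Rightarrow> 'a \<Rightarrow> real"

definition flat :: "'a metric \<Rightarrow> 'a vfield \<Rightarrow> 'a form" where
  "flat g X = (\<lambda>Ys. case Ys of [Y] \<Rightarrow> g X Y | _ \<Rightarrow> (\<lambda>p. 0))"

text \<open>
  \<open>\<alpha> \<and> \<star>\<omega> = \<langle>\<alpha>, \<omega>\<rangle> vol\<close> for the forms \<open>\<alpha> = Y\<^sub>1\<^sup>\<flat> \<and> \<dots> \<and> Y\<^sub>k\<^sup>\<flat>\<close>, which span all \<open>k\<close>-forms, and for which
  the inner product is \<open>\<langle>\<alpha>, \<omega>\<rangle> = \<omega> (Y\<^sub>1,\<dots>,Y\<^sub>k)\<close>.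
\<close>

definition hodge_star ::
  "('a::topological_space, 'e::euclidean_space) atlas \<Rightarrow> 'a metric \<Rightarrow> 'a form \<Rightarrow> nat \<Rightarrow> 'a form \<Rightarrow> 'a form"
  where
  "hodge_star A g vol k \<omega> = (THE \<eta>. \<eta> \<in> forms A (DIM('e) - k) \<and>
     (\<forall>Ys. length Ys = k \<and> set Ys \<subseteq> vector_fields A \<longrightarrow>
        wedge (wedges (map (flat g) Ys)) \<eta> = (\<lambda>Xs p. \<omega> Ys p * vol Xs p)))"

text \<open>The codifferential \<open>d\<^sup>*\<close> on \<open>k\<close>-forms, with the sign making it the formal adjoint of \<open>d\<close>.\<close>

definition codiff ::
  "('a::topological_space, 'e::euclidean_space) atlas \<Rightarrow> 'a metric \<Rightarrow> 'a form \<Rightarrow> nat \<Rightarrow> 'a form \<Rightarrow> 'a form"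
  where
  "codiff A g vol k \<omega> = (\<lambda>Xs p. if 1 \<le> k \<and> k \<le> DIM('e) then
     (-1) ^ (DIM('e) * (k + 1) + 1) *
       hodge_star A g vol (DIM('e) - k + 1) (ext_d A (hodge_star A g vol k \<omega>)) Xs p
     else 0)"

definition hodge_laplacian ::
  "('a::topological_space, 'e::euclidean_space) atlas \<Rightarrow> 'a metric \<Rightarrow> 'a form \<Rightarrow> nat \<Rightarrow> 'a form \<Rightarrow> 'a form"
  where
  "hodge_laplacian A g vol k \<omega> = (\<lambda>Xs p.
     ext_d A (codiff A g vol k \<omega>) Xs p + codiff A g vol (k + 1) (ext_d A \<omega>) Xs p)"

section \<open>G2-structures and Laplacian solitons\<close>

text \<open>Each pair \<open>(c, [i\<^sub>1,\<dots>,i\<^sub>k])\<close> contributes \<open>c\<close> times the wedge product of the forms numbered \<open>i\<^sub>1,\<dots>,i\<^sub>k\<close>.\<close>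

definition lin_form :: "(nat \<Rightarrow> 'a form) \<Rightarrow> (real \<times> nat list) list \<Rightarrow> 'a form" where
  "lin_form e cs = (\<lambda>Xs p. \<Sum>(c, I)\<leftarrow>cs. c * wedges (map e I) Xs p)"

definition g2_std :: "(nat \<Rightarrow> 'a form) \<Rightarrow> 'a form" where
  "g2_std x = lin_form x [(1, [1,2,7]), (1, [3,4,7]), (1, [5,6,7]),
     (1, [1,3,5]), (-1, [1,4,6]), (-1, [2,3,6]), (-1, [2,4,5])]"

text \<open>Pointwise linear independence of seven 1-forms; on a 7-manifold they are then a coframe on \<^term>\<open>U\<close>.\<close>

definition coframe_on ::
  "('a::topological_space, real^7) atlas \<Rightarrow> 'a set \<Rightarrow> (nat \<Rightarrow> 'a form) \<Rightarrow> bool" where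
  "coframe_on A U x \<longleftrightarrow> (\<forall>i\<in>{1..7}. x i \<in> forms A 1) \<and>
     (\<forall>q\<in>U. \<forall>c::nat \<Rightarrow> real. (\<forall>X\<in>vector_fields A. (\<Sum>i=1..7. c i * x i [X] q) = 0)
        \<longrightarrow> (\<forall>i\<in>{1..7}. c i = 0))"

text \<open>
  \<open>\<phi>\<close> is a G2-structure inducing the metric \<^term>\<open>g\<close> and the oriented volume form \<^term>\<open>vol\<close>: near
  every point there is an adapted basis \<^term>\<open>x\<close> of 1-forms, oriented orthonormal for \<^term>\<open>g\<close> and
  \<^term>\<open>vol\<close>. Local 1-forms agree near any given point with global ones, so \<^term>\<open>x\<close> may be taken
  global with the conditions imposed only on \<^term>\<open>U\<close>. As G2 is contained in SO(7),
  \<open>\<phi>\<close> determines \<^term>\<open>g\<close> and \<^term>\<open>vol\<close>.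
\<close>

definition g2_structure ::
  "('a::topological_space, real^7) atlas \<Rightarrow> 'a form \<Rightarrow> 'a metric \<Rightarrow> 'a form \<Rightarrow> bool" where
  "g2_structure A \<phi> g vol \<longleftrightarrow> \<phi> \<in> forms A 3 \<and>
     (\<forall>p. \<exists>U x. open U \<and> p \<in> U \<and> coframe_on A U x \<and>
        (\<forall>q\<in>U. (\<forall>Xs. \<phi> Xs q = g2_std x Xs q) \<and>
               (\<forall>X Y. g X Y q = (\<Sum>i=1..7. x i [X] q * x i [Y] q)) \<and>
               (\<forall>Xs. vol Xs q = wedges (map x [1,2,3,4,5,6,7]) Xs q)))"

definition shrinking_laplacian_soliton ::
  "('a::topological_space, real^7) atlas \<Rightarrow> 'a form \<Rightarrow> bool" where
  "shrinking_laplacian_soliton A \<phi> \<longleftrightarrow>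
     (\<exists>g vol. g2_structure A \<phi> g vol \<and>
        (\<exists>c<0. \<exists>X\<in>vector_fields A. \<forall>Ys p.
           hodge_laplacian A g vol 3 \<phi> Ys p = c * \<phi> Ys p + lie_derivative A X \<phi> Ys p))"

section \<open>The Lie algebras and the families of 3-forms\<close>

text \<open>The \<open>i\<close>-th row lists the terms of \<open>de\<^sup>i\<close>.\<close>

definition cp1 :: "real \<Rightarrow> (real \<times> nat list) list list" where
  "cp1 m = [[(-m, [1,7])], [(-m, [2,7])], [(-m, [3,7])], [(-m, [4,7])], [(-m, [5,7])], [(-m, [6,7])], []]"

definition cp2 :: "real \<Rightarrow> (real \<times> nat list) list list" where
  "cp2 m = [[(-(4/3)*m, [1,7]), (2/3*m, [3,6])], [(-m, [2,7])], [(-(2/3)*m, [3,7])], [(-m, [4,7])],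
     [(-m, [5,7])], [(-(2/3)*m, [6,7])], []]"

definition cp3 :: "real \<Rightarrow> (real \<times> nat list) list list" where
  "cp3 m = [[(-(3/2)*m, [1,7]), (1/2*m, [3,6]), (1/2*m, [4,5])], [(-m, [2,7])], [(-(3/4)*m, [3,7])],
     [(-(3/4)*m, [4,7])], [(-(3/4)*m, [5,7])], [(-(3/4)*m, [6,7])], []]"

definition cp4 :: "real \<Rightarrow> (real \<times> nat list) list list" where
  "cp4 m = [[(-(7/5)*m, [1,7]), (2/5*m, [3,6]), (2/5*m, [4,5])], [(-(6/5)*m, [2,7]), (-(2/5)*m, [4,6])],
     [(-(4/5)*m, [3,7])], [(-(3/5)*m, [4,7])], [(-(4/5)*m, [5,7])], [(-(3/5)*m, [6,7])], []]"

definition cp5 :: "real \<Rightarrow> (real \<times> nat list) list list" where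
  "cp5 m = [[(-(5/4)*m, [1,7]), (1/2*m, [4,5])], [(-(5/4)*m, [2,7]), (-(1/2)*m, [4,6])],
     [(-m, [3,7])], [(-(1/2)*m, [4,7])], [(-(3/4)*m, [5,7])], [(-(3/4)*m, [6,7])], []]"

definition cp6 :: "real \<Rightarrow> (real \<times> nat list) list list" where
  "cp6 m = [[(-(4/3)*m, [1,7]), (1/3*m, [3,6]), (1/3*m, [4,5])],
     [(-(4/3)*m, [2,7]), (1/3*m, [3,5]), (-(1/3)*m, [4,6])],
     [(-(2/3)*m, [3,7])], [(-(2/3)*m, [4,7])], [(-(2/3)*m, [5,7])], [(-(2/3)*m, [6,7])], []]"

definition cp7 :: "real \<Rightarrow> (real \<times> nat list) list list" where
  "cp7 m = [[(-(6/5)*m, [1,7]), (2/5*m, [3,6])], [(-(3/5)*m, [2,7])], [(-(3/5)*m, [3,7])],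
     [(2/5*m, [2,6]), (-(6/5)*m, [4,7])], [(2/5*m, [2,3]), (-(6/5)*m, [5,7])], [(-(3/5)*m, [6,7])], []]"

text \<open>\<open>e\<^sup>1,\<dots>,e\<^sup>7\<close> are the left-invariant 1-forms dual to a basis of the Lie algebra and satisfy the
  structure equations \<^term>\<open>cp\<close>.\<close>

definition has_lie_algebra ::
  "('a::topological_space, real^7) atlas \<Rightarrow> ('a \<Rightarrow> 'a \<Rightarrow> 'a) \<Rightarrow> 'a \<Rightarrow>
   (real \<times> nat list) list list \<Rightarrow> (nat \<Rightarrow> 'a form) \<Rightarrow> bool" where
  "has_lie_algebra A mul one cp e \<longleftrightarrow>
     (\<exists>E. lie_algebra_basis A mul one E \<and>
        (\<forall>i\<in>{1..7}. e i \<in> forms A 1 \<and>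
           (\<forall>j\<in>{1..7}. e i [E j] = (\<lambda>p. if i = j then 1 else 0)))) \<and>
     (\<forall>i\<in>{1..7}. ext_d A (e i) = lin_form e (cp ! (i - 1)))"

definition phi1 :: "real \<Rightarrow> real \<Rightarrow> (nat \<Rightarrow> 'a form) \<Rightarrow> 'a form" where
  "phi1 m t e = (let u = 1 - 4 * m^2 * t; a = u^2; b = u powr (9/4) in
     lin_form e [(a, [1,2,7]), (a, [3,4,7]), (a, [5,6,7]),
       (b, [1,3,5]), (-b, [1,4,6]), (-b, [2,3,6]), (-b, [2,4,5])])"

definition phi2 :: "real \<Rightarrow> real \<Rightarrow> (nat \<Rightarrow> 'a form) \<Rightarrow> 'a form" where
  "phi2 m t e = (let u = 1 - 10/3 * m^2 * t; a = u powr (11/5); b = u^2; c = u powr (12/5) in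
     lin_form e [(a, [1,2,7]), (-a, [2,3,6]), (b, [3,4,7]), (b, [5,6,7]),
       (c, [1,3,5]), (-c, [1,4,6]), (-c, [2,4,5])])"

definition phi3 :: "real \<Rightarrow> real \<Rightarrow> (nat \<Rightarrow> 'a form) \<Rightarrow> 'a form" where
  "phi3 m t e = (let u = 1 - 3 * m^2 * t; a = u powr (7/3); b = u^2; c = u powr (5/2) in
     lin_form e [(a, [1,2,7]), (-a, [2,3,6]), (-a, [2,4,5]), (b, [3,4,7]), (b, [5,6,7]),
       (c, [1,3,5]), (-c, [1,4,6])])"

definition phi4 :: "real \<Rightarrow> real \<Rightarrow> (nat \<Rightarrow> 'a form) \<Rightarrow> 'a form" where
  "phi4 m t e = (let u = 1 - 14/5 * m^2 * t; a = u powr (17/7); b = u^2; c = u powr (18/7) in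
     lin_form e [(a, [1,2,7]), (-a, [1,4,6]), (-a, [2,3,6]), (-a, [2,4,5]),
       (b, [3,4,7]), (b, [5,6,7]), (c, [1,3,5])])"

definition phi5 :: "real \<Rightarrow> real \<Rightarrow> (nat \<Rightarrow> 'a form) \<Rightarrow> 'a form" where
  "phi5 m t e = (let u = 1 - 3 * m^2 * t; a = u powr (7/3); b = u^2; c = u powr (5/2) in
     lin_form e [(a, [1,2,7]), (-a, [1,4,6]), (-a, [2,4,5]), (b, [3,4,7]), (b, [5,6,7]),
       (c, [1,3,5]), (-c, [2,3,6])])"

definition phi6 :: "real \<Rightarrow> real \<Rightarrow> (nat \<Rightarrow> 'a form) \<Rightarrow> 'a form" where
  "phi6 m t e = (let u = 1 - 8/3 * m^2 * t; a = u powr (5/2); b = u^2 in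
     lin_form e [(a, [1,2,7]), (a, [1,3,5]), (-a, [1,4,6]), (-a, [2,3,6]), (-a, [2,4,5]),
       (b, [3,4,7]), (b, [5,6,7])])"

definition phi7 :: "real \<Rightarrow> real \<Rightarrow> (nat \<Rightarrow> 'a form) \<Rightarrow> 'a form" where
  "phi7 m t e = (let u = 1 - 14/5 * m^2 * t; a = u powr (15/7); b = u powr (18/7) in
     lin_form e [(a, [1,2,7]), (a, [3,4,7]), (a, [5,6,7]), (-a, [2,3,6]),
       (b, [1,3,5]), (-b, [1,4,6]), (-b, [2,4,5])])"

end

theory Submission
  imports Defs
begin

text \<open>
  Let \<open>u\<close> be the affine function of \<open>t\<close> whose powers occur in \<open>\<phi>(t)\<close>. The rescaled coframe
  \<open>x\<^sup>i = u\<^bsup>r\<^sub>i\<^esup> e\<^sup>i\<close>, with suitable exponents and \<open>r\<^sub>7 = 1/2\<close>, turns \<open>\<phi>(t)\<close> into the standard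
  G2-form of \<open>x\<close> and reproduces the structure equations with \<open>m\<close> replaced by \<open>\<mu> = m / \<surd>u\<close>.
  In it \<open>d\<phi> = 3\<mu> x\<^sup>7 \<and> \<phi>\<close> and \<open>d\<star>\<phi> = 4\<mu> x\<^sup>7 \<and> \<star>\<phi>\<close>, and the Hodge Laplacian of \<open>\<phi>\<close> is again a
  combination of the seven monomials of \<open>\<phi>\<close>. The left-invariant field \<open>E\<^sub>7\<close> dual to \<open>x\<^sup>7\<close> acts
  diagonally on these monomials, and \<open>X = -\<mu> E\<^sub>7\<close> solves the soliton equation.
\<close>

section \<open>Exterior algebra\<close>

text \<open>The field is sought along \<open>E 7\<close> because both halves of the Laplacian lead
  there: \<open>codiff\<close> of \<phi> is -4\<mu> times the contraction of \<phi> with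
  \<open>E 7\<close>, and \<star>d\<phi> is -3\<mu> times the contraction of \<star>\<phi> with
  \<open>E 7\<close>, so Cartan's formula turns the remaining d into Lie derivatives along
  \<open>E 7\<close>. What is left of the soliton equation is one scalar equation per monomial. The
  obstacle is the encoding: forms are functions of lists of global vector fields, wedge and d are
  signed sums over positions, and the Hodge star is a definite description. Each operation is
  therefore given a recursion that removes the head of the argument list, so that identities of
  exterior calculus become list inductions; on a coframe with a dual frame they reduce to arithmetic
  on index lists, which the simplifier evaluates. The star also needs a uniqueness proof among all
  forms, not only those with constant coefficients.\<close>

definition contract :: "'a vfield \<Rightarrow> 'a form \<Rightarrow> 'a form" where
  "contract X \<omega> = (\<lambda>Xs. \<omega> (X # Xs))"

text \<open>The grade involution. Its sign is read off the argument list, so no degree has to be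
  tracked in the antiderivation rule.\<close>

definition alternate :: "'a form \<Rightarrow> 'a form" where
  "alternate \<omega> = (\<lambda>Xs p. (-1) ^ length Xs * \<omega> Xs p)"

definition scalar :: "('a \<Rightarrow> real) \<Rightarrow> 'a form" where
  "scalar f = (\<lambda>Xs p. if Xs = [] then f p else 0)"

text \<open>Sums are brought to this one shape, so that each operation needs a single linearity
  rule; a lone multiple or a zero form is written with a vanishing coefficient and a filler
  form.\<close>

definition lin2 :: "('a \<Rightarrow> real) \<Rightarrow> 'a form \<Rightarrow> ('a \<Rightarrow> real) \<Rightarrow> 'a form \<Rightarrow> 'a form" where
  "lin2 f \<alpha> g \<beta> = (\<lambda>Xs p. f p * \<alpha> Xs p + g p * \<beta> Xs p)"

text \<open>Only the degree is recorded, since this is what collapses the antiderivation rule to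
  \<open>wedge_one_form_Cons\<close>.\<close>

definition one_form :: "'a form \<Rightarrow> bool" where
  "one_form \<alpha> \<longleftrightarrow> (\<forall>Xs. length Xs \<noteq> 1 \<longrightarrow> \<alpha> Xs = (\<lambda>p. 0))"

lemma wedge_Nil: "wedge \<alpha> \<beta> [] p = \<alpha> [] p * \<beta> [] p"
  by (simp add: wedge_def)

lemma inj_on_image_Suc: "inj_on ((`) Suc) S"
  by (meson inj_Suc inj_image_eq_iff inj_onI)

lemma Pow_lessThan_Suc_shift:
  "Pow {..<Suc n} = (`) Suc ` Pow {..<n} \<union> (\<lambda>T. insert 0 (Suc ` T)) ` Pow {..<n}"
proof -
  have *: "{..<Suc n} = insert 0 (Suc ` {..<n})"
    by (rule lessThan_Suc_eq_insert_0)
  show ?thesis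
    unfolding * Pow_insert image_Pow_surj[OF refl, of Suc, symmetric]
    by (simp add: image_image)
qed

text \<open>Contraction with the head is an antiderivation: the sets of positions split by whether
  they contain 0, that is, by which factor receives \<open>X\<close>. The algebraic identities below
  are proved by induction through this recursion instead of by counting shuffles.\<close>

lemma wedge_Cons:
  "wedge \<alpha> \<beta> (X # Xs) p =
     wedge (contract X \<alpha>) \<beta> Xs p + wedge (alternate \<alpha>) (contract X \<beta>) Xs p"
proof -
  let ?n = "length Xs"
  let ?c = "\<lambda>S. card {(i, j). i \<in> S \<and> j < i \<and> j \<notin> S}"
  let ?t = "\<lambda>Ys S. (-1) ^ ?c S * \<alpha> (nths Ys S) p * \<beta> (nths Ys (- S)) p"
  have inj2: "inj_on (\<lambda>T. insert 0 (Suc ` T)) (Pow {..<?n})"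
    by (intro inj_onI) (metis Zero_not_Suc image_iff inj_Suc inj_image_eq_iff insert_ident)
  have disj: "(`) Suc ` Pow {..<?n} \<inter> (\<lambda>T. insert 0 (Suc ` T)) ` Pow {..<?n} = {}"
    by auto
  have "wedge \<alpha> \<beta> (X # Xs) p = sum (?t (X # Xs)) (Pow {..<Suc ?n})"
    by (simp add: wedge_def)
  also have "\<dots> = (\<Sum>T\<in>Pow {..<?n}. ?t (X # Xs) (Suc ` T)) +
                  (\<Sum>T\<in>Pow {..<?n}. ?t (X # Xs) (insert 0 (Suc ` T)))"
    unfolding Pow_lessThan_Suc_shift
    by (subst sum.union_disjoint)
       (use disj in \<open>auto simp: sum.reindex inj_on_image_Suc inj2 finite_imageI\<close>)
  \<comment> \<open>Here \<open>X\<close> goes to \<alpha>; position 0 precedes all others, so no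
    inversion arises.\<close>
  also have "(\<Sum>T\<in>Pow {..<?n}. ?t (X # Xs) (insert 0 (Suc ` T))) = wedge (contract X \<alpha>) \<beta> Xs p"
    unfolding wedge_def
  proof (rule sum.cong[OF refl])
    fix T assume "T \<in> Pow {..<?n}"
    have "{(i, j). i \<in> insert 0 (Suc ` T) \<and> j < i \<and> j \<notin> insert 0 (Suc ` T)}
        = map_prod Suc Suc ` {(i, j). i \<in> T \<and> j < i \<and> j \<notin> T}"
    (is "?L = ?R")
    proof (rule set_eqI)
      fix x show "x \<in> ?L \<longleftrightarrow> x \<in> ?R"
        by (cases x; cases "fst x"; cases "snd x") (auto simp: image_iff)
    qed
    then have "?c (insert 0 (Suc ` T)) = ?c T"
      by (simp add: card_image inj_on_def)
    moreover have "{j. Suc j \<in> insert 0 (Suc ` T)} = T" "{j. Suc j \<in> - insert 0 (Suc ` T)} = - T"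
      by auto
    ultimately show "?t (X # Xs) (insert 0 (Suc ` T)) =
      (-1) ^ ?c T * contract X \<alpha> (nths Xs T) p * \<beta> (nths Xs (- T)) p"
      by (simp add: nths_Cons contract_def)
  qed
  \<comment> \<open>Here \<open>X\<close> goes to \<beta>; each of the \<open>card T\<close> entries
    fed to \<alpha> is inverted with position 0, and \<open>card T\<close> is the number of
    arguments of \<alpha>, whence \<open>alternate\<close>.\<close>
  also have "(\<Sum>T\<in>Pow {..<?n}. ?t (X # Xs) (Suc ` T)) = wedge (alternate \<alpha>) (contract X \<beta>) Xs p"
    unfolding wedge_def
  proof (rule sum.cong[OF refl])
    fix T assume T: "T \<in> Pow {..<?n}"
    then have fin: "finite T" by (auto intro: finite_subset)
    have "{(i, j). i \<in> Suc ` T \<and> j < i \<and> j \<notin> Suc ` T}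
        = map_prod Suc Suc ` {(i, j). i \<in> T \<and> j < i \<and> j \<notin> T} \<union> (\<lambda>i. (Suc i, 0)) ` T"
    (is "?L = ?R")
    proof (rule set_eqI)
      fix x show "x \<in> ?L \<longleftrightarrow> x \<in> ?R"
        by (cases x; cases "fst x"; cases "snd x") (auto simp: image_iff)
    qed
    moreover have "finite {(i, j). i \<in> T \<and> j < i \<and> j \<notin> T}"
      by (rule finite_subset[of _ "{..<?n} \<times> {..<?n}"]) (use T in auto)
    moreover have "map_prod Suc Suc ` {(i, j). i \<in> T \<and> j < i \<and> j \<notin> T} \<inter> (\<lambda>i. (Suc i, 0)) ` T = {}"
      by auto
    ultimately have "?c (Suc ` T) = card (map_prod Suc Suc ` {(i, j). i \<in> T \<and> j < i \<and> j \<notin> T})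
        + card ((\<lambda>i. (Suc i, 0::nat)) ` T)"
      using fin by (simp add: card_Un_disjoint)
    then have "?c (Suc ` T) = ?c T + card T"
      by (simp add: card_image inj_on_def)
    moreover have "length (nths Xs T) = card T"
      using T by (auto simp: length_nths intro!: arg_cong[where f = card])
    moreover have "{j. Suc j \<in> Suc ` T} = T" "{j. Suc j \<in> - Suc ` T} = - T"
      by auto
    ultimately show "?t (X # Xs) (Suc ` T) =
      (-1) ^ ?c T * alternate \<alpha> (nths Xs T) p * contract X \<beta> (nths Xs (- T)) p"
      by (simp add: nths_Cons contract_def alternate_def power_add)
  qed
  finally show ?thesis by simp
qed

lemma contract_wedge:
  "contract X (wedge \<alpha> \<beta>) =
     lin2 (\<lambda>p. 1) (wedge (contract X \<alpha>) \<beta>) (\<lambda>p. 1) (wedge (alternate \<alpha>) (contract X \<beta>))"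
  by (intro ext) (simp add: contract_def[of X "wedge \<alpha> \<beta>"] wedge_Cons lin2_def)

lemma wedge_lin2_left:
  "wedge (lin2 f \<alpha> g \<beta>) \<gamma> = lin2 f (wedge \<alpha> \<gamma>) g (wedge \<beta> \<gamma>)"
  by (intro ext) (simp add: wedge_def lin2_def algebra_simps sum.distrib sum_distrib_left)

lemma wedge_lin2_right:
  "wedge \<gamma> (lin2 f \<alpha> g \<beta>) = lin2 f (wedge \<gamma> \<alpha>) g (wedge \<gamma> \<beta>)"
  by (intro ext) (simp add: wedge_def lin2_def algebra_simps sum.distrib sum_distrib_left)

lemma contract_alternate: "contract X (alternate \<alpha>) = lin2 (\<lambda>p. -1) (alternate (contract X \<alpha>)) (\<lambda>p. 0) \<alpha>"
  by (intro ext) (simp add: contract_def alternate_def lin2_def)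

lemma contract_lin2: "contract X (lin2 f \<alpha> g \<beta>) = lin2 f (contract X \<alpha>) g (contract X \<beta>)"
  by (intro ext) (simp add: contract_def lin2_def)

lemma wedge_alternate: "wedge (alternate \<alpha>) (alternate \<beta>) Xs p = alternate (wedge \<alpha> \<beta>) Xs p"
proof (induction Xs arbitrary: \<alpha> \<beta>)
  case Nil
  then show ?case by (simp add: wedge_Nil alternate_def)
next
  case (Cons X Xs)
  have "wedge (alternate \<alpha>) (alternate \<beta>) (X # Xs) p =
      - wedge (alternate (contract X \<alpha>)) (alternate \<beta>) Xs p
      - wedge (alternate (alternate \<alpha>)) (alternate (contract X \<beta>)) Xs p"
    by (simp add: wedge_Cons contract_alternate wedge_lin2_left wedge_lin2_right) (simp add: lin2_def)
  also have "\<dots> = alternate (wedge \<alpha> \<beta>) (X # Xs) p"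
    by (simp add: Cons.IH) (simp add: alternate_def wedge_Cons algebra_simps)
  finally show ?case .
qed

text \<open>Both bracketings obey the same recursion, because the grade involution is
  multiplicative, and they agree on the empty list. The forms are generalised since contraction
  changes them.\<close>

lemma wedge_assoc: "wedge (wedge \<alpha> \<beta>) \<gamma> Xs p = wedge \<alpha> (wedge \<beta> \<gamma>) Xs p"
proof (induction Xs arbitrary: \<alpha> \<beta> \<gamma>)
  case Nil
  then show ?case by (simp add: wedge_Nil)
next
  case (Cons X Xs)
  have alt: "alternate (wedge \<alpha> \<beta>) = wedge (alternate \<alpha>) (alternate \<beta>)"
    by (intro ext) (simp add: wedge_alternate)
  show ?case
    by (simp add: wedge_Cons contract_wedge alt wedge_lin2_left wedge_lin2_right)
       (simp add: lin2_def Cons.IH)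
qed

lemma wedge_scalar_left: "wedge (scalar f) \<beta> Xs p = f p * \<beta> Xs p"
proof (induction Xs arbitrary: \<beta>)
  case Nil
  then show ?case by (simp add: wedge_Nil scalar_def)
next
  case (Cons X Xs)
  have "contract X (scalar f) = lin2 (\<lambda>p. 0) \<beta> (\<lambda>p. 0) \<beta>" "alternate (scalar f) = scalar f"
    by (auto intro!: ext simp: contract_def scalar_def lin2_def alternate_def)
  then show ?case
    by (simp add: wedge_Cons Cons.IH wedge_lin2_left) (simp add: lin2_def contract_def)
qed

lemma wedge_scalar_right: "wedge \<alpha> (scalar f) Xs p = f p * \<alpha> Xs p"
proof (induction Xs arbitrary: \<alpha>)
  case Nil
  then show ?case by (simp add: wedge_Nil scalar_def)
next
  case (Cons X Xs)
  have "contract X (scalar f) = lin2 (\<lambda>p. 0) \<alpha> (\<lambda>p. 0) \<alpha>"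
    by (auto intro!: ext simp: contract_def scalar_def lin2_def)
  then show ?case
    by (simp add: wedge_Cons Cons.IH wedge_lin2_right) (simp add: lin2_def contract_def)
qed

lemma one_form_contract: "one_form \<alpha> \<Longrightarrow> contract X \<alpha> = scalar (\<alpha> [X])"
  by (intro ext) (auto simp: one_form_def contract_def scalar_def)

lemma one_form_alternate: "one_form \<alpha> \<Longrightarrow> alternate \<alpha> = lin2 (\<lambda>p. -1) \<alpha> (\<lambda>p. 0) \<alpha>"
  unfolding one_form_def alternate_def lin2_def
  by (intro ext, rename_tac Xs p, case_tac "length Xs = 1") auto

lemma wedge_one_form_Cons:
  assumes "one_form \<alpha>"
  shows "wedge \<alpha> \<beta> (X # Xs) p = \<alpha> [X] p * \<beta> Xs p - wedge \<alpha> (contract X \<beta>) Xs p"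
  using assms
  by (simp add: wedge_Cons one_form_contract wedge_scalar_left one_form_alternate wedge_lin2_left)
     (simp add: lin2_def)

lemma wedge_one_form_Nil: "one_form \<alpha> \<Longrightarrow> wedge \<alpha> \<beta> [] p = 0"
  by (simp add: wedge_Nil one_form_def)

lemma contract_wedge_one_form:
  assumes "one_form \<alpha>"
  shows "contract X (wedge \<alpha> \<beta>) = lin2 (\<alpha> [X]) \<beta> (\<lambda>p. -1) (wedge \<alpha> (contract X \<beta>))"
  using assms by (intro ext) (simp add: contract_def[of X "wedge \<alpha> \<beta>"] wedge_one_form_Cons lin2_def)

lemma wedge_one_form_self:
  assumes "one_form \<alpha>"
  shows "wedge \<alpha> (wedge \<alpha> \<beta>) Xs p = 0"
proof (induction Xs arbitrary: \<beta>)
  case (Cons X Xs)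
  then show ?case
    using assms
    by (simp add: wedge_one_form_Cons contract_wedge_one_form wedge_lin2_right) (simp add: lin2_def)
qed (use assms in \<open>simp add: wedge_one_form_Nil\<close>)

lemma wedge_one_form_swap:
  assumes "one_form \<alpha>" "one_form \<beta>"
  shows "wedge \<alpha> (wedge \<beta> \<gamma>) Xs p = - wedge \<beta> (wedge \<alpha> \<gamma>) Xs p"
proof (induction Xs arbitrary: \<gamma>)
  case (Cons X Xs)
  then show ?case
    using assms
    by (simp add: wedge_one_form_Cons contract_wedge_one_form wedge_lin2_right)
       (simp add: lin2_def Cons.IH)
qed (use assms in \<open>simp add: wedge_one_form_Nil\<close>)

section \<open>Products of lists of one-forms\<close>

lemma wedges_Nil: "wedges [] = scalar (\<lambda>p. 1)"
  by (intro ext) (simp add: wedges_def scalar_def)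

lemma wedges_Cons: "wedges (\<alpha> # \<alpha>s) = wedge \<alpha> (wedges \<alpha>s)"
  by (simp add: wedges_def)

lemma wedges_append: "wedges (\<alpha>s @ \<beta>s) = wedge (wedges \<alpha>s) (wedges \<beta>s)"
proof (induction \<alpha>s)
  case Nil
  then show ?case by (intro ext) (simp add: wedges_Nil wedge_scalar_left)
next
  case (Cons \<alpha> \<alpha>s)
  then show ?case by (intro ext) (simp add: wedges_Cons wedge_assoc)
qed

lemma wedges_degree:
  assumes "\<forall>\<alpha>\<in>set \<alpha>s. one_form \<alpha>" "length Xs \<noteq> length \<alpha>s"
  shows "wedges \<alpha>s Xs p = 0"
  using assms
proof (induction \<alpha>s arbitrary: Xs)
  case Nil
  then show ?case by (simp add: wedges_Nil scalar_def)
next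
  case (Cons \<alpha> \<alpha>s)
  have 1: "one_form \<alpha>" using Cons.prems by simp
  \<comment> \<open>Stated for any form supported in degree n, as contraction lowers the degree; for
    n = 0 contraction gives zero, because a list with a head is never empty.\<close>
  have "\<And>\<beta>. (\<And>Ys. length Ys \<noteq> n \<Longrightarrow> \<beta> Ys p = 0) \<Longrightarrow> length Xs \<noteq> Suc n \<Longrightarrow> wedge \<alpha> \<beta> Xs p = 0" for n
  proof (induction Xs arbitrary: n)
    case (Cons Y Ys)
    show ?case
    proof (cases n)
      case 0
      then have "contract Y \<beta> Zs p = 0" for Zs using Cons.prems(1) by (simp add: contract_def)
      then have "wedge \<alpha> (contract Y \<beta>) Ys p = 0"
        by (simp add: wedge_def)
      then show ?thesis using 1 Cons.prems by (simp add: wedge_one_form_Cons)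
    next
      case (Suc k)
      have "wedge \<alpha> (contract Y \<beta>) Ys p = 0"
        by (rule Cons.IH[of k]) (use Cons.prems Suc in \<open>auto simp: contract_def\<close>)
      then show ?thesis using 1 Cons.prems Suc by (simp add: wedge_one_form_Cons)
    qed
  qed (use 1 in \<open>simp add: wedge_one_form_Nil\<close>)
  from this[of "length \<alpha>s" "wedges \<alpha>s"] show ?case using Cons by (simp add: wedges_Cons)
qed

text \<open>Antisymmetry under adjacent swaps is inherited by contractions, which suits list
  induction. As the values are real, it yields the vanishing on repeated arguments that
  \<open>forms\<close> asks for (\<open>alternating_eq_0\<close>).\<close>

definition alternating :: "'a form \<Rightarrow> bool" where
  "alternating \<omega> \<longleftrightarrow> (\<forall>As X Y Bs p. \<omega> (As @ X # Y # Bs) p = - \<omega> (As @ Y # X # Bs) p)"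

lemma alternatingD: "alternating \<omega> \<Longrightarrow> \<omega> (X # Y # Xs) p = - \<omega> (Y # X # Xs) p"
  unfolding alternating_def by (metis append_Nil)

lemma alternating_contract: "alternating \<omega> \<Longrightarrow> alternating (contract X \<omega>)"
  unfolding alternating_def contract_def by (metis append_Cons)

lemma alternating_scalar: "alternating (scalar f)"
  by (simp add: alternating_def scalar_def)

lemma alternating_wedge:
  assumes "one_form \<alpha>" "alternating \<beta>"
  shows "alternating (wedge \<alpha> \<beta>)"
proof -
  have "wedge \<alpha> \<beta> (As @ X # Y # Bs) p = - wedge \<alpha> \<beta> (As @ Y # X # Bs) p" for As X Y Bs p
    using assms(2)
  proof (induction As arbitrary: \<beta>)
    case Nil
    have "contract Y (contract X \<beta>) = lin2 (\<lambda>p. -1) (contract X (contract Y \<beta>)) (\<lambda>p. 0) \<beta>"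
      using Nil by (intro ext) (simp add: contract_def lin2_def alternatingD[of \<beta> X Y])
    then have "wedge \<alpha> (contract Y (contract X \<beta>)) Bs p = - wedge \<alpha> (contract X (contract Y \<beta>)) Bs p"
      by (simp only: wedge_lin2_right) (simp add: lin2_def)
    then show ?case
      using assms(1) by (simp add: wedge_one_form_Cons) (simp add: contract_def)
  next
    case (Cons Z As)
    have "\<beta> (As @ X # Y # Bs) p = - \<beta> (As @ Y # X # Bs) p"
      using Cons.prems unfolding alternating_def by blast
    then show ?case
      using Cons.IH[OF alternating_contract[OF Cons.prems, of Z]] assms(1)
      by (simp add: wedge_one_form_Cons)
  qed
  then show ?thesis unfolding alternating_def by blast
qed

lemma alternating_wedges: "\<forall>\<alpha>\<in>set \<alpha>s. one_form \<alpha> \<Longrightarrow> alternating (wedges \<alpha>s)"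
  by (induction \<alpha>s) (simp_all add: wedges_Nil wedges_Cons alternating_scalar alternating_wedge)

text \<open>This costs j adjacent swaps. It matches the Koszul sum, where a bracket stands in front
  of the other arguments, with the Lie derivative, where it replaces the j-th one.\<close>

lemma alternating_move:
  assumes "alternating \<omega>" "j < length Xs"
  shows "\<omega> (Z # nths Xs (- {j})) p = (-1) ^ j * \<omega> (Xs[j := Z]) p"
  using assms
proof (induction Xs arbitrary: \<omega> j)
  case (Cons Y Ys)
  show ?case
  proof (cases j)
    case 0
    then have "{i. Suc i \<in> - {j}} = UNIV" by auto
    then show ?thesis using 0 by (simp add: nths_Cons nths_all)
  next
    case (Suc k)
    then have "{i. Suc i \<in> - {j}} = - {k}" by auto
    then have "\<omega> (Z # nths (Y # Ys) (- {j})) p = - contract Y \<omega> (Z # nths Ys (- {k})) p"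
      using Suc alternatingD[OF Cons.prems(1), of Z Y] by (simp add: nths_Cons contract_def)
    then show ?thesis
      using Cons.IH[OF alternating_contract[OF Cons.prems(1)], of k Y] Cons.prems Suc
      by (simp add: contract_def)
  qed
qed simp

lemma alternating_eq_0:
  assumes "alternating \<omega>" "i < j" "j < length Xs" "Xs ! i = Xs ! j"
  shows "\<omega> Xs p = 0"
  using assms
proof (induction Xs arbitrary: \<omega> i j)
  case (Cons Y Ys)
  obtain k where j: "j = Suc k" using Cons.prems by (cases j) auto
  show ?case
  proof (cases i)
    case 0
    have "\<omega> (Y # Ys) p = contract Y \<omega> (Ys[k := Y]) p"
      using Cons.prems 0 j by (simp add: contract_def)
    also have "\<dots> = (-1) ^ k * \<omega> (Y # Y # nths Ys (- {k})) p"
      using alternating_move[OF alternating_contract[OF Cons.prems(1)], of k Ys Y Y p] Cons.prems j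
      by (simp add: contract_def)
    also have "\<dots> = 0" using alternatingD[OF Cons.prems(1), of Y Y "nths Ys (- {k})" p] by simp
    finally show ?thesis .
  next
    case (Suc l)
    have "contract Y \<omega> Ys p = 0"
      by (rule Cons.IH[OF alternating_contract[OF Cons.prems(1)], of l k]) (use Cons.prems j Suc in auto)
    then show ?thesis by (simp add: contract_def)
  qed
qed simp

section \<open>Smooth functions and tensoriality\<close>

text \<open>The usual rules give \<open>frechet_derivative\<close> of a sum or product only at
  points of \<open>U\<close>, so higher orders require passing to another function that agrees on
  \<open>U\<close>; openness transfers the derivatives.\<close>

lemma Ck_on_cong:
  assumes "open U" "\<And>x. x \<in> U \<Longrightarrow> f x = g x" "Ck_on k U f"
  shows "Ck_on k U g"
  using assms(2,3)
proof (induction k arbitrary: f g)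
  case 0
  then show ?case by (simp cong: continuous_on_cong)
next
  case (Suc k)
  have "g differentiable at x" if "x \<in> U" for x
    using Suc.prems that \<open>open U\<close> unfolding Ck_on.simps differentiable_def
    by (metis has_derivative_transform_within_open)
  moreover have "Ck_on k U (\<lambda>x. frechet_derivative g (at x) v)" for v
  proof (rule Suc.IH)
    show "Ck_on k U (\<lambda>x. frechet_derivative f (at x) v)" using Suc.prems by simp
    show "frechet_derivative f (at x) v = frechet_derivative g (at x) v" if "x \<in> U" for x
      using frechet_derivative_transform_within_open[of f x U g] Suc.prems that \<open>open U\<close> by simp
  qed
  ultimately show ?case by simp
qed

lemma Ck_on_const: "Ck_on k U (\<lambda>x. c)"
  by (induction k arbitrary: c) simp_all

lemma Ck_on_SucD: "Ck_on (Suc k) U f \<Longrightarrow> Ck_on k U f"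
proof (induction k arbitrary: f)
  case 0
  then show ?case
    by (auto intro!: continuous_at_imp_continuous_on differentiable_imp_continuous_within)
next
  case (Suc k)
  then have d: "\<forall>x\<in>U. f differentiable at x"
    and c: "\<And>v. Ck_on (Suc k) U (\<lambda>x. frechet_derivative f (at x) v)"
    using Ck_on.simps(2)[of "Suc k" U f] by blast+
  show ?case
    by (subst Ck_on.simps(2)) (intro conjI allI d Suc.IH c)
qed

lemma Ck_on_add:
  assumes "open U" "Ck_on k U f" "Ck_on k U g"
  shows "Ck_on k U (\<lambda>x. f x + g x)"
  using assms(2,3)
proof (induction k arbitrary: f g)
  case 0
  then show ?case by (simp add: continuous_on_add)
next
  case (Suc k)
  have "Ck_on k U (\<lambda>x. frechet_derivative (\<lambda>x. f x + g x) (at x) v)" for v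
  proof (rule Ck_on_cong[OF \<open>open U\<close>])
    show "Ck_on k U (\<lambda>x. frechet_derivative f (at x) v + frechet_derivative g (at x) v)"
      by (rule Suc.IH) (use Suc.prems in auto)
    fix x assume "x \<in> U"
    then have "((\<lambda>x. f x + g x) has_derivative
        (\<lambda>v. frechet_derivative f (at x) v + frechet_derivative g (at x) v)) (at x)"
      using Suc.prems by (intro has_derivative_add) (auto simp: frechet_derivative_works[symmetric])
    from frechet_derivative_at[OF this]
    show "frechet_derivative f (at x) v + frechet_derivative g (at x) v
        = frechet_derivative (\<lambda>x. f x + g x) (at x) v"
      by metis
  qed
  then show ?case using Suc.prems by simp
qed

lemma Ck_on_mult:
  fixes f g :: "'a::real_normed_vector \<Rightarrow> real"
  assumes "open U" "Ck_on k U f" "Ck_on k U g"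
  shows "Ck_on k U (\<lambda>x. f x * g x)"
  using assms(2,3)
proof (induction k arbitrary: f g)
  case 0
  then show ?case by (simp add: continuous_on_mult)
next
  case (Suc k)
  have "Ck_on k U (\<lambda>x. frechet_derivative (\<lambda>x. f x * g x) (at x) v)" for v
  proof (rule Ck_on_cong[OF \<open>open U\<close>])
    \<comment> \<open>The product rule contains f and g undifferentiated, hence the appeal to
      \<open>Ck_on_SucD\<close>.\<close>
    show "Ck_on k U (\<lambda>x. f x * frechet_derivative g (at x) v + frechet_derivative f (at x) v * g x)"
      by (intro Ck_on_add Suc.IH assms(1)) (use Suc.prems Ck_on_SucD in auto)
    fix x assume "x \<in> U"
    then have "((\<lambda>x. f x * g x) has_derivative
        (\<lambda>v. f x * frechet_derivative g (at x) v + frechet_derivative f (at x) v * g x)) (at x)"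
      using Suc.prems by (intro has_derivative_mult) (auto simp: frechet_derivative_works[symmetric])
    from frechet_derivative_at[OF this]
    show "f x * frechet_derivative g (at x) v + frechet_derivative f (at x) v * g x
        = frechet_derivative (\<lambda>x. f x * g x) (at x) v"
      by metis
  qed
  then show ?case using Suc.prems by simp
qed

section \<open>Smooth functions on the manifold and their derivations\<close>

lemma smooth_fun_iff:
  "f \<in> smooth_fun A \<longleftrightarrow> continuous_on UNIV f \<and>
     (\<forall>(U, \<phi>)\<in>A. \<forall>k. Ck_on k (\<phi> ` U) (\<lambda>y. f (inv_into U \<phi> y)))"
  by (simp add: smooth_fun_def smooth_map_def smooth_on_def comp_def)

lemma smooth_atlas_open: "smooth_atlas A \<Longrightarrow> (U, \<phi>) \<in> A \<Longrightarrow> open (\<phi> ` U)"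
  by (auto simp: smooth_atlas_def)

lemma smooth_fun_const: "(\<lambda>p. c) \<in> smooth_fun A"
  by (auto simp: smooth_fun_iff Ck_on_const)

lemma smooth_fun_add:
  "smooth_atlas A \<Longrightarrow> f \<in> smooth_fun A \<Longrightarrow> g \<in> smooth_fun A \<Longrightarrow> (\<lambda>p. f p + g p) \<in> smooth_fun A"
  unfolding smooth_fun_iff by (auto intro!: continuous_on_add Ck_on_add intro: smooth_atlas_open)

lemma smooth_fun_mult:
  "smooth_atlas A \<Longrightarrow> f \<in> smooth_fun A \<Longrightarrow> g \<in> smooth_fun A \<Longrightarrow> (\<lambda>p. f p * g p) \<in> smooth_fun A"
  unfolding smooth_fun_iff by (auto intro!: continuous_on_mult Ck_on_mult intro: smooth_atlas_open)

lemma smooth_fun_lin: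
  assumes "smooth_atlas A" "f \<in> smooth_fun A" "g \<in> smooth_fun A" "h \<in> smooth_fun A" "k \<in> smooth_fun A"
  shows "(\<lambda>p. f p * h p + g p * k p) \<in> smooth_fun A"
  using assms by (intro smooth_fun_add smooth_fun_mult)

lemma vector_field_smooth: "X \<in> vector_fields A \<Longrightarrow> f \<in> smooth_fun A \<Longrightarrow> X f \<in> smooth_fun A"
  by (simp add: vector_fields_def)

lemma vector_field_linear:
  "X \<in> vector_fields A \<Longrightarrow> f \<in> smooth_fun A \<Longrightarrow> g \<in> smooth_fun A \<Longrightarrow>
     X (\<lambda>p. a * f p + b * g p) = (\<lambda>p. a * X f p + b * X g p)"
  by (simp add: vector_fields_def)

lemma vector_field_mult:
  "X \<in> vector_fields A \<Longrightarrow> f \<in> smooth_fun A \<Longrightarrow> g \<in> smooth_fun A \<Longrightarrow>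
     X (\<lambda>p. f p * g p) = (\<lambda>p. f p * X g p + g p * X f p)"
  by (simp add: vector_fields_def)

lemma vector_field_const:
  assumes "X \<in> vector_fields A"
  shows "X (\<lambda>p. c) = (\<lambda>p. 0)"
proof -
  \<comment> \<open>The Leibniz rule on 1 = 1 * 1 gives X 1 = 2 * X 1.\<close>
  have 1: "X (\<lambda>p. 1) = (\<lambda>p. 0)"
    using vector_field_mult[OF assms smooth_fun_const smooth_fun_const, of 1 1]
    by (simp add: fun_eq_iff)
  show ?thesis
    using vector_field_linear[OF assms smooth_fun_const smooth_fun_const, of c 1 0 1] 1
    by simp
qed

lemma vector_field_lin:
  assumes "smooth_atlas A" "X \<in> vector_fields A"
    "f \<in> smooth_fun A" "g \<in> smooth_fun A" "h \<in> smooth_fun A" "k \<in> smooth_fun A"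
  shows "X (\<lambda>p. f p * h p + g p * k p) =
    (\<lambda>p. X f p * h p + f p * X h p + (X g p * k p + g p * X k p))"
  using vector_field_linear[OF assms(2) smooth_fun_mult[OF assms(1,3,5)]
      smooth_fun_mult[OF assms(1,4,6)], of 1 1]
  by (simp add: vector_field_mult[OF assms(2,3,5)] vector_field_mult[OF assms(2,4,6)] algebra_simps)

lemma vector_fields_lin:
  assumes "smooth_atlas A" "Y \<in> vector_fields A" "Z \<in> vector_fields A"
    "f \<in> smooth_fun A" "g \<in> smooth_fun A"
  shows "(\<lambda>h p. f p * Y h p + g p * Z h p) \<in> vector_fields A"
  unfolding vector_fields_def
proof (intro CollectI conjI allI ballI impI)
  fix h assume "h \<notin> smooth_fun A"
  then show "(\<lambda>p. f p * Y h p + g p * Z h p) = (\<lambda>p. 0)"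
    using assms(2,3) by (simp add: vector_fields_def)
next
  fix h assume "h \<in> smooth_fun A"
  then show "(\<lambda>p. f p * Y h p + g p * Z h p) \<in> smooth_fun A"
    using smooth_fun_lin[OF assms(1,4,5) vector_field_smooth[OF assms(2)] vector_field_smooth[OF assms(3)]]
    by blast
next
  fix h k and a b :: real assume "h \<in> smooth_fun A" "k \<in> smooth_fun A"
  then show "(\<lambda>p. f p * Y (\<lambda>p. a * h p + b * k p) p + g p * Z (\<lambda>p. a * h p + b * k p) p) =
       (\<lambda>p. a * (f p * Y h p + g p * Z h p) + b * (f p * Y k p + g p * Z k p))"
    by (simp add: vector_field_linear[OF assms(2)] vector_field_linear[OF assms(3)] algebra_simps)
next
  fix h k assume "h \<in> smooth_fun A" "k \<in> smooth_fun A"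
  then show "(\<lambda>p. f p * Y (\<lambda>p. h p * k p) p + g p * Z (\<lambda>p. h p * k p) p) =
       (\<lambda>p. h p * (f p * Y k p + g p * Z k p) + k p * (f p * Y h p + g p * Z h p))"
    by (simp add: vector_field_mult[OF assms(2)] vector_field_mult[OF assms(3)] algebra_simps)
qed

text \<open>The part of \<open>forms\<close> that can be handled independently of degree:
  multilinearity over smooth functions for lists of every length. Alternation is treated separately
  by \<open>alternating\<close>.\<close>

definition tensorial :: "('a::topological_space, 'e::euclidean_space) atlas \<Rightarrow> 'a form \<Rightarrow> bool" where
  "tensorial A \<omega> \<longleftrightarrow>
     (\<forall>Xs. \<not> set Xs \<subseteq> vector_fields A \<longrightarrow> \<omega> Xs = (\<lambda>p. 0)) \<and>
     (\<forall>Xs. set Xs \<subseteq> vector_fields A \<longrightarrow> \<omega> Xs \<in> smooth_fun A) \<and>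
     (\<forall>Xs. \<forall>i<length Xs. \<forall>Y\<in>vector_fields A. \<forall>Z\<in>vector_fields A. \<forall>f\<in>smooth_fun A. \<forall>g\<in>smooth_fun A.
        set Xs \<subseteq> vector_fields A \<longrightarrow>
        \<omega> (Xs[i := (\<lambda>h p. f p * Y h p + g p * Z h p)])
          = (\<lambda>p. f p * \<omega> (Xs[i := Y]) p + g p * \<omega> (Xs[i := Z]) p))"

lemma tensorial_vanish: "tensorial A \<omega> \<Longrightarrow> \<not> set Xs \<subseteq> vector_fields A \<Longrightarrow> \<omega> Xs = (\<lambda>p. 0)"
  by (simp add: tensorial_def)

lemma tensorial_smooth: "tensorial A \<omega> \<Longrightarrow> set Xs \<subseteq> vector_fields A \<Longrightarrow> \<omega> Xs \<in> smooth_fun A"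
  by (simp add: tensorial_def)

lemma tensorial_multilinear:
  "tensorial A \<omega> \<Longrightarrow> i < length Xs \<Longrightarrow> set Xs \<subseteq> vector_fields A \<Longrightarrow> Y \<in> vector_fields A \<Longrightarrow>
   Z \<in> vector_fields A \<Longrightarrow> f \<in> smooth_fun A \<Longrightarrow> g \<in> smooth_fun A \<Longrightarrow>
   \<omega> (Xs[i := (\<lambda>h p. f p * Y h p + g p * Z h p)]) = (\<lambda>p. f p * \<omega> (Xs[i := Y]) p + g p * \<omega> (Xs[i := Z]) p)"
  unfolding tensorial_def by blast

lemma forms_one_form: "\<alpha> \<in> forms A 1 \<Longrightarrow> one_form \<alpha>"
  by (auto simp: forms_def one_form_def)

lemma forms_tensorial:
  assumes "\<omega> \<in> forms A k"
  shows "tensorial A \<omega>"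
proof -
  note * = assms[unfolded forms_def mem_Collect_eq]
  have zero: "\<omega> Xs = (\<lambda>p. 0)" if "\<not> (length Xs = k \<and> set Xs \<subseteq> vector_fields A)" for Xs
    using conjunct1[OF *] that by blast
  have smooth: "\<omega> Xs \<in> smooth_fun A" if "set Xs \<subseteq> vector_fields A" for Xs
    using conjunct1[OF conjunct2[OF *]] that zero[of Xs] smooth_fun_const[of 0 A]
    by (cases "length Xs = k") auto
  have "\<omega> (Xs[i := (\<lambda>h p. f p * Y h p + g p * Z h p)]) =
      (\<lambda>p. f p * \<omega> (Xs[i := Y]) p + g p * \<omega> (Xs[i := Z]) p)"
    if "i < length Xs" "Y \<in> vector_fields A" "Z \<in> vector_fields A" "f \<in> smooth_fun A"
      "g \<in> smooth_fun A" "set Xs \<subseteq> vector_fields A" for Xs i Y Z f g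
  proof (cases "length Xs = k")
    case True
    then show ?thesis using conjunct1[OF conjunct2[OF conjunct2[OF *]]] that by blast
  qed (simp add: zero)
  then show ?thesis using zero smooth unfolding tensorial_def by blast
qed

lemma forms_intro:
  assumes "tensorial A \<omega>" "\<And>Xs p. length Xs \<noteq> k \<Longrightarrow> \<omega> Xs p = 0"
    and "\<And>Xs i j p. i < j \<Longrightarrow> j < length Xs \<Longrightarrow> Xs ! i = Xs ! j \<Longrightarrow> \<omega> Xs p = 0"
  shows "\<omega> \<in> forms A k"
proof -
  have "\<omega> Xs = (\<lambda>p. 0)" if "i < length Xs" "j < length Xs" "i \<noteq> j" "Xs ! i = Xs ! j" for Xs i j
  proof (intro ext)
    show "\<omega> Xs p = 0" for p
      using assms(3)[of i j Xs p] assms(3)[of j i Xs p] that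
      by (cases i j rule: linorder_cases) auto
  qed
  moreover have "\<omega> Xs = (\<lambda>p. 0)" if "\<not> (length Xs = k \<and> set Xs \<subseteq> vector_fields A)" for Xs
    using that assms(2) tensorial_vanish[OF assms(1)] by (cases "length Xs = k") auto
  ultimately show ?thesis
    unfolding forms_def mem_Collect_eq
    by (intro conjI allI impI ballI tensorial_multilinear[OF assms(1)] tensorial_smooth[OF assms(1)])
       (use assms(2) in auto)
qed

lemma forms_eq_0:
  assumes "\<omega> \<in> forms A k" "length Xs \<noteq> k \<or> i < j \<and> j < length Xs \<and> Xs ! i = Xs ! j"
  shows "\<omega> Xs p = 0"
proof (cases "length Xs = k \<and> set Xs \<subseteq> vector_fields A")
  case True
  then have "i < k" "j < k" "i \<noteq> j" "Xs ! i = Xs ! j" using assms(2) by auto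
  then show ?thesis
    using conjunct2[OF conjunct2[OF conjunct2[OF assms(1)[unfolded forms_def mem_Collect_eq]]]] True
    by fastforce
next
  case False
  then show ?thesis
    using conjunct1[OF assms(1)[unfolded forms_def mem_Collect_eq]] by fastforce
qed

lemma tensorial_contract:
  assumes "tensorial A \<omega>" "X \<in> vector_fields A"
  shows "tensorial A (contract X \<omega>)"
proof -
  have "\<omega> (X # Xs[i := (\<lambda>h p. f p * Y h p + g p * Z h p)]) =
      (\<lambda>p. f p * \<omega> (X # Xs[i := Y]) p + g p * \<omega> (X # Xs[i := Z]) p)"
    if "i < length Xs" "Y \<in> vector_fields A" "Z \<in> vector_fields A" "f \<in> smooth_fun A"
      "g \<in> smooth_fun A" "set Xs \<subseteq> vector_fields A" for Xs i Y Z f g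
    using tensorial_multilinear[OF assms(1), of "Suc i" "X # Xs" Y Z f g] that assms(2) by simp
  then show ?thesis
    using assms tensorial_vanish[OF assms(1)] tensorial_smooth[OF assms(1)]
    unfolding tensorial_def contract_def by simp
qed

lemma contract_lin:
  assumes "tensorial A \<omega>" "Y \<in> vector_fields A" "Z \<in> vector_fields A"
    "f \<in> smooth_fun A" "g \<in> smooth_fun A"
  shows "contract (\<lambda>h p. f p * Y h p + g p * Z h p) \<omega> = lin2 f (contract Y \<omega>) g (contract Z \<omega>)"
proof
  fix Xs
  show "contract (\<lambda>h p. f p * Y h p + g p * Z h p) \<omega> Xs = lin2 f (contract Y \<omega>) g (contract Z \<omega>) Xs"
  proof (cases "set Xs \<subseteq> vector_fields A")
    case True
    then show ?thesis
      using tensorial_multilinear[OF assms(1), of 0 "Y # Xs" Y Z f g] assms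
      by (simp add: contract_def lin2_def)
  next
    case False
    then show ?thesis
      using assms by (simp add: contract_def lin2_def tensorial_vanish)
  qed
qed

lemma tensorial_lin2:
  assumes "smooth_atlas A" "tensorial A \<alpha>" "tensorial A \<beta>" "f \<in> smooth_fun A" "g \<in> smooth_fun A"
  shows "tensorial A (lin2 f \<alpha> g \<beta>)"
proof -
  have "lin2 f \<alpha> g \<beta> Xs \<in> smooth_fun A" if "set Xs \<subseteq> vector_fields A" for Xs
    unfolding lin2_def
    by (rule smooth_fun_lin[OF assms(1,4,5) tensorial_smooth[OF assms(2) that] tensorial_smooth[OF assms(3) that]])
  moreover have "lin2 f \<alpha> g \<beta> Xs = (\<lambda>p. 0)" if "\<not> set Xs \<subseteq> vector_fields A" for Xs
    unfolding lin2_def using assms that by (simp add: tensorial_vanish)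
  moreover have "lin2 f \<alpha> g \<beta> (Xs[i := (\<lambda>h p. k p * Y h p + l p * Z h p)]) =
      (\<lambda>p. k p * lin2 f \<alpha> g \<beta> (Xs[i := Y]) p + l p * lin2 f \<alpha> g \<beta> (Xs[i := Z]) p)"
    if "i < length Xs" "Y \<in> vector_fields A" "Z \<in> vector_fields A" "k \<in> smooth_fun A"
      "l \<in> smooth_fun A" "set Xs \<subseteq> vector_fields A" for Xs i Y Z k l
    using that assms by (simp add: lin2_def tensorial_multilinear algebra_simps)
  ultimately show ?thesis unfolding tensorial_def by blast
qed

lemma tensorial_scalar:
  assumes "f \<in> smooth_fun A"
  shows "tensorial A (scalar f)"
proof -
  have "scalar f Xs = (if Xs = [] then f else (\<lambda>p. 0))" for Xs :: "'a vfield list"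
    by (simp add: scalar_def fun_eq_iff)
  then show ?thesis
    using assms smooth_fun_const[of 0 A] by (fastforce simp: tensorial_def)
qed

text \<open>Each entry of the list is handed to one of the two factors, so an inadmissible entry
  kills every summand. No tensoriality is assumed, so Lie and exterior derivatives may be
  factors.\<close>

lemma wedge_vanish:
  assumes "\<And>Xs. \<not> set Xs \<subseteq> S \<Longrightarrow> \<alpha> Xs = (\<lambda>p. 0)" "\<And>Xs. \<not> set Xs \<subseteq> S \<Longrightarrow> \<beta> Xs = (\<lambda>p. 0)"
    "\<not> set Xs \<subseteq> S"
  shows "wedge \<alpha> \<beta> Xs = (\<lambda>p. 0)"
proof -
  have "\<alpha> (nths Xs T) p * \<beta> (nths Xs (- T)) p = 0" for T p
  proof -
    have "set Xs = set (nths Xs T) \<union> set (nths Xs (- T))"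
      unfolding set_nths set_conv_nth[of Xs] by auto
    then have "\<not> set (nths Xs T) \<subseteq> S \<or> \<not> set (nths Xs (- T)) \<subseteq> S" using assms(3) by auto
    then show ?thesis
      using assms(1)[of "nths Xs T"] assms(2)[of "nths Xs (- T)"] by (elim disjE) simp_all
  qed
  then show ?thesis
    unfolding wedge_def by (intro ext sum.neutral) (auto simp: mult.assoc)
qed

lemma tensorial_wedge:
  assumes A: "smooth_atlas A" and \<alpha>: "tensorial A \<alpha>" "one_form \<alpha>" and "tensorial A \<beta>"
  shows "tensorial A (wedge \<alpha> \<beta>)"
proof -
  have smooth: "wedge \<alpha> \<beta> Xs \<in> smooth_fun A"
    if "tensorial A \<beta>" "set Xs \<subseteq> vector_fields A" for Xs \<beta>
    using that
  proof (induction Xs arbitrary: \<beta>)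
    case Nil
    have "wedge \<alpha> \<beta> [] = (\<lambda>p. 0)" using \<alpha> by (intro ext) (simp add: wedge_one_form_Nil)
    then show ?case by (simp add: smooth_fun_const)
  next
    case (Cons X Xs)
    have "wedge \<alpha> \<beta> (X # Xs) = (\<lambda>p. \<alpha> [X] p * \<beta> Xs p + (-1) * wedge \<alpha> (contract X \<beta>) Xs p)"
      using \<alpha> by (intro ext) (simp add: wedge_one_form_Cons)
    also have "\<dots> \<in> smooth_fun A"
      by (rule smooth_fun_lin[OF A tensorial_smooth[OF \<alpha>(1)] smooth_fun_const
            tensorial_smooth[OF Cons.prems(1)] Cons.IH[OF tensorial_contract[OF Cons.prems(1)]]])
         (use Cons.prems in auto)
    finally show ?case .
  qed
  have lin: "wedge \<alpha> \<beta> (Xs[i := (\<lambda>h p. f p * Y h p + g p * Z h p)]) p =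
      f p * wedge \<alpha> \<beta> (Xs[i := Y]) p + g p * wedge \<alpha> \<beta> (Xs[i := Z]) p"
    if "tensorial A \<beta>" "i < length Xs" "Y \<in> vector_fields A" "Z \<in> vector_fields A" "f \<in> smooth_fun A"
      "g \<in> smooth_fun A" "set Xs \<subseteq> vector_fields A" for Xs i Y Z f g \<beta> p
    using that
  proof (induction Xs arbitrary: \<beta> i)
    case (Cons X Xs)
    show ?case
    \<comment> \<open>At the head, linearity comes from \<alpha> and from contraction of \<beta>;
      further down it comes from \<beta> and from the induction hypothesis for its
      contraction.\<close>
    proof (cases i)
      case 0
      have "\<alpha> [\<lambda>h p. f p * Y h p + g p * Z h p] = (\<lambda>p. f p * \<alpha> [Y] p + g p * \<alpha> [Z] p)"
        using tensorial_multilinear[OF \<alpha>(1), of 0 "[X]" Y Z f g] Cons.prems by simp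
      then show ?thesis
        using 0 \<alpha>(2) Cons.prems
        by (simp add: wedge_one_form_Cons contract_lin[OF Cons.prems(1)] wedge_lin2_right)
           (simp add: lin2_def algebra_simps)
    next
      case (Suc k)
      then show ?thesis
        using \<alpha>(2) Cons.prems Cons.IH[of "contract X \<beta>" k]
          tensorial_multilinear[OF Cons.prems(1), of k Xs Y Z f g]
        by (simp add: wedge_one_form_Cons tensorial_contract algebra_simps)
    qed
  qed simp
  have "wedge \<alpha> \<beta> Xs = (\<lambda>p. 0)" if "\<not> set Xs \<subseteq> vector_fields A" for Xs
    using wedge_vanish[of "vector_fields A" \<alpha> \<beta> Xs] tensorial_vanish[OF \<alpha>(1)]
      tensorial_vanish[OF assms(4)] that by blast
  then show ?thesis using smooth[OF assms(4)] lin[OF assms(4)] unfolding tensorial_def by blast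
qed

lemma tensorial_wedges:
  assumes "smooth_atlas A" "\<forall>\<alpha>\<in>set \<alpha>s. \<alpha> \<in> forms A 1"
  shows "tensorial A (wedges \<alpha>s)"
  using assms(2)
proof (induction \<alpha>s)
  case Nil
  then show ?case by (simp add: wedges_Nil tensorial_scalar smooth_fun_const)
next
  case (Cons \<alpha> \<alpha>s)
  then have "\<alpha> \<in> forms A 1" by simp
  then show ?case
    using Cons tensorial_wedge[OF assms(1) forms_tensorial forms_one_form]
    by (simp add: wedges_Cons)
qed

section \<open>Exterior and Lie derivatives\<close>

lemma lie_derivative_vanish:
  "\<not> set Xs \<subseteq> vector_fields A \<Longrightarrow> lie_derivative A X \<omega> Xs = (\<lambda>p. 0)"
  by (auto simp: lie_derivative_def)

lemma ext_d_vanish: "\<not> set Xs \<subseteq> vector_fields A \<Longrightarrow> ext_d A \<omega> Xs = (\<lambda>p. 0)"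
  by (auto simp: ext_d_def)

lemma lie_derivative_Nil: "lie_derivative A X \<omega> [] p = X (\<omega> []) p"
  by (simp add: lie_derivative_def)

lemma ext_d_Nil: "ext_d A \<omega> [] p = 0"
  by (simp add: ext_d_def)

lemma lie_derivative_Cons:
  assumes "Y \<in> vector_fields A" "set Ys \<subseteq> vector_fields A"
  shows "lie_derivative A X \<omega> (Y # Ys) p =
    lie_derivative A X (contract Y \<omega>) Ys p - contract (bracket X Y) \<omega> Ys p"
  using assms by (simp add: lie_derivative_def sum.lessThan_Suc_shift contract_def del: sum.lessThan_Suc)

text \<open>The commutator of a Lie derivative with a contraction, obtained by splitting off the
  summand at position 0. As an equation of forms it can be rewritten inside wedge products.\<close>

lemma contract_lie_derivative:
  assumes "Y \<in> vector_fields A" "tensorial A \<omega>"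
  shows "contract Y (lie_derivative A X \<omega>) =
    lin2 (\<lambda>p. 1) (lie_derivative A X (contract Y \<omega>)) (\<lambda>p. -1) (contract (bracket X Y) \<omega>)"
proof
  fix Ys
  show "contract Y (lie_derivative A X \<omega>) Ys =
    lin2 (\<lambda>p. 1) (lie_derivative A X (contract Y \<omega>)) (\<lambda>p. -1) (contract (bracket X Y) \<omega>) Ys"
  proof (cases "set Ys \<subseteq> vector_fields A")
    case True
    then show ?thesis
      using assms by (simp add: lin2_def fun_eq_iff contract_def[of Y "lie_derivative A X \<omega>"] lie_derivative_Cons)
  next
    case False
    then have "\<not> set (Z # Ys) \<subseteq> vector_fields A" for Z by auto
    then have "lie_derivative A X \<omega> (Y # Ys) = (\<lambda>p. 0)" "\<omega> (bracket X Y # Ys) = (\<lambda>p. 0)"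
      using tensorial_vanish[OF assms(2)] lie_derivative_vanish by blast+
    then show ?thesis
      by (simp add: lin2_def contract_def[of Y "lie_derivative A X \<omega>"]
          contract_def[of "bracket X Y"] lie_derivative_vanish[OF False])
  qed
qed

lemma lie_derivative_lin2:
  assumes A: "smooth_atlas A" and X: "X \<in> vector_fields A"
    and "tensorial A \<alpha>" "tensorial A \<beta>" "f \<in> smooth_fun A" "g \<in> smooth_fun A"
    and Xs: "set Xs \<subseteq> vector_fields A"
  shows "lie_derivative A X (lin2 f \<alpha> g \<beta>) Xs p =
    X f p * \<alpha> Xs p + f p * lie_derivative A X \<alpha> Xs p +
    (X g p * \<beta> Xs p + g p * lie_derivative A X \<beta> Xs p)"
  using vector_field_lin[OF A X assms(5,6) tensorial_smooth[OF assms(3) Xs] tensorial_smooth[OF assms(4) Xs]] Xs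
  by (simp add: lie_derivative_def lin2_def sum.distrib sum_distrib_left algebra_simps)

lemma one_form_lie_derivative:
  assumes "X \<in> vector_fields A" "one_form \<alpha>"
  shows "one_form (lie_derivative A X \<alpha>)"
  unfolding one_form_def
proof (intro allI impI ext)
  fix Xs :: "'a vfield list" and p assume "length Xs \<noteq> 1"
  then have "\<alpha> Xs = (\<lambda>p. 0)" "\<alpha> (Xs[i := Z]) = (\<lambda>p. 0)" for i Z
    using assms(2) by (simp_all add: one_form_def)
  then show "lie_derivative A X \<alpha> Xs p = 0"
    using vector_field_const[OF assms(1), of 0] by (simp add: lie_derivative_def)
qed

text \<open>Contracting with the head reduces the claim to \<beta> and its contraction; the terms
  with \<open>bracket X Y\<close> that the commutator with contraction produces on the two sides
  match.\<close>

lemma lie_derivative_wedge: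
  assumes A: "smooth_atlas A" and X: "X \<in> vector_fields A"
    and \<alpha>: "tensorial A \<alpha>" "one_form \<alpha>" and "tensorial A \<beta>"
  shows "lie_derivative A X (wedge \<alpha> \<beta>) Xs p =
    wedge (lie_derivative A X \<alpha>) \<beta> Xs p + wedge \<alpha> (lie_derivative A X \<beta>) Xs p"
proof (cases "set Xs \<subseteq> vector_fields A")
  case True
  note one = \<alpha>(2) one_form_lie_derivative[OF X \<alpha>(2)]
  from True assms(5) show ?thesis
  proof (induction Xs arbitrary: \<beta>)
    case Nil
    have "wedge \<alpha> \<beta> [] = (\<lambda>p. 0)" by (intro ext) (simp add: wedge_one_form_Nil one)
    then show ?case
      using vector_field_const[OF X, of 0] by (simp add: wedge_one_form_Nil one lie_derivative_Nil)
  next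
    case (Cons Y Ys)
    then have Y: "Y \<in> vector_fields A" "set Ys \<subseteq> vector_fields A" by auto
    have \<alpha>Y: "\<alpha> [Y] \<in> smooth_fun A" using tensorial_smooth[OF \<alpha>(1), of "[Y]"] Y by simp
    have \<iota>: "tensorial A (contract Y \<beta>)" by (rule tensorial_contract[OF Cons.prems(2) Y(1)])
    have "lie_derivative A X (wedge \<alpha> \<beta>) (Y # Ys) p =
      lie_derivative A X (lin2 (\<alpha> [Y]) \<beta> (\<lambda>p. -1) (wedge \<alpha> (contract Y \<beta>))) Ys p
      - contract (bracket X Y) (wedge \<alpha> \<beta>) Ys p"
      by (simp add: lie_derivative_Cons Y contract_wedge_one_form[OF one(1), of Y])
    also have "\<dots> = X (\<alpha> [Y]) p * \<beta> Ys p + \<alpha> [Y] p * lie_derivative A X \<beta> Ys p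
      - (wedge (lie_derivative A X \<alpha>) (contract Y \<beta>) Ys p
         + wedge \<alpha> (lie_derivative A X (contract Y \<beta>)) Ys p)
      - (\<alpha> [bracket X Y] p * \<beta> Ys p - wedge \<alpha> (contract (bracket X Y) \<beta>) Ys p)"
      by (subst lie_derivative_lin2[OF A X Cons.prems(2) tensorial_wedge[OF A \<alpha> \<iota>] \<alpha>Y smooth_fun_const Y(2)])
         (simp add: Cons.IH[OF Y(2) \<iota>] vector_field_const[OF X] contract_wedge_one_form[OF one(1)] lin2_def)
    also have "\<dots> = wedge (lie_derivative A X \<alpha>) \<beta> (Y # Ys) p + wedge \<alpha> (lie_derivative A X \<beta>) (Y # Ys) p"
      using Y(1)
      by (simp add: wedge_one_form_Cons one contract_lie_derivative[OF Y(1) Cons.prems(2)] wedge_lin2_right)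
         (simp add: lin2_def lie_derivative_def algebra_simps)
    finally show ?case .
  qed
next
  case False
  have "wedge (lie_derivative A X \<alpha>) \<beta> Xs = (\<lambda>p. 0)" "wedge \<alpha> (lie_derivative A X \<beta>) Xs = (\<lambda>p. 0)"
    by (rule wedge_vanish[OF _ _ False],
        simp_all add: lie_derivative_vanish tensorial_vanish[OF assms(5)] tensorial_vanish[OF \<alpha>(1)])+
  with False show ?thesis
    by (simp add: lie_derivative_vanish)
qed

text \<open>Cartan's formula; it turns the Koszul formula into a recursion on the list of arguments.\<close>

lemma ext_d_Cons:
  assumes "alternating \<omega>" and X: "X \<in> vector_fields A" "set Xs \<subseteq> vector_fields A"
  shows "ext_d A \<omega> (X # Xs) p = lie_derivative A X \<omega> Xs p - ext_d A (contract X \<omega>) Xs p"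
proof -
  have n0: "nths (X # Xs) (- {0}) = Xs"
    by (simp add: nths_Cons nths_all)
  have nS: "nths (X # Xs) (- {Suc i}) = X # nths Xs (- {i})" for i
  proof -
    have "{j. Suc j \<in> - {Suc i}} = - {i}" by auto
    then show ?thesis by (simp add: nths_Cons)
  qed
  have n0S: "nths (X # Xs) (- {0, Suc j}) = nths Xs (- {j})" for j
  proof -
    have "{i. Suc i \<in> - {0, Suc j}} = - {j}" by auto
    then show ?thesis by (simp add: nths_Cons)
  qed
  have nSS: "nths (X # Xs) (- {Suc i, Suc j}) = X # nths Xs (- {i, j})" for i j
  proof -
    have "{k. Suc k \<in> - {Suc i, Suc j}} = - {i, j}" by auto
    then show ?thesis by (simp add: nths_Cons)
  qed
  \<comment> \<open>Among the differentiated terms, position 0 gives the leading term of the Lie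
    derivative; the others belong to the contraction, shifted by one position and hence with
    opposite sign.\<close>
  have "(\<Sum>i<length (X # Xs). (-1) ^ i * ((X # Xs) ! i) (\<omega> (nths (X # Xs) (- {i}))) p) =
      X (\<omega> Xs) p - (\<Sum>i<length Xs. (-1) ^ i * (Xs ! i) (contract X \<omega> (nths Xs (- {i}))) p)"
    by (simp add: sum.lessThan_Suc_shift n0 nS contract_def sum_negf del: sum.lessThan_Suc)
  moreover have "(\<Sum>j<length (X # Xs). \<Sum>i<j. (-1) ^ (i + j) *
        \<omega> (bracket ((X # Xs) ! i) ((X # Xs) ! j) # nths (X # Xs) (- {i, j})) p) =
      - (\<Sum>j<length Xs. \<omega> (Xs[j := bracket X (Xs ! j)]) p)
      - (\<Sum>j<length Xs. \<Sum>i<j. (-1) ^ (i + j) *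
           contract X \<omega> (bracket (Xs ! i) (Xs ! j) # nths Xs (- {i, j})) p)"
  proof -
    \<comment> \<open>Brackets with the head \<open>X\<close>: moving the bracket from the front to
      position j absorbs (-1) ^ j and leaves -1.\<close>
    have 0: "(-1) ^ Suc j * \<omega> (bracket X (Xs ! j) # nths Xs (- {j})) p = - \<omega> (Xs[j := bracket X (Xs ! j)]) p"
      if "j < length Xs" for j
      using alternating_move[OF assms(1) that, of "bracket X (Xs ! j)" p] by simp
    \<comment> \<open>Brackets of two other arguments stand before \<open>X\<close>; one swap brings
      \<open>X\<close> to the front, where it is contracted.\<close>
    have swap: "\<omega> (Z # X # Zs) p = - contract X \<omega> (Z # Zs) p" for Z Zs
      using alternatingD[OF assms(1), of Z X Zs p] by (simp add: contract_def)
    have "(\<Sum>j<length (X # Xs). \<Sum>i<j. (-1) ^ (i + j) *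
        \<omega> (bracket ((X # Xs) ! i) ((X # Xs) ! j) # nths (X # Xs) (- {i, j})) p) =
      (\<Sum>j<length Xs. (-1) ^ Suc j * \<omega> (bracket X (Xs ! j) # nths Xs (- {j})) p +
         (\<Sum>i<j. (-1) ^ (i + j) * \<omega> (bracket (Xs ! i) (Xs ! j) # X # nths Xs (- {i, j})) p))"
      by (simp add: sum.lessThan_Suc_shift n0S nSS del: sum.lessThan_Suc)
    also have "\<dots> = (\<Sum>j<length Xs. - \<omega> (Xs[j := bracket X (Xs ! j)]) p
         - (\<Sum>i<j. (-1) ^ (i + j) * contract X \<omega> (bracket (Xs ! i) (Xs ! j) # nths Xs (- {i, j})) p))"
      by (intro sum.cong refl) (simp add: 0[simplified] swap sum_negf)
    finally show ?thesis by (simp add: sum_subtractf sum_negf)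
  qed
  ultimately show ?thesis
    using X unfolding ext_d_def lie_derivative_def by simp
qed

lemma ext_d_degree:
  assumes "\<And>Xs. length Xs \<noteq> k \<Longrightarrow> \<omega> Xs = (\<lambda>p. 0)" "length Xs \<noteq> Suc k"
  shows "ext_d A \<omega> Xs p = 0"
proof (cases "set Xs \<subseteq> vector_fields A")
  case True
  have l1: "length (nths Xs (- {i})) = length Xs - 1" if "i < length Xs" for i
  proof -
    have "{j. j < length Xs \<and> j \<in> - {i}} = {..<length Xs} - {i}" by auto
    then show ?thesis using that by (simp add: length_nths)
  qed
  have l2: "Suc (length (nths Xs (- {i, j}))) = length Xs - 1" if "i < j" "j < length Xs" for i j
  proof -
    have "{l. l < length Xs \<and> l \<in> - {i, j}} = {..<length Xs} - {i, j}" by auto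
    moreover have "card ({..<length Xs} - {i, j}) = length Xs - 2"
      using that by (subst card_Diff_subset) auto
    ultimately show ?thesis using that by (simp add: length_nths)
  qed
  have "(Xs ! i) (\<omega> (nths Xs (- {i}))) p = 0" if "i < length Xs" for i
  proof -
    have "\<omega> (nths Xs (- {i})) = (\<lambda>p. 0)" using assms(2) that by (intro assms(1)) (simp add: l1)
    moreover have "Xs ! i \<in> vector_fields A" using True that by auto
    ultimately show ?thesis using vector_field_const[of "Xs ! i" A 0] by simp
  qed
  moreover have "\<omega> (bracket (Xs ! i) (Xs ! j) # nths Xs (- {i, j})) p = 0" if "i < j" "j < length Xs" for i j
    using assms(2) that l2[OF that] by (subst assms(1)) auto
  ultimately show ?thesis by (simp add: ext_d_def)
qed (simp add: ext_d_vanish)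

lemma ext_d_scalar_Cons:
  "X \<in> vector_fields A \<Longrightarrow> ext_d A (scalar f) [X] p = X f p"
  by (simp add: ext_d_def nths_Cons scalar_def)

lemma one_form_ext_d_scalar: "one_form (ext_d A (scalar f))"
  unfolding one_form_def using ext_d_degree[of 0 "scalar f"]
  by (auto simp: scalar_def fun_eq_iff)

lemma alternating_lin2: "alternating \<alpha> \<Longrightarrow> alternating \<beta> \<Longrightarrow> alternating (lin2 f \<alpha> g \<beta>)"
  unfolding alternating_def lin2_def
  by (metis (no_types, lifting) add_uminus_conv_diff minus_add_distrib mult_minus_right)

text \<open>The Leibniz rule for function coefficients, \<open>ext_d A (scalar f)\<close> being df.
  In Cartan's recursion the Lie derivative supplies X f, which is the head term of df wedge
  \<alpha>.\<close>

lemma ext_d_lin2: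
  assumes A: "smooth_atlas A" and f: "f \<in> smooth_fun A" and g: "g \<in> smooth_fun A"
    and \<alpha>: "tensorial A \<alpha>" "alternating \<alpha>" and \<beta>: "tensorial A \<beta>" "alternating \<beta>"
  shows "ext_d A (lin2 f \<alpha> g \<beta>) Xs p =
    wedge (ext_d A (scalar f)) \<alpha> Xs p + f p * ext_d A \<alpha> Xs p +
    (wedge (ext_d A (scalar g)) \<beta> Xs p + g p * ext_d A \<beta> Xs p)"
proof (cases "set Xs \<subseteq> vector_fields A")
  case True
  from True \<alpha> \<beta> show ?thesis
  proof (induction Xs arbitrary: \<alpha> \<beta>)
    case Nil
    then show ?case by (simp add: ext_d_Nil wedge_one_form_Nil one_form_ext_d_scalar)
  next
    case (Cons X Xs)
    then have X: "X \<in> vector_fields A" "set Xs \<subseteq> vector_fields A" by auto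
    show ?case
      by (simp add: ext_d_Cons X Cons.prems alternating_lin2 contract_lin2
          lie_derivative_lin2[OF A X(1) Cons.prems(2,4) f g X(2)]
          Cons.IH[OF X(2) tensorial_contract[OF Cons.prems(2) X(1)] alternating_contract[OF Cons.prems(3)]
            tensorial_contract[OF Cons.prems(4) X(1)] alternating_contract[OF Cons.prems(5)]]
          wedge_one_form_Cons[OF one_form_ext_d_scalar] ext_d_scalar_Cons algebra_simps)
  qed
next
  case False
  have "wedge (ext_d A (scalar f)) \<alpha> Xs = (\<lambda>p. 0)" "wedge (ext_d A (scalar g)) \<beta> Xs = (\<lambda>p. 0)"
    by (rule wedge_vanish[OF _ _ False],
        simp_all add: ext_d_vanish tensorial_vanish[OF \<alpha>(1)] tensorial_vanish[OF \<beta>(1)])+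
  with False show ?thesis
    by (simp add: ext_d_vanish)
qed

lemma ext_d_scalar_const: "ext_d A (scalar (\<lambda>p. c)) = (\<lambda>Xs p. 0)"
proof (intro ext)
  fix Xs p
  show "ext_d A (scalar (\<lambda>p. c)) Xs p = 0"
  proof (cases "length Xs = 1 \<and> set Xs \<subseteq> vector_fields A")
    case True
    then obtain X where "Xs = [X]" "X \<in> vector_fields A" by (cases Xs) auto
    then show ?thesis by (simp add: ext_d_scalar_Cons vector_field_const)
  next
    case False
    then have "length Xs \<noteq> 1 \<or> \<not> set Xs \<subseteq> vector_fields A" by blast
    then have "ext_d A (scalar (\<lambda>p. c)) Xs = (\<lambda>p. 0)"
      using one_form_ext_d_scalar[of A "\<lambda>p. c"] ext_d_vanish[of Xs A "scalar (\<lambda>p. c)"]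
      unfolding one_form_def by blast
    then show ?thesis by simp
  qed
qed

lemma wedge_zero_left: "wedge (\<lambda>Xs p. 0) \<beta> = (\<lambda>Xs p. 0)"
  by (intro ext) (simp add: wedge_def)

lemma ext_d_lin2_const:
  assumes "smooth_atlas A" "tensorial A \<alpha>" "alternating \<alpha>" "tensorial A \<beta>" "alternating \<beta>"
  shows "ext_d A (lin2 (\<lambda>p. a) \<alpha> (\<lambda>p. b) \<beta>) = lin2 (\<lambda>p. a) (ext_d A \<alpha>) (\<lambda>p. b) (ext_d A \<beta>)"
  by (intro ext)
     (simp add: ext_d_lin2[OF assms(1) smooth_fun_const smooth_fun_const assms(2-5)]
       ext_d_scalar_const wedge_zero_left lin2_def[of _ "ext_d A \<alpha>"])

text \<open>Contraction produces the non-constant coefficient \<alpha>[X], which is why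
  \<open>ext_d_lin2\<close> allows functions. Its differential is absorbed by Cartan's formula for
  \<alpha>: the contraction of d\<alpha> is L_X \<alpha> - d(\<alpha>[X]).\<close>

lemma ext_d_wedge:
  assumes A: "smooth_atlas A" and \<alpha>: "\<alpha> \<in> forms A 1" and \<beta>: "tensorial A \<beta>" "alternating \<beta>"
  shows "ext_d A (wedge \<alpha> \<beta>) Xs p = wedge (ext_d A \<alpha>) \<beta> Xs p - wedge \<alpha> (ext_d A \<beta>) Xs p"
proof (cases "set Xs \<subseteq> vector_fields A")
  case True
  note one = forms_one_form[OF \<alpha>]
  note t\<alpha> = forms_tensorial[OF \<alpha>]
  have alt\<alpha>: "alternating \<alpha>"
    using one by (simp add: alternating_def one_form_def)
  \<comment> \<open>d\<alpha> is concentrated in degree 2, so the grade involution in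
    \<open>wedge_Cons\<close> fixes it.\<close>
  have d\<alpha>: "alternate (ext_d A \<alpha>) = ext_d A \<alpha>"
  proof (intro ext)
    show "alternate (ext_d A \<alpha>) Zs p = ext_d A \<alpha> Zs p" for Zs p
      using ext_d_degree[of 1 \<alpha> Zs A p] one
      by (cases "length Zs = 2") (simp_all add: alternate_def one_form_def)
  qed
  from True \<beta> show ?thesis
  proof (induction Xs arbitrary: \<beta>)
    case Nil
    then show ?case by (simp add: ext_d_Nil wedge_Nil)
  next
    case (Cons X Xs)
    then have X: "X \<in> vector_fields A" "set Xs \<subseteq> vector_fields A" by auto
    have \<alpha>X: "\<alpha> [X] \<in> smooth_fun A" using tensorial_smooth[OF t\<alpha>, of "[X]"] X by simp
    note \<iota> = tensorial_contract[OF Cons.prems(2) X(1)] alternating_contract[OF Cons.prems(3), of X]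
    have \<iota>d: "contract X (ext_d A \<omega>) = lin2 (\<lambda>p. 1) (lie_derivative A X \<omega>) (\<lambda>p. -1) (ext_d A (contract X \<omega>))"
      if "alternating \<omega>" for \<omega>
    proof (intro ext)
      fix Zs p
      show "contract X (ext_d A \<omega>) Zs p =
        lin2 (\<lambda>p. 1) (lie_derivative A X \<omega>) (\<lambda>p. -1) (ext_d A (contract X \<omega>)) Zs p"
      proof (cases "set Zs \<subseteq> vector_fields A")
        case True
        then show ?thesis using ext_d_Cons[OF that X(1) True] by (simp add: contract_def lin2_def)
      next
        case False
        then have "ext_d A \<omega> (X # Zs) = (\<lambda>p. 0)" by (intro ext_d_vanish) auto
        then show ?thesis
          by (simp add: contract_def[of X "ext_d A \<omega>"] lin2_def ext_d_vanish[OF False]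
              lie_derivative_vanish[OF False])
      qed
    qed
    have "ext_d A (wedge \<alpha> \<beta>) (X # Xs) p = lie_derivative A X (wedge \<alpha> \<beta>) Xs p
      - ext_d A (lin2 (\<alpha> [X]) \<beta> (\<lambda>p. -1) (wedge \<alpha> (contract X \<beta>))) Xs p"
      by (simp add: ext_d_Cons[OF alternating_wedge[OF one Cons.prems(3)] X] contract_wedge_one_form[OF one])
    also have "\<dots> = wedge (lie_derivative A X \<alpha>) \<beta> Xs p + wedge \<alpha> (lie_derivative A X \<beta>) Xs p
      - (wedge (ext_d A (scalar (\<alpha> [X]))) \<beta> Xs p + \<alpha> [X] p * ext_d A \<beta> Xs p
         - (wedge (ext_d A \<alpha>) (contract X \<beta>) Xs p - wedge \<alpha> (ext_d A (contract X \<beta>)) Xs p))"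
      by (simp add: lie_derivative_wedge[OF A X(1) t\<alpha> one Cons.prems(2)]
          ext_d_lin2[OF A \<alpha>X smooth_fun_const Cons.prems(2,3) tensorial_wedge[OF A t\<alpha> one \<iota>(1)]
            alternating_wedge[OF one \<iota>(2)]]
          Cons.IH[OF X(2) \<iota>] ext_d_scalar_const wedge_zero_left)
    also have "\<dots> = wedge (ext_d A \<alpha>) \<beta> (X # Xs) p - wedge \<alpha> (ext_d A \<beta>) (X # Xs) p"
      by (simp add: wedge_one_form_Cons[OF one] wedge_Cons[of "ext_d A \<alpha>"] d\<alpha> \<iota>d[OF alt\<alpha>]
          \<iota>d[OF Cons.prems(3)] one_form_contract[OF one] wedge_lin2_left wedge_lin2_right)
         (simp add: lin2_def)
    finally show ?case .
  qed
next
  case False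
  have "wedge (ext_d A \<alpha>) \<beta> Xs = (\<lambda>p. 0)" "wedge \<alpha> (ext_d A \<beta>) Xs = (\<lambda>p. 0)"
    by (rule wedge_vanish[OF _ _ False],
        simp_all add: ext_d_vanish tensorial_vanish[OF \<beta>(1)] tensorial_vanish[OF forms_tensorial[OF \<alpha>]])+
  with False show ?thesis
    by (simp add: ext_d_vanish)
qed

section \<open>Coframes\<close>

text \<open>Keeps the index range \<open>{1..7}\<close> from being rewritten to \<open>{Suc 0..7}\<close>.\<close>

declare One_nat_def [simp del]

lemma wedge_sum_left:
  "wedge (\<lambda>Xs p. \<Sum>i\<in>S. c i p * \<alpha> i Xs p) \<beta> = (\<lambda>Xs p. \<Sum>i\<in>S. c i p * wedge (\<alpha> i) \<beta> Xs p)"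
  unfolding wedge_def sum_distrib_left sum_distrib_right
  by (intro ext, subst sum.swap) (simp add: algebra_simps)

lemma wedge_sum_right:
  "wedge \<beta> (\<lambda>Xs p. \<Sum>i\<in>S. c i p * \<alpha> i Xs p) = (\<lambda>Xs p. \<Sum>i\<in>S. c i p * wedge \<beta> (\<alpha> i) Xs p)"
  unfolding wedge_def sum_distrib_left sum_distrib_right
  by (intro ext, subst sum.swap) (simp add: algebra_simps)

lemma wedge_scale_left: "wedge (\<lambda>Xs p. c * \<alpha> Xs p) \<beta> = (\<lambda>Xs p. c * wedge \<alpha> \<beta> Xs p)"
  by (intro ext) (simp add: wedge_def sum_distrib_left algebra_simps)

lemma wedge_scale_right: "wedge \<alpha> (\<lambda>Xs p. c * \<beta> Xs p) = (\<lambda>Xs p. c * wedge \<alpha> \<beta> Xs p)"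
  by (intro ext) (simp add: wedge_def sum_distrib_left algebra_simps)

lemma wedge_one_form_eq_0:
  assumes "one_form \<alpha>" "\<And>X. X \<in> set Xs \<Longrightarrow> \<alpha> [X] p = 0"
  shows "wedge \<alpha> \<beta> Xs p = 0"
  using assms(2)
  by (induction Xs arbitrary: \<beta>) (simp_all add: wedge_one_form_Nil wedge_one_form_Cons assms(1))

text \<open>The constant pairing with a global dual frame supplies test arguments \<open>E i\<close>
  on which every product \<open>W I\<close> takes constant values.\<close>

locale coframe =
  fixes A :: "('a::{t2_space,second_countable_topology}, real^7) atlas"
    and x :: "nat \<Rightarrow> 'a form" and E :: "nat \<Rightarrow> 'a vfield"
  assumes atlas: "smooth_atlas A"
    and x_forms: "i \<in> {1..7} \<Longrightarrow> x i \<in> forms A 1"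
    and E_fields: "i \<in> {1..7} \<Longrightarrow> E i \<in> vector_fields A"
    and dual: "i \<in> {1..7} \<Longrightarrow> j \<in> {1..7} \<Longrightarrow> x i [E j] = (\<lambda>p. if i = j then 1 else 0)"
begin

abbreviation W :: "nat list \<Rightarrow> 'a form" where "W I \<equiv> wedges (map x I)"

lemma one_form_x: "i \<in> {1..7} \<Longrightarrow> one_form (x i)"
  by (rule forms_one_form[OF x_forms])

lemma alternating_W: "set I \<subseteq> {1..7} \<Longrightarrow> alternating (W I)"
  by (rule alternating_wedges) (auto intro: one_form_x)

lemma tensorial_W: "set I \<subseteq> {1..7} \<Longrightarrow> tensorial A (W I)"
  by (rule tensorial_wedges[OF atlas]) (auto intro: x_forms)

lemma W_degree: "set I \<subseteq> {1..7} \<Longrightarrow> length Xs \<noteq> length I \<Longrightarrow> W I Xs p = 0"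
  by (rule wedges_degree) (auto intro: one_form_x)

lemma W_move:
  assumes "set I \<subseteq> {1..7}" "i \<in> {1..7}"
  shows "W (I @ i # J) = (\<lambda>Xs p. (-1) ^ length I * W (i # I @ J) Xs p)"
  using assms(1)
proof (induction I)
  case (Cons j I)
  then have "one_form (x i)" "one_form (x j)" using assms(2) by (simp_all add: one_form_x)
  from wedge_one_form_swap[OF this(2,1)] Cons show ?case
    by (simp add: wedges_Cons wedge_scale_right)
qed simp

lemma W_not_distinct:
  assumes "set I \<subseteq> {1..7}" "\<not> distinct I"
  shows "W I = (\<lambda>Xs p. 0)"
  using assms
proof (induction I)
  case (Cons i I)
  show ?case
  proof (cases "i \<in> set I")
    case True
    then obtain I1 I2 where I: "I = I1 @ i # I2" by (auto simp: in_set_conv_decomp)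
    have "one_form (x i)" using Cons.prems by (simp add: one_form_x)
    from wedge_one_form_self[OF this] show ?thesis
      using W_move[of I1 i I2] Cons.prems unfolding I
      by (simp add: wedges_Cons wedge_scale_right)
  next
    case False
    then have "W I = (\<lambda>Xs p. 0)" using Cons by simp
    then show ?thesis using wedge_scale_right[of "x i" 0] by (simp add: wedges_Cons)
  qed
qed simp

lemma W_frame_other:
  assumes "set J \<subseteq> {1..7}" "i \<in> {1..7}" "i \<notin> set J"
  shows "wedge (x i) \<beta> (map E J) p = 0"
  by (rule wedge_one_form_eq_0[OF one_form_x]) (use assms dual in auto)

text \<open>If J rearranges I, then \<open>W I (map E J)\<close> is the sign of the rearrangement,
  and reordering J into I costs the same sign. Otherwise both sides vanish.\<close>

lemma W_wedge_W:
  assumes "set I \<subseteq> {1..7}" "set K \<subseteq> {1..7}" "distinct (I @ K)" "length J = length I"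
    "set J \<subseteq> set I \<union> set K"
  shows "W (J @ K) Xs p = W I (map E J) p * W (I @ K) Xs p"
  using assms
proof (induction I arbitrary: J Xs)
  case Nil
  then show ?case by (simp add: wedges_Nil scalar_def)
next
  case (Cons i I)
  have i: "i \<in> {1..7}" and J7: "set J \<subseteq> {1..7}" using Cons.prems by auto
  have JK7: "set (J @ K) \<subseteq> {1..7}" using J7 Cons.prems by auto
  consider "i \<notin> set J" | "\<not> distinct J" | "i \<in> set J" "distinct J" by blast
  then show ?case
  proof cases
    case 1
    \<comment> \<open>Pigeonhole: with i missing from J, the entries of \<open>J @ K\<close> lie
      among those of \<open>I @ K\<close>, which is shorter by one.\<close>
    have "\<not> distinct (J @ K)"
    proof
      assume "distinct (J @ K)"
      then have "length (J @ K) = card (set (J @ K))" by (rule distinct_card[symmetric])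
      also have "\<dots> \<le> card (set (I @ K))" using 1 Cons.prems by (intro card_mono) auto
      also have "\<dots> \<le> length (I @ K)" by (rule card_length)
      finally show False using Cons.prems by simp
    qed
    then show ?thesis
      using W_not_distinct[OF JK7] W_frame_other[of J i "W I" p] 1 J7 i Cons.prems
      by (simp add: wedges_Cons)
  next
    case 2
    then obtain a b where ab: "a < b" "b < length J" "J ! a = J ! b"
      by (metis distinct_conv_nth nat_neq_iff)
    have "W (i # I) (map E J) p = 0"
      by (rule alternating_eq_0[OF alternating_W, of _ a b]) (use ab Cons.prems in auto)
    moreover have "W (J @ K) = (\<lambda>Xs p. 0)" using W_not_distinct[OF JK7] 2 by simp
    ultimately show ?thesis by simp
  next
    case 3
    \<comment> \<open>Pulling i to the front of \<open>J @ K\<close> and pulling \<open>E i\<close>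
      to the front of the arguments both cost (-1) ^ length J1; after that i is stripped from both
      lists.\<close>
    then obtain J1 J2 where J: "J = J1 @ i # J2" by (auto simp: in_set_conv_decomp)
    have J': "i \<notin> set (J1 @ J2)" "set (J1 @ J2) \<subseteq> {1..7}" using 3 J J7 by auto
    have IH: "W ((J1 @ J2) @ K) Xs p = W I (map E (J1 @ J2)) p * W (I @ K) Xs p" for Xs
      using Cons.prems J J' by (intro Cons.IH) auto
    have "W (J @ K) Xs p = (-1) ^ length J1 * W (i # J1 @ J2 @ K) Xs p"
      using W_move[of J1 i "J2 @ K"] J J7 i by simp
    also have "W (i # J1 @ J2 @ K) Xs p = wedge (x i) (W (J1 @ J2 @ K)) Xs p"
      by (simp add: wedges_Cons)
    also have "\<dots> = W I (map E (J1 @ J2)) p * wedge (x i) (W (I @ K)) Xs p"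
      using IH by (simp add: wedge_def sum_distrib_left algebra_simps)
    finally have L: "W (J @ K) Xs p =
      (-1) ^ length J1 * W I (map E (J1 @ J2)) p * W (i # I @ K) Xs p"
      by (simp add: wedges_Cons)
    have n: "nths (map E J) (- {length J1}) = map E (J1 @ J2)"
    proof -
      have "{j. j + length J1 \<in> - {length J1}} = {j. 0 < j}" by auto
      moreover have "nths (map E J1) (- {length J1}) = map E J1"
        by (rule nths_all) auto
      ultimately show ?thesis
        unfolding J by (simp add: nths_append nths_Cons nths_all)
    qed
    have "W (i # I) (E i # map E (J1 @ J2)) p = (-1) ^ length J1 * W (i # I) (map E J) p"
    proof -
      have "W (i # I) (E i # nths (map E J) (- {length J1})) p =
          (-1) ^ length J1 * W (i # I) ((map E J)[length J1 := E i]) p"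
        by (rule alternating_move[OF alternating_W]) (use Cons.prems J in auto)
      moreover have "(map E J)[length J1 := E i] = map E J"
        by (simp add: J list_update_append)
      ultimately show ?thesis by (simp only: n)
    qed
    moreover have "W (i # I) (E i # map E (J1 @ J2)) p = W I (map E (J1 @ J2)) p"
      using W_frame_other[of "J1 @ J2" i _ p] J' i Cons.prems
      by (simp add: wedges_Cons wedge_one_form_Cons one_form_x dual)
    ultimately have "W I (map E (J1 @ J2)) p = (-1) ^ length J1 * W (i # I) (map E J) p" by simp
    then show ?thesis unfolding L by (simp add: wedges_Cons)
  qed
qed

text \<open>A form with this property sees an argument only through its coordinates
  \<open>x i [Y]\<close>. Products of the coframe have it even if Y is not a combination of the
  \<open>E i\<close>.\<close>

definition expands :: "'a form \<Rightarrow> bool" where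
  "expands \<omega> \<longleftrightarrow> (\<forall>Xs Y Ys p. \<omega> (Xs @ Y # Ys) p = (\<Sum>i=1..7. x i [Y] p * \<omega> (Xs @ E i # Ys) p))"

lemma expands_wedge:
  assumes "j \<in> {1..7}" "expands \<beta>"
  shows "expands (wedge (x j) \<beta>)"
proof -
  note one = one_form_x[OF assms(1)]
  have "wedge (x j) \<beta> (Xs @ Y # Ys) p = (\<Sum>i=1..7. x i [Y] p * wedge (x j) \<beta> (Xs @ E i # Ys) p)"
    for Xs Y Ys p
    using assms(2)
  proof (induction Xs arbitrary: \<beta>)
    case Nil
    have "contract Y \<beta> = (\<lambda>Zs p. \<Sum>i=1..7. x i [Y] p * contract (E i) \<beta> Zs p)"
    proof (intro ext)
      show "contract Y \<beta> Zs p = (\<Sum>i=1..7. x i [Y] p * contract (E i) \<beta> Zs p)" for Zs p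
        using Nil[unfolded expands_def, rule_format, of "[]" Y Zs p] by (simp add: contract_def)
    qed
    moreover have "x j [Y] p = (\<Sum>i=1..7. x i [Y] p * x j [E i] p)"
      using assms(1) by (simp add: dual if_distrib cong: if_cong)
    ultimately show ?case
      by (simp only: append_Nil wedge_one_form_Cons[OF one] wedge_sum_right)
         (simp add: sum_subtractf algebra_simps sum_distrib_left sum_distrib_right)
  next
    case (Cons X Xs)
    have "expands (contract X \<beta>)"
      unfolding expands_def contract_def
    proof (intro allI)
      show "\<beta> (X # Zs @ Z # Ys) p = (\<Sum>i=1..7. x i [Z] p * \<beta> (X # Zs @ E i # Ys) p)" for Zs Z Ys p
        using Cons.prems[unfolded expands_def, rule_format, of "X # Zs" Z Ys p] by simp
    qed
    from Cons.IH[OF this] show ?case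
      using Cons.prems[unfolded expands_def, rule_format, of Xs Y Ys p]
      by (simp add: wedge_one_form_Cons[OF one] sum_subtractf algebra_simps sum_distrib_left)
  qed
  then show ?thesis unfolding expands_def by blast
qed

lemma expands_W: "set I \<subseteq> {1..7} \<Longrightarrow> expands (W I)"
proof (induction I)
  case Nil
  show ?case by (simp add: expands_def wedges_Nil scalar_def)
qed (simp add: wedges_Cons expands_wedge)

text \<open>The arguments are replaced from left to right by frame fields; the induction carries the
  prefix \<open>map E J\<close> that has already been replaced.\<close>

lemma multilinear_eq_0:
  fixes G :: "'a vfield list \<Rightarrow> real"
  assumes "\<And>Xs Y Ys. G (Xs @ Y # Ys) = (\<Sum>i=1..7. x i [Y] p * G (Xs @ E i # Ys))"
    and "\<And>J. set J \<subseteq> {1..7} \<Longrightarrow> length J = k \<Longrightarrow> G (map E J) = 0"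
    and "length Ys = k"
  shows "G Ys = 0"
proof -
  have "G (map E J @ Ys) = 0" if "set J \<subseteq> {1..7}" "length J + length Ys = k" for J
    using that
  proof (induction Ys arbitrary: J)
    case Nil
    then show ?case using assms(2) by simp
  next
    case (Cons Y Ys)
    have "G (map E J @ E i # Ys) = 0" if "i \<in> {1..7}" for i
      using Cons.IH[of "J @ [i]"] Cons.prems that by simp
    then show ?case by (subst assms(1)) simp
  qed
  from this[of "[]"] show ?thesis using assms(3) by simp
qed

section \<open>The induced metric and duals of monomials\<close>

definition metric :: "'a metric" where
  "metric X Y p = (\<Sum>i=1..7. x i [X] p * x i [Y] p)"

lemma flat_metric: "flat metric Y = (\<lambda>Zs p. \<Sum>i=1..7. x i [Y] p * x i Zs p)"
proof (intro ext)
  fix Zs p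
  have "x i Zs p = 0" if "i \<in> {1..7}" "length Zs \<noteq> 1" for i
    using one_form_x[OF that(1)] that(2) by (simp add: one_form_def)
  then show "flat metric Y Zs p = (\<Sum>i=1..7. x i [Y] p * x i Zs p)"
    by (cases Zs rule: list.exhaust; cases "tl Zs")
       (auto simp: flat_def metric_def split: list.split)
qed

lemma flat_E: "j \<in> {1..7} \<Longrightarrow> flat metric (E j) = x j"
proof (intro ext)
  fix Zs p assume j: "j \<in> {1..7}"
  have "flat metric (E j) Zs p = (\<Sum>i=1..7. if i = j then x i Zs p else 0)"
    unfolding flat_metric by (intro sum.cong) (use j in \<open>auto simp: dual\<close>)
  then show "flat metric (E j) Zs p = x j Zs p" using j by simp
qed

text \<open>Up to the sign of the ordering \<open>I @ K\<close>, this identifies \<open>W K\<close>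
  as the Hodge dual of \<open>W I\<close>. Both sides depend on \<open>Ys\<close> only through
  coordinates, so frame fields suffice, and there it is \<open>W_wedge_W\<close>.\<close>

lemma flat_metric_wedge:
  assumes "set I \<subseteq> {1..7}" "set K \<subseteq> {1..7}" "distinct (I @ K)" "set (I @ K) = {1..7}"
    "length Ys = length I"
  shows "wedge (wedges (map (flat metric) Ys)) (W K) Xs p = W I Ys p * W (I @ K) Xs p"
proof -
  let ?G = "\<lambda>Ys. wedge (wedges (map (flat metric) Ys)) (W K) Xs p - W I Ys p * W (I @ K) Xs p"
  have "?G Ys = 0"
  proof (rule multilinear_eq_0[where G = ?G and k = "length I" and p = p])
    fix Zs Y Ys
    have "wedges (map (flat metric) (Zs @ Y # Ys)) = (\<lambda>Xs p. \<Sum>i=1..7. x i [Y] p *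
        wedges (map (flat metric) (Zs @ E i # Ys)) Xs p)"
      by (intro ext) (simp add: wedges_append wedges_Cons flat_E wedge_sum_left wedge_sum_right
          flat_metric[of Y])
    moreover have "W I (Zs @ Y # Ys) p = (\<Sum>i=1..7. x i [Y] p * W I (Zs @ E i # Ys) p)"
      using expands_W[OF assms(1)] unfolding expands_def by blast
    ultimately show "?G (Zs @ Y # Ys) = (\<Sum>i=1..7. x i [Y] p * ?G (Zs @ E i # Ys))"
      by (simp only: wedge_sum_left)
         (simp add: right_diff_distrib sum_subtractf sum_distrib_left sum_distrib_right algebra_simps)
  next
    fix J assume J: "set J \<subseteq> {1..7::nat}" "length J = length I"
    have eq: "map (flat metric) (map E J) = map x J" "wedge (W J) (W K) = W (J @ K)"
      using J flat_E by (auto simp: wedges_append)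
    show "?G (map E J) = 0"
      unfolding eq using W_wedge_W[OF assms(1-3) J(2), of Xs p] J(1) assms(4) by simp
  qed (rule assms(5))
  then show ?thesis by simp
qed

text \<open>Only the shuffle that feeds all of \<open>map E J\<close> to \<open>W J\<close>
  survives, because \<open>Zs\<close> is invisible to these \<open>x j\<close>; its sign is +1 as
  the frame fields come first.\<close>

lemma wedge_frame:
  assumes "set J \<subseteq> {1..7}" "distinct J" "\<And>Z j. Z \<in> set Zs \<Longrightarrow> j \<in> set J \<Longrightarrow> x j [Z] p = 0"
  shows "wedge (W J) \<beta> (map E J @ Zs) p = \<beta> Zs p"
  using assms
proof (induction J arbitrary: \<beta>)
  case Nil
  then show ?case by (simp add: wedges_Nil wedge_scalar_left)
next
  case (Cons j J)
  have j: "j \<in> {1..7}" using Cons.prems by simp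
  have "wedge (x j) \<gamma> (map E J @ Zs) p = 0" for \<gamma>
    by (rule wedge_one_form_eq_0[OF one_form_x[OF j]]) (use Cons.prems j in \<open>auto simp: dual\<close>)
  then show ?case
    using Cons.IH[of \<beta>] Cons.prems
    by (simp add: wedges_Cons wedge_assoc wedge_one_form_Cons one_form_x dual)
qed

text \<open>
  The coframe is not known to span the cotangent spaces. A form is nevertheless determined by its
  wedge products with the \<open>W J\<close>: modulo the frame, every vector field is annihilated by the coframe,
  and on arguments annihilated by all but a few \<open>x\<^sup>i\<close> there is a complementary \<open>J\<close> that isolates the form.
\<close>

lemma form_eq_0:
  assumes \<delta>: "\<delta> \<in> forms A n" and "k + n \<le> 7"
    and zero: "\<And>J Xs p. set J \<subseteq> {1..7} \<Longrightarrow> length J = k \<Longrightarrow> wedge (W J) \<delta> Xs p = 0"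
  shows "\<delta> Xs p = 0"
proof -
  note t\<delta> = forms_tensorial[OF \<delta>]
  \<comment> \<open>At p such a field is seen by at most one \<open>x i\<close>: this covers the
    frame fields and the fields that the whole coframe annihilates.\<close>
  define basic where "basic Z \<longleftrightarrow> Z \<in> vector_fields A \<and> card {i\<in>{1..7}. x i [Z] p \<noteq> 0} \<le> 1" for Z
  have basic_E: "basic (E i)" if "i \<in> {1..7}" for i
  proof -
    have "{j\<in>{1..7}. x j [E i] p \<noteq> 0} = {i}" using that by (auto simp: dual split: if_splits)
    then show ?thesis using E_fields[OF that] by (simp add: basic_def)
  qed
  have basic: "\<delta> Zs p = 0" if "\<forall>Z\<in>set Zs. basic Z" "length Zs = n" for Zs
  proof -
    \<comment> \<open>n basic arguments are seen by at most n of the \<open>x i\<close>, so at least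
      7 - n \<ge> k indices remain from which to choose J for \<open>wedge_frame\<close>.\<close>
    let ?L = "\<Union>Z\<in>set Zs. {i\<in>{1..7}. x i [Z] p \<noteq> 0}"
    have "card ?L \<le> (\<Sum>Z\<in>set Zs. card {i\<in>{1..7}. x i [Z] p \<noteq> 0})"
      by (rule card_UN_le) simp
    also have "\<dots> \<le> card (set Zs)"
      using that sum_mono[of "set Zs" "\<lambda>Z. card {i\<in>{1..7}. x i [Z] p \<noteq> 0}" "\<lambda>_. 1"]
      by (simp add: basic_def)
    also have "\<dots> \<le> n" using card_length[of Zs] that by simp
    finally have "card ?L \<le> n" .
    moreover have "?L \<subseteq> {1..7}" by auto
    then have "card ({1..7} - ?L) = 7 - card ?L"
      by (subst card_Diff_subset) (auto intro: finite_subset)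
    ultimately have "k \<le> card ({1..7} - ?L)" using assms(2) by simp
    then obtain T where T: "T \<subseteq> {1..7} - ?L" "card T = k"
      by (meson obtain_subset_with_card_n)
    then have "finite T" by (auto intro: finite_subset)
    then obtain J where J: "set J = T" "distinct J" using finite_distinct_list by blast
    then have "length J = k" using T distinct_card by fastforce
    moreover have "wedge (W J) \<delta> (map E J @ Zs) p = \<delta> Zs p"
      by (rule wedge_frame) (use J T in auto)
    moreover have "set J \<subseteq> {1..7}" using J T by blast
    ultimately show ?thesis using zero[of J] by simp
  qed
  \<comment> \<open>Induction on the number m of leading arguments that may fail to be
    basic.\<close>
  have "\<delta> Xs p = 0"
    if "m \<le> n" "length Xs = n" "set Xs \<subseteq> vector_fields A" "\<forall>i<n. m \<le> i \<longrightarrow> basic (Xs ! i)" for m Xs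
    using that
  proof (induction m arbitrary: Xs)
    case 0
    then show ?case using basic by (metis in_set_conv_nth le0)
  next
    case (Suc m)
    define Y where "Y = Xs ! m"
    \<comment> \<open>\<open>R k\<close> is Y with its components along \<open>E 1\<close> to
      \<open>E k\<close> removed, so the whole coframe annihilates \<open>R 7\<close>. The factors 1
      and -1 fit the shape of \<open>vector_fields_lin\<close>.\<close>
    define R where "R = rec_nat Y (\<lambda>k Z h q. 1 * Z h q + (- 1 * x (Suc k) [Y] q) * E (Suc k) h q)"
    have R0: "R 0 = Y"
      and RS: "R (Suc k) = (\<lambda>h q. 1 * R k h q + (- 1 * x (Suc k) [Y] q) * E (Suc k) h q)" for k
      by (simp_all add: R_def)
    have Y: "Y \<in> vector_fields A" using Suc.prems by (auto simp: Y_def)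
    have c: "(\<lambda>q. - 1 * x i [Y] q) \<in> smooth_fun A" if "i \<in> {1..7}" for i
      by (rule smooth_fun_mult[OF atlas smooth_fun_const tensorial_smooth[OF forms_tensorial[OF x_forms[OF that]]]])
         (use Y in simp)
    have R: "R k \<in> vector_fields A" if "k \<le> 7" for k
      using that
    proof (induction k)
      case (Suc k)
      then show ?case unfolding RS
        by (intro vector_fields_lin atlas E_fields c smooth_fun_const) auto
    qed (simp add: R0 Y)
    have xR: "x j [R k] = (if j \<le> k then (\<lambda>q. 0) else x j [Y])" if "k \<le> 7" "j \<in> {1..7}" for j k
      using that
    proof (induction k)
      case (Suc k)
      have "x j [R (Suc k)] = (\<lambda>q. 1 * x j [R k] q + (- 1 * x (Suc k) [Y] q) * x j [E (Suc k)] q)"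
        using tensorial_multilinear[OF forms_tensorial[OF x_forms[OF Suc.prems(2)]], of 0 "[Y]" "R k" "E (Suc k)"
            "\<lambda>q. 1" "\<lambda>q. - 1 * x (Suc k) [Y] q"] R[of k] Suc.prems Y E_fields c smooth_fun_const[of 1 A]
        unfolding RS by simp
      moreover have "Suc k \<in> {1..7}" using Suc.prems by auto
      ultimately show ?case
        using Suc dual[OF Suc.prems(2), of "Suc k"] by (auto simp: fun_eq_iff le_Suc_eq)
    qed (simp add: R0)
    have "basic (R 7)"
    proof -
      have none: "{i\<in>{1..7}. x i [R 7] p \<noteq> 0} = {}" by (auto simp: xR)
      show ?thesis unfolding basic_def none using R[of 7] by simp
    qed
    have IH: "\<delta> (Xs[m := Z]) p = 0" if "basic Z" for Z
    proof (rule Suc.IH)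
      show "set (Xs[m := Z]) \<subseteq> vector_fields A"
        using that Suc.prems by (auto simp: basic_def dest: set_update_subset_insert[THEN subsetD])
      show "\<forall>i<n. m \<le> i \<longrightarrow> basic (Xs[m := Z] ! i)"
        using that Suc.prems by (auto simp: nth_list_update Suc_le_eq)
    qed (use Suc.prems in auto)
    \<comment> \<open>Descent from \<open>R 7\<close> to \<open>R 0 = Y\<close>: consecutive fields
      differ by a multiple of a frame field, which is basic and so contributes zero.\<close>
    have "\<delta> (Xs[m := R (7 - k)]) p = 0" if "k \<le> 7" for k
      using that
    proof (induction k)
      case 0
      then show ?case using IH \<open>basic (R 7)\<close> by simp
    next
      case (Suc k)
      define l where "l = 7 - Suc k"
      have l: "7 - k = Suc l" "Suc l \<in> {1..7}" "l \<le> 7" using Suc.prems by (auto simp: l_def)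
      have "\<delta> (Xs[m := R (Suc l)]) =
          (\<lambda>q. 1 * \<delta> (Xs[m := R l]) q + (- 1 * x (Suc l) [Y] q) * \<delta> (Xs[m := E (Suc l)]) q)"
        unfolding RS
        by (rule tensorial_multilinear[OF t\<delta>])
           (use Suc_le_eq[of m n] that R[of l] E_fields[of "Suc l"] c[of "Suc l"] l smooth_fun_const[of 1 A] \<open>Suc m \<le> n\<close>
             \<open>length Xs = n\<close> \<open>set Xs \<subseteq> vector_fields A\<close> in auto)
      then have "\<delta> (Xs[m := R l]) p = 0"
        using Suc IH[OF basic_E[OF l(2)]] by (simp add: l)
      then show ?case by (simp add: l_def)
    qed
    from this[of 7] show ?case by (simp add: R0 Y_def)
  qed
  from this[of n Xs] show ?thesis
    using forms_tensorial[OF \<delta>] \<delta> tensorial_vanish[OF t\<delta>, of Xs]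
    by (cases "length Xs = n \<and> set Xs \<subseteq> vector_fields A") (auto simp: forms_def)
qed

end

section \<open>Forms with constant coefficients\<close>

lemma lin_form_Nil: "lin_form x [] = (\<lambda>Xs p. 0)"
  by (simp add: lin_form_def)

lemma lin_form_Cons:
  "lin_form x ((c, I) # cs) = lin2 (\<lambda>p. c) (wedges (map x I)) (\<lambda>p. 1) (lin_form x cs)"
  by (simp add: lin_form_def lin2_def)

lemma lin_form_append: "lin_form x (cs @ ds) Xs p = lin_form x cs Xs p + lin_form x ds Xs p"
  by (simp add: lin_form_def)

lemma lin_form_scale: "lin_form x (map (\<lambda>(c, I). (a * c, I)) cs) Xs p = a * lin_form x cs Xs p"
  by (induction cs) (auto simp: lin_form_def algebra_simps)

lemma wedge_lin_form_left:
  "wedge (lin_form x cs) \<beta> Xs p = (\<Sum>(c, I)\<leftarrow>cs. c * wedge (wedges (map x I)) \<beta> Xs p)"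
proof (induction cs)
  case Nil
  show ?case by (simp add: lin_form_Nil wedge_def)
next
  case (Cons a cs)
  then show ?case by (cases a) (simp add: lin_form_Cons wedge_lin2_left, simp add: lin2_def)
qed

lemma wedge_lin_form_right:
  "wedge \<beta> (lin_form x cs) Xs p = (\<Sum>(c, I)\<leftarrow>cs. c * wedge \<beta> (wedges (map x I)) Xs p)"
proof (induction cs)
  case Nil
  show ?case by (simp add: lin_form_Nil wedge_def)
next
  case (Cons a cs)
  then show ?case by (cases a) (simp add: lin_form_Cons wedge_lin2_right, simp add: lin2_def)
qed

section \<open>Symbolic calculus on index lists\<close>

fun insert_index :: "nat \<Rightarrow> nat list \<Rightarrow> real \<times> nat list" where
  "insert_index i [] = (1, [i])"
| "insert_index i (j # J) =
     (if i < j then (1, i # j # J) else if i = j then (0, [])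
      else (case insert_index i J of (s, K) \<Rightarrow> (- s, j # K)))"

text \<open>Insertion sort that records the sign, so that evaluation brings monomials to a common
  form. A repeated index makes the coefficient 0, and the list returned with it has no
  meaning.\<close>

fun sort_index :: "nat list \<Rightarrow> real \<times> nat list" where
  "sort_index [] = (1, [])"
| "sort_index (i # I) =
     (case sort_index I of (s, J) \<Rightarrow> case insert_index i J of (t, K) \<Rightarrow> (s * t, K))"

fun d_index :: "(nat \<Rightarrow> (real \<times> nat list) list) \<Rightarrow> nat list \<Rightarrow> (real \<times> nat list) list" where
  "d_index S [] = []"
| "d_index S (i # I) = map (\<lambda>(c, J). (c, J @ I)) (S i) @ map (\<lambda>(c, J). (- c, i # J)) (d_index S I)"

definition d_list :: "(nat \<Rightarrow> (real \<times> nat list) list) \<Rightarrow> (real \<times> nat list) list \<Rightarrow> (real \<times> nat list) list" where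
  "d_list S cs = concat (map (\<lambda>(c, I). map (\<lambda>(d, J). (c * d, J)) (d_index S I)) cs)"

definition complement_index :: "nat list \<Rightarrow> nat list" where
  "complement_index I = filter (\<lambda>i. i \<notin> set I) [1,2,3,4,5,6,7]"

text \<open>The sign makes the product of a monomial with its dual equal to the volume form.\<close>

definition star_list :: "(real \<times> nat list) list \<Rightarrow> (real \<times> nat list) list" where
  "star_list cs = map (\<lambda>(c, I). (c * fst (sort_index (I @ complement_index I)), complement_index I)) cs"

definition indexed :: "nat \<Rightarrow> (real \<times> nat list) list \<Rightarrow> bool" where
  "indexed k cs \<longleftrightarrow> (\<forall>(c, I)\<in>set cs. length I = k \<and> set I \<subseteq> {1..7})"

lemma set_1_7: "{1..7} = set [1,2,3,4,5,6,7::nat]"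
  by auto

context coframe
begin

lemma W_insert_index:
  assumes "i \<in> {1..7}" "set J \<subseteq> {1..7}"
  shows "W (i # J) = (\<lambda>Xs p. fst (insert_index i J) * W (snd (insert_index i J)) Xs p)"
  using assms(2)
proof (induction J)
  case (Cons j J)
  have j: "j \<in> {1..7}" using Cons.prems by simp
  have "W (i # j # J) = (\<lambda>Xs p. - W (j # i # J) Xs p)"
    using wedge_one_form_swap[OF one_form_x[OF assms(1)] one_form_x[OF j]]
    by (intro ext) (simp add: wedges_Cons)
  also have "\<dots> = (\<lambda>Xs p. - (fst (insert_index i J) * W (j # snd (insert_index i J)) Xs p))"
    using Cons by (simp add: wedges_Cons[of "x j"] wedge_scale_right)
  finally have swap: "W (i # j # J) = \<dots>" .
  consider "i < j" | "i = j" | "i > j" by linarith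
  then show ?case
  proof cases
    case 2
    then show ?thesis
      using wedge_one_form_self[OF one_form_x[OF j]] by (intro ext) (simp add: wedges_Cons)
  next
    case 3
    then show ?thesis using swap by (simp add: case_prod_beta)
  qed simp
qed simp

lemma set_insert_index: "set (snd (insert_index i J)) \<subseteq> insert i (set J)"
  by (induction J) (auto simp: case_prod_beta)

lemma set_sort_index: "set (snd (sort_index I)) \<subseteq> set I"
proof (induction I)
  case (Cons i I)
  then show ?case
    using set_insert_index[of i "snd (sort_index I)"] by (auto simp: case_prod_beta)
qed simp

lemma W_sort_index:
  "set I \<subseteq> {1..7} \<Longrightarrow> W I = (\<lambda>Xs p. fst (sort_index I) * W (snd (sort_index I)) Xs p)"
proof (induction I)
  case (Cons i I)
  have "W (i # I) = (\<lambda>Xs p. fst (sort_index I) * W (i # snd (sort_index I)) Xs p)"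
    using Cons by (simp add: wedges_Cons[of "x i"] wedge_scale_right)
  then show ?case
    using W_insert_index[of i "snd (sort_index I)"] Cons.prems set_sort_index[of I]
    by (simp add: case_prod_beta mult.assoc subset_trans)
qed simp

lemma lin_form_sort_index:
  assumes "indexed k cs"
  shows "lin_form x cs = lin_form x (map (\<lambda>(c, I). (c * fst (sort_index I), snd (sort_index I))) cs)"
proof (intro ext)
  fix Xs p
  have "c * W I Xs p = c * fst (sort_index I) * W (snd (sort_index I)) Xs p" if "(c, I) \<in> set cs" for c I
    using W_sort_index[of I] assms that by (fastforce simp: indexed_def)
  then show "lin_form x cs Xs p =
      lin_form x (map (\<lambda>(c, I). (c * fst (sort_index I), snd (sort_index I))) cs) Xs p"
    unfolding lin_form_def map_map
    by (intro arg_cong[where f = sum_list] map_cong refl) auto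
qed

lemma tensorial_lin_form: "indexed k cs \<Longrightarrow> tensorial A (lin_form x cs)"
proof (induction cs)
  case Nil
  show ?case by (simp add: lin_form_Nil tensorial_def smooth_fun_const)
next
  case (Cons a cs)
  then show ?case
    by (cases a)
       (auto simp: lin_form_Cons indexed_def intro!: tensorial_lin2 atlas tensorial_W smooth_fun_const)
qed

lemma alternating_lin_form: "indexed k cs \<Longrightarrow> alternating (lin_form x cs)"
proof (induction cs)
  case Nil
  show ?case by (simp add: lin_form_Nil alternating_def)
next
  case (Cons a cs)
  then show ?case
    by (cases a) (auto simp: lin_form_Cons indexed_def intro!: alternating_lin2 alternating_W)
qed

lemma lin_form_forms: 
  assumes "indexed k cs"
  shows "lin_form x cs \<in> forms A k"
proof (rule forms_intro[OF tensorial_lin_form[OF assms]])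
  show "lin_form x cs Xs p = 0" if "length Xs \<noteq> k" for Xs p
    using assms that
    by (induction cs) (auto simp: lin_form_Nil lin_form_Cons lin2_def indexed_def W_degree)
qed (rule alternating_eq_0[OF alternating_lin_form[OF assms]])

lemma ext_d_zero: "ext_d A (\<lambda>Xs p. 0) = (\<lambda>Xs p. 0)"
proof -
  have s: "tensorial A (scalar (\<lambda>p. 1))" by (rule tensorial_scalar[OF smooth_fun_const])
  show ?thesis
    using ext_d_lin2_const[OF atlas s alternating_scalar s alternating_scalar, of 0 0]
    by (simp add: lin2_def)
qed

lemma ext_d_W:
  assumes S: "\<And>i. i \<in> {1..7} \<Longrightarrow> ext_d A (x i) = lin_form x (S i)" and "set I \<subseteq> {1..7}"
  shows "ext_d A (W I) Xs p = lin_form x (d_index S I) Xs p"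
  using assms(2)
proof (induction I arbitrary: Xs p)
  case Nil
  then show ?case by (simp add: wedges_Nil ext_d_scalar_const lin_form_Nil)
next
  case (Cons i I)
  have i: "i \<in> {1..7}" and I: "set I \<subseteq> {1..7}" using Cons.prems by auto
  have IH: "ext_d A (W I) = lin_form x (d_index S I)" using Cons.IH[OF I] by (intro ext)
  have "ext_d A (W (i # I)) Xs p =
      wedge (lin_form x (S i)) (W I) Xs p - wedge (x i) (lin_form x (d_index S I)) Xs p"
    using ext_d_wedge[OF atlas x_forms[OF i] tensorial_W[OF I] alternating_W[OF I]]
    by (simp add: wedges_Cons S[OF i] IH)
  moreover have "wedge (lin_form x (S i)) (W I) Xs p = lin_form x (map (\<lambda>(c, J). (c, J @ I)) (S i)) Xs p"
    unfolding wedge_lin_form_left unfolding lin_form_def map_map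
    by (intro arg_cong[where f = sum_list] map_cong refl) (auto simp: wedges_append)
  moreover have "- wedge (x i) (lin_form x cs) Xs p = lin_form x (map (\<lambda>(c, J). (- c, i # J)) cs) Xs p" for cs
    unfolding wedge_lin_form_right
    by (induction cs) (auto simp: lin_form_def wedges_Cons)
  ultimately show ?case by (simp add: lin_form_append)
qed

lemma ext_d_lin_form:
  assumes S: "\<And>i. i \<in> {1..7} \<Longrightarrow> ext_d A (x i) = lin_form x (S i)" and "indexed k cs"
  shows "ext_d A (lin_form x cs) = lin_form x (d_list S cs)"
  using assms(2)
proof (induction cs)
  case Nil
  show ?case by (simp add: lin_form_Nil ext_d_zero d_list_def)
next
  case (Cons a cs)
  obtain c I where a: "a = (c, I)" by (cases a)
  have I: "set I \<subseteq> {1..7}" and cs: "indexed k cs" using Cons.prems by (auto simp: a indexed_def)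
  have "ext_d A (lin_form x (a # cs)) =
      lin2 (\<lambda>p. c) (ext_d A (W I)) (\<lambda>p. 1) (ext_d A (lin_form x cs))"
    unfolding a lin_form_Cons
    by (rule ext_d_lin2_const[OF atlas tensorial_W[OF I] alternating_W[OF I]
          tensorial_lin_form[OF cs] alternating_lin_form[OF cs]])
  then show ?case
    using Cons.IH[OF cs] ext_d_W[OF S I]
    by (intro ext) (simp add: a d_list_def lin_form_append lin_form_scale lin2_def)
qed

definition vol :: "'a form" where "vol = W [1,2,3,4,5,6,7]"

lemma complement_index:
  assumes "set I \<subseteq> {1..7}" "distinct I"
  shows "distinct (I @ complement_index I)" "set (I @ complement_index I) = {1..7}"
    "length (complement_index I) = 7 - length I"
proof -
  show d: "distinct (I @ complement_index I)" using assms by (simp add: complement_index_def)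
  show s: "set (I @ complement_index I) = {1..7}"
    using assms(1) unfolding complement_index_def set_1_7 by auto
  have "length (I @ complement_index I) = 7" using distinct_card[OF d] by (simp only: s) simp
  then show "length (complement_index I) = 7 - length I" by simp
qed

lemma forms_diff:
  assumes "\<alpha> \<in> forms A k" "\<beta> \<in> forms A k"
  shows "lin2 (\<lambda>p. 1) \<alpha> (\<lambda>p. -1) \<beta> \<in> forms A k"
proof (rule forms_intro)
  show "tensorial A (lin2 (\<lambda>p. 1) \<alpha> (\<lambda>p. -1) \<beta>)"
    by (intro tensorial_lin2 atlas forms_tensorial[OF assms(1)] forms_tensorial[OF assms(2)] smooth_fun_const)
  have "lin2 (\<lambda>p. 1) \<alpha> (\<lambda>p. -1) \<beta> Xs p = 0"
    if "length Xs \<noteq> k \<or> i < j \<and> j < length Xs \<and> Xs ! i = Xs ! j" for Xs i j p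
    by (simp add: lin2_def forms_eq_0[OF assms(1) that] forms_eq_0[OF assms(2) that])
  then show "length Xs \<noteq> k \<Longrightarrow> lin2 (\<lambda>p. 1) \<alpha> (\<lambda>p. -1) \<beta> Xs p = 0"
    and "i < j \<Longrightarrow> j < length Xs \<Longrightarrow> Xs ! i = Xs ! j \<Longrightarrow> lin2 (\<lambda>p. 1) \<alpha> (\<lambda>p. -1) \<beta> Xs p = 0"
    for Xs i j p
    by blast+
qed

text \<open>Existence is checked monomial by monomial with \<open>flat_metric_wedge\<close>;
  uniqueness, which the definite description requires, is \<open>form_eq_0\<close> for the
  difference. The condition on sorting is discharged by evaluation for concrete lists.\<close>

lemma hodge_star_lin_form:
  assumes cs: "indexed k cs" and k: "k \<le> 7"
    and comp: "\<forall>(c, I)\<in>set cs. distinct I \<and>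
      fst (sort_index (I @ complement_index I)) ^ 2 = 1 \<and>
      snd (sort_index (I @ complement_index I)) = [1,2,3,4,5,6,7]"
  shows "hodge_star A metric vol k (lin_form x cs) = lin_form x (star_list cs)"
proof -
  let ?\<eta> = "lin_form x (star_list cs)"
  let ?P = "\<lambda>\<eta>. \<eta> \<in> forms A (7 - k) \<and> (\<forall>Ys. length Ys = k \<and> set Ys \<subseteq> vector_fields A \<longrightarrow>
    wedge (wedges (map (flat metric) Ys)) \<eta> = (\<lambda>Xs p. lin_form x cs Ys p * vol Xs p))"
  have sorted: "distinct I \<and> fst (sort_index (I @ complement_index I)) ^ 2 = 1 \<and>
      snd (sort_index (I @ complement_index I)) = [1,2,3,4,5,6,7]" if "(c, I) \<in> set cs" for c I
    using comp that by blast
  have cs': "length I = k" "set I \<subseteq> {1..7}" "distinct I" if "(c, I) \<in> set cs" for c I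
    using cs sorted that by (auto simp: indexed_def)
  have "indexed (7 - k) (star_list cs)"
    unfolding indexed_def star_list_def
    using cs' complement_index by fastforce
  then have forms: "?\<eta> \<in> forms A (7 - k)" by (rule lin_form_forms)
  have wedge: "wedge (wedges (map (flat metric) Ys)) ?\<eta> = (\<lambda>Xs p. lin_form x cs Ys p * vol Xs p)"
    if "length Ys = k" for Ys
  proof (intro ext)
    fix Xs p
    \<comment> \<open>The sign enters twice, from \<open>star_list\<close> and from sorting
      \<open>I @ complement_index I\<close>, and squares to 1.\<close>
    have "c * fst (sort_index (I @ complement_index I)) *
        wedge (wedges (map (flat metric) Ys)) (W (complement_index I)) Xs p = c * W I Ys p * vol Xs p"
      if cI: "(c, I) \<in> set cs" for c I
    proof -
      note I = cs'[OF cI]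
      note comp = complement_index[OF I(2,3)]
      have "wedge (wedges (map (flat metric) Ys)) (W (complement_index I)) Xs p =
          W I Ys p * W (I @ complement_index I) Xs p"
        by (rule flat_metric_wedge) (use I comp \<open>length Ys = k\<close> in auto)
      also have "W (I @ complement_index I) Xs p = fst (sort_index (I @ complement_index I)) * vol Xs p"
        using W_sort_index[OF eq_refl[OF comp(2)]] sorted[OF cI] by (simp add: vol_def)
      finally show ?thesis using sorted[OF cI] by (simp add: power2_eq_square)
    qed
    then show "wedge (wedges (map (flat metric) Ys)) ?\<eta> Xs p = lin_form x cs Ys p * vol Xs p"
      unfolding wedge_lin_form_right star_list_def unfolding lin_form_def sum_list_mult_const[symmetric] map_map
      by (intro arg_cong[where f = sum_list] map_cong refl) auto
  qed
  have "(THE \<eta>. ?P \<eta>) = ?\<eta>"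
  proof (rule the_equality)
    show "?P ?\<eta>" using forms wedge by blast
    fix \<eta> assume \<eta>: "?P \<eta>"
    let ?\<delta> = "lin2 (\<lambda>p. 1) \<eta> (\<lambda>p. -1) ?\<eta>"
    have "?\<delta> Xs p = 0" for Xs p
    proof (rule form_eq_0[where k = k])
      show "?\<delta> \<in> forms A (7 - k)" using forms_diff \<eta> forms by blast
      show "k + (7 - k) \<le> 7" using k by simp
      fix J Xs p assume J: "set J \<subseteq> {1..7::nat}" "length J = k"
      \<comment> \<open>With frame fields as test arguments the defining property of the star speaks
        of wedge products with \<open>W J\<close>.\<close>
      have xJ: "map x J = map (flat metric) (map E J)" using J flat_E by auto
      have "length (map E J) = k \<and> set (map E J) \<subseteq> vector_fields A" using J E_fields by auto
      then have "wedge (wedges (map (flat metric) (map E J))) \<eta> = (\<lambda>Xs p. lin_form x cs (map E J) p * vol Xs p)"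
        using \<eta> by blast
      moreover have "wedge (wedges (map (flat metric) (map E J))) ?\<eta> = (\<lambda>Xs p. lin_form x cs (map E J) p * vol Xs p)"
        by (rule wedge) (simp add: J)
      ultimately have "wedge (W J) \<eta> = wedge (W J) ?\<eta>" unfolding xJ by simp
      then show "wedge (W J) ?\<delta> Xs p = 0" by (simp add: wedge_lin2_right) (simp add: lin2_def)
    qed
    then show "\<eta> = ?\<eta>" by (intro ext) (simp add: lin2_def)
  qed
  then show ?thesis by (simp add: hodge_star_def)
qed

lemma lie_derivative_W:
  assumes X: "X \<in> vector_fields A"
    and Lx: "\<And>i. i \<in> {1..7} \<Longrightarrow> lie_derivative A X (x i) = (\<lambda>Xs p. w i * x i Xs p)"
    and "set I \<subseteq> {1..7}"
  shows "lie_derivative A X (W I) Xs p = (\<Sum>i\<leftarrow>I. w i) * W I Xs p"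
  using assms(3)
proof (induction I arbitrary: Xs p)
  case Nil
  have "scalar (\<lambda>p. 1) Ys = (if Ys = [] then \<lambda>p. 1 else (\<lambda>p. 0))" for Ys :: "'a vfield list"
    by (simp add: scalar_def fun_eq_iff)
  then show ?case using vector_field_const[OF X] by (auto simp: wedges_Nil lie_derivative_def)
next
  case (Cons i I)
  have i: "i \<in> {1..7}" and I: "set I \<subseteq> {1..7}" using Cons.prems by auto
  have "lie_derivative A X (W I) = (\<lambda>Xs p. (\<Sum>i\<leftarrow>I. w i) * W I Xs p)"
    using Cons.IH[OF I] by (intro ext)
  then show ?case
    using lie_derivative_wedge[OF atlas X forms_tensorial[OF x_forms[OF i]] one_form_x[OF i] tensorial_W[OF I]]
    by (simp add: wedges_Cons Lx[OF i] wedge_scale_left wedge_scale_right algebra_simps)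
qed

lemma lie_derivative_lin_form:
  assumes X: "X \<in> vector_fields A"
    and Lx: "\<And>i. i \<in> {1..7} \<Longrightarrow> lie_derivative A X (x i) = (\<lambda>Xs p. w i * x i Xs p)"
    and "indexed k cs"
  shows "lie_derivative A X (lin_form x cs) Xs p = lin_form x (map (\<lambda>(c, I). (c * (\<Sum>i\<leftarrow>I. w i), I)) cs) Xs p"
proof (cases "set Xs \<subseteq> vector_fields A")
  case True
  show ?thesis
    using assms(3)
  proof (induction cs)
    case Nil
    show ?case using vector_field_const[OF X, of 0] by (simp add: lin_form_Nil lie_derivative_def)
  next
    case (Cons a cs)
    obtain c I where a: "a = (c, I)" by (cases a)
    have I: "set I \<subseteq> {1..7}" and cs: "indexed k cs" using Cons.prems by (auto simp: a indexed_def)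
    show ?case
      using Cons.IH[OF cs] lie_derivative_W[OF X Lx I]
        lie_derivative_lin2[OF atlas X tensorial_W[OF I] tensorial_lin_form[OF cs]
          smooth_fun_const smooth_fun_const True, of c 1 p]
      by (simp add: a lin_form_Cons vector_field_const[OF X]) (simp add: lin2_def)
  qed
next
  case False
  have "indexed k (map (\<lambda>(c, I). (c * (\<Sum>i\<leftarrow>I. w i), I)) cs)"
    using assms(3) by (auto simp: indexed_def)
  from tensorial_vanish[OF tensorial_lin_form[OF this] False] False show ?thesis
    by (simp add: lie_derivative_vanish)
qed

end

section \<open>Locally conformally parallel coframes\<close>

text \<open>The seven Lie algebras are specialisations of a single twelve-parameter family.\<close>

definition lcp_equations ::
  "real \<Rightarrow> real \<Rightarrow> real \<Rightarrow> real \<Rightarrow> real \<Rightarrow> real \<Rightarrow> real \<Rightarrow> real \<Rightarrow> real \<Rightarrow> real \<Rightarrow> real \<Rightarrow> real \<Rightarrow>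
    nat \<Rightarrow> (real \<times> nat list) list" where
  "lcp_equations w1 w2 w3 w4 w5 w6 a1 b1 a2 b2 a4 a5 i =
     (if i = 1 then [(-w1, [1,7]), (a1, [3,6]), (b1, [4,5])]
      else if i = 2 then [(-w2, [2,7]), (a2, [3,5]), (b2, [4,6])]
      else if i = 3 then [(-w3, [3,7])]
      else if i = 4 then [(-w4, [4,7]), (a4, [2,6])]
      else if i = 5 then [(-w5, [5,7]), (a5, [2,3])]
      else if i = 6 then [(-w6, [6,7])] else [])"

text \<open>The seven linear conditions are the coefficients of d\<phi> = 3m x^7 wedge \<phi> and of
  d\<star>\<phi> = 4m x^7 wedge \<star>\<phi>. Since x^7 is closed, \<phi> is then locally conformal
  to a closed and coclosed G2-form.\<close>

locale lcp_coframe = coframe +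
  fixes w1 w2 w3 w4 w5 w6 a1 b1 a2 b2 a4 a5 m :: real
  assumes structure_eq: "i \<in> {1..7} \<Longrightarrow>
      ext_d A (x i) = lin_form x (lcp_equations w1 w2 w3 w4 w5 w6 a1 b1 a2 b2 a4 a5 i)"
    and d_phi: "w1 + w3 + w5 + a2 = 3 * m" "w1 + w4 + w6 - b2 = 3 * m"
      "w2 + w3 + w6 + a1 + a4 + a5 = 3 * m" "w2 + w4 + w5 + b1 = 3 * m"
    and d_star_phi: "w1 + w2 + w3 + w4 + a5 = 4 * m" "w1 + w2 + w5 + w6 + a4 = 4 * m"
      "w3 + w4 + w5 + w6 + a1 + b1 + a2 - b2 = 4 * m"
begin

abbreviation S where "S \<equiv> lcp_equations w1 w2 w3 w4 w5 w6 a1 b1 a2 b2 a4 a5"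

text \<open>The template for the explicit derivatives: differentiate on index lists, sort the
  monomials, and leave a comparison of coefficients to the simplifier.\<close>

lemma ext_d_eq:
  assumes "indexed k cs" "indexed (Suc k) ds"
    and "\<And>Xs p. lin_form x (map (\<lambda>(c, I). (c * fst (sort_index I), snd (sort_index I))) (d_list S cs)) Xs p
      = lin_form x ds Xs p"
    and "indexed (Suc k) (d_list S cs)"
  shows "ext_d A (lin_form x cs) = lin_form x ds"
  using ext_d_lin_form[OF structure_eq assms(1)] lin_form_sort_index[OF assms(4)] assms(3)
  by (intro ext) simp

section \<open>The Hodge Laplacian of the G2-form\<close>

lemma ext_d_g2:
  "ext_d A (g2_std x) = lin_form x
     [(-3 * m, [1,3,5,7]), (3 * m, [1,4,6,7]), (3 * m, [2,3,6,7]), (3 * m, [2,4,5,7])]"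
proof -
  have "ext_d A (g2_std x) = lin_form x [(-(w1 + w3 + w5 + a2), [1,3,5,7]), (w1 + w4 + w6 - b2, [1,4,6,7]),
      (w2 + w3 + w6 + a1 + a4 + a5, [2,3,6,7]), (w2 + w4 + w5 + b1, [2,4,5,7])]"
    unfolding g2_std_def
    by (rule ext_d_eq[where k = 3])
       (simp_all add: indexed_def d_list_def lcp_equations_def lin_form_def algebra_simps)
  then show ?thesis by (simp only: d_phi) simp
qed

lemma star_g2:
  "hodge_star A metric vol 3 (g2_std x) = lin_form x
     [(1, [3,4,5,6]), (1, [1,2,5,6]), (1, [1,2,3,4]),
      (-1, [2,4,6,7]), (1, [2,3,5,7]), (1, [1,4,5,7]), (1, [1,3,6,7])]"
  unfolding g2_std_def
  by (subst hodge_star_lin_form)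
     (simp_all add: indexed_def star_list_def complement_index_def)

lemma ext_d_star_g2:
  "ext_d A (hodge_star A metric vol 3 (g2_std x)) = lin_form x
     [(4 * m, [1,2,3,4,7]), (4 * m, [1,2,5,6,7]), (4 * m, [3,4,5,6,7])]"
proof -
  have "ext_d A (hodge_star A metric vol 3 (g2_std x)) = lin_form x
      [(w1 + w2 + w3 + w4 + a5, [1,2,3,4,7]), (w1 + w2 + w5 + w6 + a4, [1,2,5,6,7]),
       (w3 + w4 + w5 + w6 + a1 + b1 + a2 - b2, [3,4,5,6,7])]"
    unfolding star_g2
    by (rule ext_d_eq[where k = 4])
       (simp_all add: indexed_def d_list_def lcp_equations_def lin_form_def algebra_simps)
  then show ?thesis by (simp only: d_star_phi)
qed

text \<open>The sign of \<open>codiff\<close> is (-1) ^ (7 * 4 + 1) = -1 here, whereas on 4-forms it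
  is (-1) ^ (7 * 5 + 1) = 1.\<close>

lemma codiff_g2:
  "codiff A metric vol 3 (g2_std x) = lin_form x [(-4 * m, [1,2]), (-4 * m, [3,4]), (-4 * m, [5,6])]"
proof -
  have "hodge_star A metric vol 5 (ext_d A (hodge_star A metric vol 3 (g2_std x))) =
      lin_form x [(4 * m, [5,6]), (4 * m, [3,4]), (4 * m, [1,2])]"
    unfolding ext_d_star_g2
    by (subst hodge_star_lin_form)
       (simp_all add: indexed_def star_list_def complement_index_def)
  then show ?thesis
    by (intro ext) (simp add: codiff_def lin_form_def)
qed

lemma ext_d_codiff_g2:
  "ext_d A (codiff A metric vol 3 (g2_std x)) = lin_form x
     [(-4 * m * (w1 + w2), [1,2,7]), (4 * m * a2, [1,3,5]), (4 * m * b2, [1,4,6]),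
      (-4 * m * (a1 + a4 + a5), [2,3,6]), (-4 * m * b1, [2,4,5]),
      (-4 * m * (w3 + w4), [3,4,7]), (-4 * m * (w5 + w6), [5,6,7])]"
  unfolding codiff_g2
  by (rule ext_d_eq[where k = 2])
     (simp_all add: indexed_def d_list_def lcp_equations_def lin_form_def algebra_simps)

lemma codiff_ext_d_g2:
  "codiff A metric vol 4 (ext_d A (g2_std x)) = lin_form x
     [(3 * m * (a1 + b1 + a2 - b2), [1,2,7]), (-3 * m * (w2 + w4 + w6), [1,3,5]),
      (3 * m * (w2 + w3 + w5), [1,4,6]), (3 * m * (w1 + w4 + w5), [2,3,6]),
      (3 * m * (w1 + w3 + w6), [2,4,5]), (3 * m * a4, [3,4,7]), (3 * m * a5, [5,6,7])]"
proof -
  have "hodge_star A metric vol 4 (ext_d A (g2_std x)) = lin_form x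
      [(-3 * m, [2,4,6]), (3 * m, [2,3,5]), (3 * m, [1,4,5]), (3 * m, [1,3,6])]"
    unfolding ext_d_g2
    by (subst hodge_star_lin_form)
       (simp_all add: indexed_def star_list_def complement_index_def lin_form_def algebra_simps)
  moreover have "ext_d A (lin_form x [(-3 * m, [2,4,6]), (3 * m, [2,3,5]), (3 * m, [1,4,5]), (3 * m, [1,3,6])])
    = lin_form x
      [(3 * m * (a1 + b1 + a2 - b2), [3,4,5,6]), (3 * m * (w2 + w4 + w6), [2,4,6,7]),
       (-3 * m * (w2 + w3 + w5), [2,3,5,7]), (-3 * m * (w1 + w4 + w5), [1,4,5,7]),
       (-3 * m * (w1 + w3 + w6), [1,3,6,7]), (3 * m * a4, [1,2,5,6]), (3 * m * a5, [1,2,3,4])]"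
    by (rule ext_d_eq[where k = 3])
       (simp_all add: indexed_def d_list_def lcp_equations_def lin_form_def algebra_simps)
  ultimately have "hodge_star A metric vol 4 (ext_d A (hodge_star A metric vol 4 (ext_d A (g2_std x)))) =
    lin_form x
     [(3 * m * (a1 + b1 + a2 - b2), [1,2,7]), (-3 * m * (w2 + w4 + w6), [1,3,5]),
      (3 * m * (w2 + w3 + w5), [1,4,6]), (3 * m * (w1 + w4 + w5), [2,3,6]),
      (3 * m * (w1 + w3 + w6), [2,4,5]), (3 * m * a4, [3,4,7]), (3 * m * a5, [5,6,7])]"
    by (simp only:)
       (subst hodge_star_lin_form, simp_all add: indexed_def star_list_def complement_index_def)
  then show ?thesis
    by (intro ext) (simp add: codiff_def)
qed

lemma g2_structure_g2: "g2_structure A (g2_std x) metric vol"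
proof -
  have "g2_std x \<in> forms A 3"
    unfolding g2_std_def by (rule lin_form_forms) (simp add: indexed_def)
  moreover have "coframe_on A UNIV x"
    unfolding coframe_on_def
  proof (intro conjI ballI allI impI)
    show "x i \<in> forms A 1" if "i \<in> {1..7}" for i by (rule x_forms[OF that])
    fix q c j assume c: "\<forall>X\<in>vector_fields A. (\<Sum>i=1..7. c i * x i [X] q) = 0" and j: "j \<in> {1..7::nat}"
    have "0 = (\<Sum>i=1..7. c i * x i [E j] q)" using c E_fields[OF j] by simp
    also have "\<dots> = (\<Sum>i=1..7. if i = j then c i else 0)"
      by (intro sum.cong) (use j in \<open>auto simp: dual\<close>)
    finally show "c j = 0" using j by simp
  qed
  ultimately show ?thesis
    unfolding g2_structure_def metric_def vol_def
    by (intro conjI allI exI[of _ UNIV] exI[of _ x]) auto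
qed

definition weight :: "nat \<Rightarrow> real" where
  "weight i = (if i = 1 then w1 else if i = 2 then w2 else if i = 3 then w3 else if i = 4 then w4
     else if i = 5 then w5 else if i = 6 then w6 else 0)"

text \<open>By Cartan's formula only the contraction of dx^i counts, because the coefficient
  \<open>x i [X]\<close> is constant. The vanishing summand of \<open>X\<close> fits the shape of
  \<open>vector_fields_lin\<close>.\<close>

lemma lie_derivative_x:
  assumes i: "i \<in> {1..7}" and X: "X = (\<lambda>h p. \<kappa> * E 7 h p + 0 * E 7 h p)"
  shows "lie_derivative A X (x i) = (\<lambda>Xs p. \<kappa> * weight i * x i Xs p)"
proof (intro ext)
  fix Xs p
  have X_fields: "X \<in> vector_fields A"
    unfolding X by (intro vector_fields_lin atlas E_fields smooth_fun_const) auto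
  have xX: "x j [X] = (\<lambda>p. if j = 7 then \<kappa> else 0)" if "j \<in> {1..7}" for j
    using tensorial_multilinear[OF forms_tensorial[OF x_forms[OF that]], of 0 "[E 7]" "E 7" "E 7"
        "\<lambda>p. \<kappa>" "\<lambda>p. 0"] E_fields[of 7] smooth_fun_const[of \<kappa> A] smooth_fun_const[of 0 A] dual[OF that, of 7]
    unfolding X by (auto simp: fun_eq_iff)
  show "lie_derivative A X (x i) Xs p = \<kappa> * weight i * x i Xs p"
  proof (cases "length Xs = 1 \<and> set Xs \<subseteq> vector_fields A")
    case True
    then obtain Y where Y: "Xs = [Y]" "Y \<in> vector_fields A"
      by (cases Xs) auto
    have "alternating (x i)" using one_form_x[OF i] by (simp add: alternating_def one_form_def)
    then have "lie_derivative A X (x i) [Y] p = ext_d A (x i) [X, Y] p + ext_d A (contract X (x i)) [Y] p"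
      using ext_d_Cons[of "x i" X A "[Y]" p] X_fields Y by simp
    also have "ext_d A (contract X (x i)) = (\<lambda>Xs p. 0)"
      unfolding one_form_contract[OF one_form_x[OF i]] xX[OF i] by (rule ext_d_scalar_const)
    \<comment> \<open>Among the terms of dx^i only -w_i x^{i7} contains x^7, so the bracket terms do
      not survive contraction with \<open>X\<close>; for i = 7 both sides are zero.\<close>
    also have "ext_d A (x i) [X, Y] p = \<kappa> * weight i * x i [Y] p"
      unfolding structure_eq[OF i] using i unfolding set_1_7
      by (auto simp: lcp_equations_def weight_def lin_form_def wedges_Cons wedges_Nil scalar_def contract_def
          wedge_one_form_Cons wedge_one_form_Nil one_form_x xX)
    finally show ?thesis by (simp add: Y)
  next
    case False
    then have "length Xs \<noteq> 1 \<or> \<not> set Xs \<subseteq> vector_fields A" by blast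
    then have "lie_derivative A X (x i) Xs = (\<lambda>p. 0)" "x i Xs = (\<lambda>p. 0)"
      using one_form_lie_derivative[OF X_fields one_form_x[OF i]] one_form_x[OF i]
        lie_derivative_vanish[of Xs A] tensorial_vanish[OF forms_tensorial[OF x_forms[OF i]], of Xs]
      unfolding one_form_def by blast+
    then show ?thesis by simp
  qed
qed

text \<open>One equation per monomial: the coefficients of the two halves of the Laplacian on the
  left, those of c \<phi> + L_X \<phi> with X = -m \<open>E 7\<close> on the right. For 146, 236 and
  245 the signs are reversed, as in \<phi>.\<close>

theorem shrinking_soliton:
  assumes "c < 0"
    and "-4 * m * (w1 + w2) + 3 * m * (a1 + b1 + a2 - b2) = c - m * (w1 + w2)"
    and "4 * m * a2 - 3 * m * (w2 + w4 + w6) = c - m * (w1 + w3 + w5)"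
    and "4 * m * b2 + 3 * m * (w2 + w3 + w5) = m * (w1 + w4 + w6) - c"
    and "-4 * m * (a1 + a4 + a5) + 3 * m * (w1 + w4 + w5) = m * (w2 + w3 + w6) - c"
    and "-4 * m * b1 + 3 * m * (w1 + w3 + w6) = m * (w2 + w4 + w5) - c"
    and "-4 * m * (w3 + w4) + 3 * m * a4 = c - m * (w3 + w4)"
    and "-4 * m * (w5 + w6) + 3 * m * a5 = c - m * (w5 + w6)"
  shows "shrinking_laplacian_soliton A (g2_std x)"
proof -
  define X where "X = (\<lambda>h p. - m * E 7 h p + 0 * E 7 h p)"
  have X: "X \<in> vector_fields A"
    unfolding X_def by (intro vector_fields_lin atlas E_fields smooth_fun_const) auto
  have "hodge_laplacian A metric vol 3 (g2_std x) Ys p = c * g2_std x Ys p + lie_derivative A X (g2_std x) Ys p" for Ys p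
  proof -
    have "lie_derivative A X (g2_std x) Ys p =
      lin_form x [(- m * (w1 + w2), [1,2,7]), (- m * (w3 + w4), [3,4,7]), (- m * (w5 + w6), [5,6,7]),
        (- m * (w1 + w3 + w5), [1,3,5]), (m * (w1 + w4 + w6), [1,4,6]), (m * (w2 + w3 + w6), [2,3,6]),
        (m * (w2 + w4 + w5), [2,4,5])] Ys p"
      unfolding g2_std_def
      by (subst lie_derivative_lin_form[where k = 3, OF X lie_derivative_x[OF _ X_def]])
         (simp_all add: indexed_def weight_def lin_form_def algebra_simps)
    moreover have "hodge_laplacian A metric vol 3 (g2_std x) Ys p =
      lin_form x [(c - m * (w1 + w2), [1,2,7]), (c - m * (w1 + w3 + w5), [1,3,5]),
        (m * (w1 + w4 + w6) - c, [1,4,6]), (m * (w2 + w3 + w6) - c, [2,3,6]),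
        (m * (w2 + w4 + w5) - c, [2,4,5]), (c - m * (w3 + w4), [3,4,7]), (c - m * (w5 + w6), [5,6,7])] Ys p"
      unfolding hodge_laplacian_def ext_d_codiff_g2 assms(2-)[symmetric]
      by (simp add: codiff_ext_d_g2) (simp add: lin_form_def algebra_simps)
    ultimately show ?thesis
      by (simp add: g2_std_def lin_form_def algebra_simps)
  qed
  then show ?thesis
    unfolding shrinking_laplacian_soliton_def using g2_structure_g2 assms(1) X by blast
qed

end

section \<open>Rescaling\<close>

lemma wedges_scale:
  "wedges (map (\<lambda>i Xs p. f i * e i Xs p) I) Xs p = prod_list (map f I) * wedges (map e I) Xs p"
proof (induction I arbitrary: Xs p)
  case (Cons i I)
  then have "wedges (map (\<lambda>i Xs p. f i * e i Xs p) I) = (\<lambda>Xs p. prod_list (map f I) * wedges (map e I) Xs p)"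
    by (intro ext)
  then show ?case by (simp add: wedges_Cons wedge_scale_left wedge_scale_right algebra_simps)
qed (simp add: wedges_Nil)

lemma lin_form_scaled_coframe:
  "lin_form (\<lambda>i Xs p. f i * e i Xs p) cs Xs p
    = lin_form e (map (\<lambda>(c, I). (c * prod_list (map f I), I)) cs) Xs p"
  by (induction cs) (auto simp: lin_form_def wedges_scale)

context coframe
begin

lemma coframe_scale:
  assumes "\<And>i. i \<in> {1..7} \<Longrightarrow> f i \<noteq> 0"
  shows "coframe A (\<lambda>i Xs p. f i * x i Xs p) (\<lambda>i h p. (1 / f i) * E i h p + 0 * E i h p)"
proof
  fix i j :: nat
  assume i: "i \<in> {1..7}"
  have eq: "(\<lambda>Xs p. f i * x i Xs p) = lin_form x [(f i, [i])]"
    by (intro ext) (simp add: lin_form_def wedges_Cons wedges_Nil wedge_scalar_right)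
  show "(\<lambda>Xs p. f i * x i Xs p) \<in> forms A 1"
    unfolding eq by (rule lin_form_forms) (use i in \<open>simp add: indexed_def\<close>)
  show "(\<lambda>h p. (1 / f i) * E i h p + 0 * E i h p) \<in> vector_fields A"
    by (intro vector_fields_lin atlas E_fields[OF i] smooth_fun_const)
  assume j: "j \<in> {1..7}"
  have "x i [\<lambda>h p. (1 / f j) * E j h p + 0 * E j h p] = (\<lambda>p. (1 / f j) * x i [E j] p + 0 * x i [E j] p)"
    using tensorial_multilinear[OF forms_tensorial[OF x_forms[OF i]], of 0 "[E j]" "E j" "E j"
        "\<lambda>p. 1 / f j" "\<lambda>p. 0"] E_fields[OF j] smooth_fun_const[of "1 / f j" A] smooth_fun_const[of 0 A]
    by simp
  then show "(\<lambda>p. f i * x i [\<lambda>h p. (1 / f j) * E j h p + 0 * E j h p] p) = (\<lambda>p. if i = j then 1 else 0)"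
    using assms[OF j] by (auto simp: dual[OF i j])
qed (rule atlas)

end

lemma has_lie_algebra_coframe:
  fixes A :: "('a::{t2_space,second_countable_topology}, real^7) atlas"
  assumes "smooth_atlas A" "has_lie_algebra A mul one cp e"
  obtains E where "coframe A e E"
proof -
  from assms(2) obtain E where E: "lie_algebra_basis A mul one E"
    "\<forall>i\<in>{1..7}. e i \<in> forms A 1 \<and> (\<forall>j\<in>{1..7}. e i [E j] = (\<lambda>p. if i = j then 1 else 0))"
    unfolding has_lie_algebra_def by blast
  have "coframe A e E"
    by unfold_locales (use assms(1) E in \<open>auto simp: lie_algebra_basis_def\<close>)
  then show thesis by (rule that)
qed

text \<open>The parameters k, \<alpha>, \<beta> are structure constants divided by m. A term x^{jk}
  in dx^i keeps its normalised constant when r_i + 1/2 = r_j + r_k; an absent term demands nothing.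
  For the exponents inserted below this reads k_i = k_j + k_k, which is the Jacobi identity.\<close>

lemma scaled_soliton:
  fixes A :: "('a::{t2_space,second_countable_topology}, real^7) atlas"
  assumes A: "smooth_atlas A" and e: "has_lie_algebra A mul one cp e" and u: "u > 0" and m: "m \<noteq> 0"
    and cp: "\<forall>i\<in>{1,2,3,4,5,6,7}. \<forall>Xs p. lin_form e (cp ! (i - 1)) Xs p = lin_form e
      (lcp_equations (k1 * m) (k2 * m) (k3 * m) (k4 * m) (k5 * m) (k6 * m)
         (\<alpha>1 * m) (\<beta>1 * m) (\<alpha>2 * m) (\<beta>2 * m) (\<alpha>4 * m) (\<alpha>5 * m) i) Xs p"
    and exponents: "\<alpha>1 = 0 \<or> r1 + 1/2 = r3 + r6" "\<beta>1 = 0 \<or> r1 + 1/2 = r4 + r5"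
      "\<alpha>2 = 0 \<or> r2 + 1/2 = r3 + r5" "\<beta>2 = 0 \<or> r2 + 1/2 = r4 + r6"
      "\<alpha>4 = 0 \<or> r4 + 1/2 = r2 + r6" "\<alpha>5 = 0 \<or> r5 + 1/2 = r2 + r3"
    and d_phi: "k1 + k3 + k5 + \<alpha>2 = 3" "k1 + k4 + k6 - \<beta>2 = 3"
      "k2 + k3 + k6 + \<alpha>1 + \<alpha>4 + \<alpha>5 = 3" "k2 + k4 + k5 + \<beta>1 = 3"
    and d_star_phi: "k1 + k2 + k3 + k4 + \<alpha>5 = 4" "k1 + k2 + k5 + k6 + \<alpha>4 = 4"
      "k3 + k4 + k5 + k6 + \<alpha>1 + \<beta>1 + \<alpha>2 - \<beta>2 = 4"
    and c: "c < 0"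
      "-4 * (k1 + k2) + 3 * (\<alpha>1 + \<beta>1 + \<alpha>2 - \<beta>2) = c - (k1 + k2)"
      "4 * \<alpha>2 - 3 * (k2 + k4 + k6) = c - (k1 + k3 + k5)"
      "4 * \<beta>2 + 3 * (k2 + k3 + k5) = (k1 + k4 + k6) - c"
      "-4 * (\<alpha>1 + \<alpha>4 + \<alpha>5) + 3 * (k1 + k4 + k5) = (k2 + k3 + k6) - c"
      "-4 * \<beta>1 + 3 * (k1 + k3 + k6) = (k2 + k4 + k5) - c"
      "-4 * (k3 + k4) + 3 * \<alpha>4 = c - (k3 + k4)"
      "-4 * (k5 + k6) + 3 * \<alpha>5 = c - (k5 + k6)"
  shows "shrinking_laplacian_soliton A (lin_form e
    [(u powr (r1 + r2 + 1/2), [1,2,7]), (u powr (r3 + r4 + 1/2), [3,4,7]), (u powr (r5 + r6 + 1/2), [5,6,7]),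
     (u powr (r1 + r3 + r5), [1,3,5]), (- (u powr (r1 + r4 + r6)), [1,4,6]),
     (- (u powr (r2 + r3 + r6)), [2,3,6]), (- (u powr (r2 + r4 + r5)), [2,4,5])])"
proof -
  obtain E where "coframe A e E" using has_lie_algebra_coframe[OF A e] .
  then interpret e: coframe A e E .
  define f where "f i = u powr (if i = 1 then r1 else if i = 2 then r2 else if i = 3 then r3
    else if i = 4 then r4 else if i = 5 then r5 else if i = 6 then r6 else 1/2)" for i :: nat
  define x where "x i Xs p = f i * e i Xs p" for i Xs p
  define \<mu> where "\<mu> = m * u powr (-1/2)"
  have m\<mu>: "m = \<mu> * u powr (1/2)" using u by (simp add: \<mu>_def mult.assoc flip: powr_add)
  interpret coframe A x "\<lambda>i h p. (1 / f i) * E i h p + 0 * E i h p"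
    unfolding x_def[abs_def] by (rule e.coframe_scale) (use u in \<open>simp add: f_def\<close>)
  have d: "ext_d A (x i) = lin_form x
      (lcp_equations (k1 * \<mu>) (k2 * \<mu>) (k3 * \<mu>) (k4 * \<mu>) (k5 * \<mu>) (k6 * \<mu>)
         (\<alpha>1 * \<mu>) (\<beta>1 * \<mu>) (\<alpha>2 * \<mu>) (\<beta>2 * \<mu>) (\<alpha>4 * \<mu>) (\<alpha>5 * \<mu>) i)" if i: "i \<in> {1..7}" for i
  proof (intro ext)
    fix Xs p
    have "ext_d A (x i) Xs p = f i * ext_d A (e i) Xs p"
    proof -
      have xi: "x i = lin2 (\<lambda>p. f i) (e i) (\<lambda>p. 0) (e i)"
        by (intro ext) (simp add: x_def lin2_def)
      have ei: "tensorial A (e i)" "alternating (e i)"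
        using forms_tensorial[OF e.x_forms[OF i]] e.alternating_W[of "[i]"] i
        by (simp_all add: wedges_Cons wedges_Nil wedge_scalar_right[abs_def])
      show ?thesis
        unfolding xi by (subst ext_d_lin2_const[OF A ei ei]) (simp add: lin2_def)
    qed
    also have "ext_d A (e i) = lin_form e (cp ! (i - 1))"
      using e i unfolding has_lie_algebra_def by blast
    also have "f i * lin_form e (cp ! (i - 1)) Xs p = lin_form x
      (lcp_equations (k1 * \<mu>) (k2 * \<mu>) (k3 * \<mu>) (k4 * \<mu>) (k5 * \<mu>) (k6 * \<mu>)
         (\<alpha>1 * \<mu>) (\<beta>1 * \<mu>) (\<alpha>2 * \<mu>) (\<beta>2 * \<mu>) (\<alpha>4 * \<mu>) (\<alpha>5 * \<mu>) i) Xs p"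
    proof -
      \<comment> \<open>Since m = \<mu> * f 7, the identity f i * f 7 = f j * f k turns f i * m *
        e^{jk} into \<mu> * x^{jk}; the first alternative disposes of absent terms.\<close>
      have scale: "a * (u powr r * u powr (1/2)) = a * (u powr s * u powr t)"
        if "a = 0 \<or> r + 1/2 = s + t" for a r s t
        using that by (auto simp flip: powr_add)
      have f: "\<alpha>1 * (f 1 * f 7) = \<alpha>1 * (f 3 * f 6)" "\<beta>1 * (f 1 * f 7) = \<beta>1 * (f 4 * f 5)"
        "\<alpha>2 * (f 2 * f 7) = \<alpha>2 * (f 3 * f 5)" "\<beta>2 * (f 2 * f 7) = \<beta>2 * (f 4 * f 6)"
        "\<alpha>4 * (f 4 * f 7) = \<alpha>4 * (f 2 * f 6)" "\<alpha>5 * (f 5 * f 7) = \<alpha>5 * (f 2 * f 3)"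
        using scale[OF exponents(1)] scale[OF exponents(2)] scale[OF exponents(3)]
          scale[OF exponents(4)] scale[OF exponents(5)] scale[OF exponents(6)]
        by (simp_all add: f_def del: mult_cancel_left mult_cancel_right)
      have m7: "m = \<mu> * f 7" using m\<mu> by (simp add: f_def)
      have "i \<in> {1,2,3,4,5,6,7}" using i by auto
      with cp have cpi: "lin_form e (cp ! (i - 1)) Xs p = lin_form e
        (lcp_equations (k1 * m) (k2 * m) (k3 * m) (k4 * m) (k5 * m) (k6 * m)
           (\<alpha>1 * m) (\<beta>1 * m) (\<alpha>2 * m) (\<beta>2 * m) (\<alpha>4 * m) (\<alpha>5 * m) i) Xs p"
        by blast
      let ?G = "\<lambda>i. f i * lin_form e
          (lcp_equations (k1 * m) (k2 * m) (k3 * m) (k4 * m) (k5 * m) (k6 * m)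
             (\<alpha>1 * m) (\<beta>1 * m) (\<alpha>2 * m) (\<beta>2 * m) (\<alpha>4 * m) (\<alpha>5 * m) i) Xs p
        = lin_form e (map (\<lambda>(c, I). (c * prod_list (map f I), I))
          (lcp_equations (k1 * \<mu>) (k2 * \<mu>) (k3 * \<mu>) (k4 * \<mu>) (k5 * \<mu>) (k6 * \<mu>)
             (\<alpha>1 * \<mu>) (\<beta>1 * \<mu>) (\<alpha>2 * \<mu>) (\<beta>2 * \<mu>) (\<alpha>4 * \<mu>) (\<alpha>5 * \<mu>) i)) Xs p"
      have "?G 1" "?G 2" "?G 3" "?G 4" "?G 5" "?G 6"
        by (simp add: lcp_equations_def lin_form_def, use f m7 in algebra)+
      moreover have "?G 7" by (simp add: lcp_equations_def lin_form_def)
      moreover have "i = 1 \<or> i = 2 \<or> i = 3 \<or> i = 4 \<or> i = 5 \<or> i = 6 \<or> i = 7" using i by auto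
      ultimately have "?G i" by (elim disjE) simp_all
      then show ?thesis
        unfolding cpi x_def[abs_def] lin_form_scaled_coframe .
    qed
    finally show "ext_d A (x i) Xs p = \<dots>" .
  qed
  have s: "lin_form e
    [(u powr (r1 + r2 + 1/2), [1,2,7]), (u powr (r3 + r4 + 1/2), [3,4,7]), (u powr (r5 + r6 + 1/2), [5,6,7]),
     (u powr (r1 + r3 + r5), [1,3,5]), (- (u powr (r1 + r4 + r6)), [1,4,6]),
     (- (u powr (r2 + r3 + r6)), [2,3,6]), (- (u powr (r2 + r4 + r5)), [2,4,5])] = g2_std x"
    unfolding g2_std_def x_def[abs_def]
    by (intro ext, subst lin_form_scaled_coframe) (simp add: f_def powr_add mult.assoc)
  interpret lcp_coframe A x "\<lambda>i h p. (1 / f i) * E i h p + 0 * E i h p"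
    "k1 * \<mu>" "k2 * \<mu>" "k3 * \<mu>" "k4 * \<mu>" "k5 * \<mu>" "k6 * \<mu>"
    "\<alpha>1 * \<mu>" "\<beta>1 * \<mu>" "\<alpha>2 * \<mu>" "\<beta>2 * \<mu>" "\<alpha>4 * \<mu>" "\<alpha>5 * \<mu>" \<mu>
    by unfold_locales
       (use d d_phi[THEN arg_cong[where f = "\<lambda>z. z * \<mu>"]]
          d_star_phi[THEN arg_cong[where f = "\<lambda>z. z * \<mu>"]] in \<open>simp_all add: algebra_simps\<close>)
  have "\<mu> \<noteq> 0" using m u by (simp add: \<mu>_def)
  \<comment> \<open>The soliton equations are quadratic in the structure constants, so the
    normalised constant c is multiplied by the square of \<mu>.\<close>
  then have "c * \<mu>\<^sup>2 < 0" using c(1) by (simp add: mult_neg_pos)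
  then show ?thesis
    unfolding s
    by (rule shrinking_soliton)
       (use c(2-)[THEN arg_cong[where f = "\<lambda>z. z * \<mu>\<^sup>2"]] in \<open>simp_all add: algebra_simps power2_eq_square\<close>)
qed

text \<open>In all seven cases the coefficient of x^347 gives c = 3 (\<alpha>4 - k3 - k4), and then
  u = 1 + (2/3) c m^2 t and r_i = 1/2 - 3 k_i / (2 c), with k_7 = 0. These values make the family
  evolve by its Laplacian: the coefficient of e^{ijk} has logarithmic t-derivative (c - k_i - k_j -
  k_k) m^2 / u.\<close>

lemma cp1_soliton:
  fixes A :: "('a::{t2_space,second_countable_topology}, real^7) atlas"
  assumes A: "smooth_atlas A" and m: "m \<noteq> 0" and e: "has_lie_algebra A mul one (cp1 m) e" and t: "t < 1 / (4 * m^2)"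
  shows "shrinking_laplacian_soliton A (phi1 m t e)"
proof -
  define u where "u = 1 - 4 * m^2 * t"
  have u: "u > 0" using m t by (simp add: u_def field_simps)
  note soliton = scaled_soliton[OF A e u m, where c = "-6"
      and ?k1.0 = "1" and ?k2.0 = "1" and ?k3.0 = "1" and ?k4.0 = "1" and ?k5.0 = "1" and ?k6.0 = "1"
      and ?\<alpha>1.0 = "0" and ?\<beta>1.0 = "0" and ?\<alpha>2.0 = "0" and ?\<beta>2.0 = "0" and ?\<alpha>4.0 = "0" and ?\<alpha>5.0 = "0"
      and ?r1.0 = "3/4" and ?r2.0 = "3/4" and ?r3.0 = "3/4" and ?r4.0 = "3/4" and ?r5.0 = "3/4" and ?r6.0 = "3/4"]
  \<comment> \<open>The scaled coframe yields real exponents throughout, whereas exponent 2 is a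
    numeral power in \<open>phi1\<close>.\<close>
  have u2: "u powr 2 = u^2" using u by simp
  show ?thesis
    unfolding phi1_def u_def[symmetric] Let_def
    by (rule soliton[THEN back_subst[where P = "shrinking_laplacian_soliton A"]])
       (simp_all add: cp1_def lcp_equations_def lin_form_def u2 fun_eq_iff algebra_simps)
qed

lemma cp2_soliton:
  fixes A :: "('a::{t2_space,second_countable_topology}, real^7) atlas"
  assumes A: "smooth_atlas A" and m: "m \<noteq> 0" and e: "has_lie_algebra A mul one (cp2 m) e" and t: "t < 3 / (10 * m^2)"
  shows "shrinking_laplacian_soliton A (phi2 m t e)"
proof -
  define u where "u = 1 - 10/3 * m^2 * t"
  have u: "u > 0" using m t by (simp add: u_def field_simps)
  note soliton = scaled_soliton[OF A e u m, where c = "-5"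
      and ?k1.0 = "4/3" and ?k2.0 = "1" and ?k3.0 = "2/3" and ?k4.0 = "1" and ?k5.0 = "1" and ?k6.0 = "2/3"
      and ?\<alpha>1.0 = "2/3" and ?\<beta>1.0 = "0" and ?\<alpha>2.0 = "0" and ?\<beta>2.0 = "0" and ?\<alpha>4.0 = "0" and ?\<alpha>5.0 = "0"
      and ?r1.0 = "9/10" and ?r2.0 = "4/5" and ?r3.0 = "7/10" and ?r4.0 = "4/5" and ?r5.0 = "4/5" and ?r6.0 = "7/10"]
  have u2: "u powr 2 = u^2" using u by simp
  show ?thesis
    unfolding phi2_def u_def[symmetric] Let_def
    \<comment> \<open>The general result follows the order of \<open>g2_std\<close> and has sums of
      r_i as exponents; \<open>back_subst\<close> leaves its identification with the grouping in
      \<open>phi2\<close> as an equation of forms.\<close>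
    by (rule soliton[THEN back_subst[where P = "shrinking_laplacian_soliton A"]])
       (simp_all add: cp2_def lcp_equations_def lin_form_def u2 fun_eq_iff algebra_simps)
qed

lemma cp3_soliton:
  fixes A :: "('a::{t2_space,second_countable_topology}, real^7) atlas"
  assumes A: "smooth_atlas A" and m: "m \<noteq> 0" and e: "has_lie_algebra A mul one (cp3 m) e" and t: "t < 1 / (3 * m^2)"
  shows "shrinking_laplacian_soliton A (phi3 m t e)"
proof -
  define u where "u = 1 - 3 * m^2 * t"
  have u: "u > 0" using m t by (simp add: u_def field_simps)
  note soliton = scaled_soliton[OF A e u m, where c = "-(9/2)"
      and ?k1.0 = "3/2" and ?k2.0 = "1" and ?k3.0 = "3/4" and ?k4.0 = "3/4" and ?k5.0 = "3/4" and ?k6.0 = "3/4"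
      and ?\<alpha>1.0 = "1/2" and ?\<beta>1.0 = "1/2" and ?\<alpha>2.0 = "0" and ?\<beta>2.0 = "0" and ?\<alpha>4.0 = "0" and ?\<alpha>5.0 = "0"
      and ?r1.0 = "1" and ?r2.0 = "5/6" and ?r3.0 = "3/4" and ?r4.0 = "3/4" and ?r5.0 = "3/4" and ?r6.0 = "3/4"]
  have u2: "u powr 2 = u^2" using u by simp
  show ?thesis
    unfolding phi3_def u_def[symmetric] Let_def
    by (rule soliton[THEN back_subst[where P = "shrinking_laplacian_soliton A"]])
       (simp_all add: cp3_def lcp_equations_def lin_form_def u2 fun_eq_iff algebra_simps)
qed

lemma cp4_soliton:
  fixes A :: "('a::{t2_space,second_countable_topology}, real^7) atlas"
  assumes A: "smooth_atlas A" and m: "m \<noteq> 0" and e: "has_lie_algebra A mul one (cp4 m) e" and t: "t < 5 / (14 * m^2)"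
  shows "shrinking_laplacian_soliton A (phi4 m t e)"
proof -
  define u where "u = 1 - 14/5 * m^2 * t"
  have u: "u > 0" using m t by (simp add: u_def field_simps)
  note soliton = scaled_soliton[OF A e u m, where c = "-(21/5)"
      and ?k1.0 = "7/5" and ?k2.0 = "6/5" and ?k3.0 = "4/5" and ?k4.0 = "3/5" and ?k5.0 = "4/5" and ?k6.0 = "3/5"
      and ?\<alpha>1.0 = "2/5" and ?\<beta>1.0 = "2/5" and ?\<alpha>2.0 = "0" and ?\<beta>2.0 = "-(2/5)" and ?\<alpha>4.0 = "0" and ?\<alpha>5.0 = "0"
      and ?r1.0 = "1" and ?r2.0 = "13/14" and ?r3.0 = "11/14" and ?r4.0 = "5/7" and ?r5.0 = "11/14" and ?r6.0 = "5/7"]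
  have u2: "u powr 2 = u^2" using u by simp
  show ?thesis
    unfolding phi4_def u_def[symmetric] Let_def
    by (rule soliton[THEN back_subst[where P = "shrinking_laplacian_soliton A"]])
       (simp_all add: cp4_def lcp_equations_def lin_form_def u2 fun_eq_iff algebra_simps)
qed

lemma cp5_soliton:
  fixes A :: "('a::{t2_space,second_countable_topology}, real^7) atlas"
  assumes A: "smooth_atlas A" and m: "m \<noteq> 0" and e: "has_lie_algebra A mul one (cp5 m) e" and t: "t < 1 / (3 * m^2)"
  shows "shrinking_laplacian_soliton A (phi5 m t e)"
proof -
  define u where "u = 1 - 3 * m^2 * t"
  have u: "u > 0" using m t by (simp add: u_def field_simps)
  note soliton = scaled_soliton[OF A e u m, where c = "-(9/2)"
      and ?k1.0 = "5/4" and ?k2.0 = "5/4" and ?k3.0 = "1" and ?k4.0 = "1/2" and ?k5.0 = "3/4" and ?k6.0 = "3/4"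
      and ?\<alpha>1.0 = "0" and ?\<beta>1.0 = "1/2" and ?\<alpha>2.0 = "0" and ?\<beta>2.0 = "-(1/2)" and ?\<alpha>4.0 = "0" and ?\<alpha>5.0 = "0"
      and ?r1.0 = "11/12" and ?r2.0 = "11/12" and ?r3.0 = "5/6" and ?r4.0 = "2/3" and ?r5.0 = "3/4" and ?r6.0 = "3/4"]
  have u2: "u powr 2 = u^2" using u by simp
  show ?thesis
    unfolding phi5_def u_def[symmetric] Let_def
    by (rule soliton[THEN back_subst[where P = "shrinking_laplacian_soliton A"]])
       (simp_all add: cp5_def lcp_equations_def lin_form_def u2 fun_eq_iff algebra_simps)
qed

text \<open>Modulo e^7 the equations combine to d(e^2 + i e^1) = (m/3) (e^3 + i e^4) wedge (e^5 + i
  e^6), the complex Heisenberg algebra.\<close>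

lemma cp6_soliton:
  fixes A :: "('a::{t2_space,second_countable_topology}, real^7) atlas"
  assumes A: "smooth_atlas A" and m: "m \<noteq> 0" and e: "has_lie_algebra A mul one (cp6 m) e" and t: "t < 3 / (8 * m^2)"
  shows "shrinking_laplacian_soliton A (phi6 m t e)"
proof -
  define u where "u = 1 - 8/3 * m^2 * t"
  have u: "u > 0" using m t by (simp add: u_def field_simps)
  note soliton = scaled_soliton[OF A e u m, where c = "-4"
      and ?k1.0 = "4/3" and ?k2.0 = "4/3" and ?k3.0 = "2/3" and ?k4.0 = "2/3" and ?k5.0 = "2/3" and ?k6.0 = "2/3"
      and ?\<alpha>1.0 = "1/3" and ?\<beta>1.0 = "1/3" and ?\<alpha>2.0 = "1/3" and ?\<beta>2.0 = "-(1/3)" and ?\<alpha>4.0 = "0" and ?\<alpha>5.0 = "0"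
      and ?r1.0 = "1" and ?r2.0 = "1" and ?r3.0 = "3/4" and ?r4.0 = "3/4" and ?r5.0 = "3/4" and ?r6.0 = "3/4"]
  have u2: "u powr 2 = u^2" using u by simp
  show ?thesis
    unfolding phi6_def u_def[symmetric] Let_def
    by (rule soliton[THEN back_subst[where P = "shrinking_laplacian_soliton A"]])
       (simp_all add: cp6_def lcp_equations_def lin_form_def u2 fun_eq_iff algebra_simps)
qed

text \<open>The only case with bracket terms in de^4 and de^5: here \<alpha>4 enters c, and x^347,
  x^567 scale with exponent 15/7 instead of 2.\<close>

lemma cp7_soliton:
  fixes A :: "('a::{t2_space,second_countable_topology}, real^7) atlas"
  assumes A: "smooth_atlas A" and m: "m \<noteq> 0" and e: "has_lie_algebra A mul one (cp7 m) e" and t: "t < 5 / (14 * m^2)"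
  shows "shrinking_laplacian_soliton A (phi7 m t e)"
proof -
  define u where "u = 1 - 14/5 * m^2 * t"
  have u: "u > 0" using m t by (simp add: u_def field_simps)
  note soliton = scaled_soliton[OF A e u m, where c = "-(21/5)"
      and ?k1.0 = "6/5" and ?k2.0 = "3/5" and ?k3.0 = "3/5" and ?k4.0 = "6/5" and ?k5.0 = "6/5" and ?k6.0 = "3/5"
      and ?\<alpha>1.0 = "2/5" and ?\<beta>1.0 = "0" and ?\<alpha>2.0 = "0" and ?\<beta>2.0 = "0" and ?\<alpha>4.0 = "2/5" and ?\<alpha>5.0 = "2/5"
      and ?r1.0 = "13/14" and ?r2.0 = "5/7" and ?r3.0 = "5/7" and ?r4.0 = "13/14" and ?r5.0 = "13/14" and ?r6.0 = "5/7"]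
  have u2: "u powr 2 = u^2" using u by simp
  show ?thesis
    unfolding phi7_def u_def[symmetric] Let_def
    by (rule soliton[THEN back_subst[where P = "shrinking_laplacian_soliton A"]])
       (simp_all add: cp7_def lcp_equations_def lin_form_def u2 fun_eq_iff algebra_simps)
qed

theorem proposition3p4:
  fixes m t :: real
    and A :: "('a::{t2_space,second_countable_topology}, real^7) atlas"
    and mul :: "'a \<Rightarrow> 'a \<Rightarrow> 'a" and one :: 'a and ginv :: "'a \<Rightarrow> 'a"
    and e :: "nat \<Rightarrow> 'a form"
  assumes "m \<noteq> 0"
    and "lie_group A mul one ginv"
  shows
    "(has_lie_algebra A mul one (cp1 m) e \<and> t < 1 / (4 * m^2) \<longrightarrow>
        shrinking_laplacian_soliton A (phi1 m t e)) \<and>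
     (has_lie_algebra A mul one (cp2 m) e \<and> t < 3 / (10 * m^2) \<longrightarrow>
        shrinking_laplacian_soliton A (phi2 m t e)) \<and>
     (has_lie_algebra A mul one (cp3 m) e \<and> t < 1 / (3 * m^2) \<longrightarrow>
        shrinking_laplacian_soliton A (phi3 m t e)) \<and>
     (has_lie_algebra A mul one (cp4 m) e \<and> t < 5 / (14 * m^2) \<longrightarrow>
        shrinking_laplacian_soliton A (phi4 m t e)) \<and>
     (has_lie_algebra A mul one (cp5 m) e \<and> t < 1 / (3 * m^2) \<longrightarrow>
        shrinking_laplacian_soliton A (phi5 m t e)) \<and>
     (has_lie_algebra A mul one (cp6 m) e \<and> t < 3 / (8 * m^2) \<longrightarrow>
        shrinking_laplacian_soliton A (phi6 m t e)) \<and>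
     (has_lie_algebra A mul one (cp7 m) e \<and> t < 5 / (14 * m^2) \<longrightarrow>
        shrinking_laplacian_soliton A (phi7 m t e))"
proof -
  have A: "smooth_atlas A" using assms(2) by (simp add: lie_group_def)
  note solitons = cp1_soliton[OF A assms(1)] cp2_soliton[OF A assms(1)] cp3_soliton[OF A assms(1)]
    cp4_soliton[OF A assms(1)] cp5_soliton[OF A assms(1)] cp6_soliton[OF A assms(1)] cp7_soliton[OF A assms(1)]
  show ?thesis
    by (intro conjI impI; rule solitons, erule conjunct1, erule conjunct2)
qed

end
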